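(* Let $0<k<n$ be integers and let ${\tt vdW}(n,k)$ be the van der Waerden complex. Then (i) ${\tt vdW}(n,k)$ is vertex decomposable if and only if $n\le 6$, or $n>6$ and $k=1$, or $n>6$ and $\frac{n}{2}\le k<n$; (ii) ${\tt vdW}(n,k)$ is pure but not Cohen-Macaulay (over a field $\Bbbk$) if and only if $n>6$ and $2\le k<\frac{n}{2}$.
   Context: Let $V=\{x_1,\ldots,x_n\}$ and $0<k<n$. The van der Waerden complex ${\tt vdW}(n,k)$ is the simplicial complex on $V$ whose facets are exactly the sets $\{x_i,x_{i+d},x_{i+2d},\ldots,x_{i+kd}\}$ for integers $d$ and $i$ with $1\le i<i+kd\le n$ (so $d\ge 1$); i.e. facets correspond to arithmetic progressions of length $k+1$ in $\{1,\ldots,n\}$. A pure simplicial complex $\Delta$ is vertex decomposable if either $\Delta=\emptyset$ or $\Delta$ is a simplex, or there exists a vertex $x$ such that both the link $\mathrm{lk}_\Delta(x)=\{H\in\Delta: x\notin H,\ H\cup\{x\}\in\Delta\}$ and the deletion $\mathrm{del}_\Delta(x)=\{H\in\Delta: x\notin H\}$ are vertex decomposable. A simplicial complex $\Delta$ is Cohen-Macaulay over the field $\Bbbk$ if its Stanley-Reisner ring $\Bbbk[x_1,\ldots,x_n]/I_\Delta$ is Cohen-Macaulay; equivalently (Eagon-Reiner), the Stanley-Reisner ideal $I_{\Delta^\vee}$ of the Alexander dual $\Delta^\vee=\{V\setminus F: F\notin\Delta\}$ has a linear minimal free resolution over $\Bbbk[x_1,\ldots,x_n]$. *)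

theory Defs
  imports
    Complex_Main
    "HOL-Library.Extended_Nat"
    "HOL-Library.Poly_Mapping"
    "HOL-Algebra.QuotRing"
    "HOL-Algebra.Ring_Divisibility"
begin

section \<open>Simplicial complexes\<close>

text \<open>A complex is given by its set of faces, so the void complex \<open>{}\<close> (no faces) and the
  complex \<open>{{}}\<close> (the simplex on no vertices) are different.\<close>

definition simplicial_complex :: "'v set set \<Rightarrow> bool" where
  "simplicial_complex \<Delta> \<longleftrightarrow> (\<forall>F\<in>\<Delta>. finite F \<and> (\<forall>G. G \<subseteq> F \<longrightarrow> G \<in> \<Delta>))"

definition facets :: "'v set set \<Rightarrow> 'v set set" where
  "facets \<Delta> = {F \<in> \<Delta>. \<forall>G\<in>\<Delta>. F \<subseteq> G \<longrightarrow> F = G}"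

definition pure_complex :: "'v set set \<Rightarrow> bool" where
  "pure_complex \<Delta> \<longleftrightarrow> simplicial_complex \<Delta> \<and> (\<forall>F\<in>facets \<Delta>. \<forall>G\<in>facets \<Delta>. card F = card G)"

definition link :: "'v set set \<Rightarrow> 'v \<Rightarrow> 'v set set" where
  "link \<Delta> x = {H \<in> \<Delta>. x \<notin> H \<and> H \<union> {x} \<in> \<Delta>}"

definition deletion :: "'v set set \<Rightarrow> 'v \<Rightarrow> 'v set set" where
  "deletion \<Delta> x = {H \<in> \<Delta>. x \<notin> H}"

inductive vertex_decomposable :: "'v set set \<Rightarrow> bool" where
  void: "vertex_decomposable {}"
| simplex: "finite F \<Longrightarrow> vertex_decomposable (Pow F)"
| decompose: "\<lbrakk>pure_complex \<Delta>; {x} \<in> \<Delta>;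
    vertex_decomposable (link \<Delta> x); vertex_decomposable (deletion \<Delta> x)\<rbrakk>
    \<Longrightarrow> vertex_decomposable \<Delta>"

text \<open>The vertex \<open>x\<^sub>i\<close> is represented by the number \<open>i\<close>. The lemma \<open>facets_vdW\<close> below confirms
  that the generating progressions are exactly the facets.\<close>

definition progressions :: "nat \<Rightarrow> nat \<Rightarrow> nat set set" where
  "progressions n k = {(\<lambda>j. i + j * d) ` {0..k} | i d. 1 \<le> i \<and> i < i + k * d \<and> i + k * d \<le> n}"

definition vdW :: "nat \<Rightarrow> nat \<Rightarrow> nat set set" where
  "vdW n k = {F. \<exists>A\<in>progressions n k. F \<subseteq> A}"

lemma progressions_finite_card:
  assumes "A \<in> progressions n k"
  shows "finite A \<and> card A = k + 1"
proof -
  obtain i d where A: "A = (\<lambda>j. i + j * d) ` {0..k}" and "k * d > 0"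
    using assms unfolding progressions_def by auto
  then have "inj_on (\<lambda>j. i + j * d) {0..k}"
    by (auto simp: inj_on_def)
  then show ?thesis
    unfolding A by (simp add: card_image)
qed

lemma simplicial_complex_vdW: "simplicial_complex (vdW n k)"
  unfolding simplicial_complex_def vdW_def
  by (blast dest: progressions_finite_card intro: finite_subset)

lemma facets_vdW: "facets (vdW n k) = progressions n k"
proof
  show "facets (vdW n k) \<subseteq> progressions n k"
    unfolding facets_def vdW_def by blast
  show "progressions n k \<subseteq> facets (vdW n k)"
  proof
    fix A assume A: "A \<in> progressions n k"
    have "A = G" if "A \<subseteq> G" "G \<subseteq> B" "B \<in> progressions n k" for G B
      using progressions_finite_card[OF A] progressions_finite_card[OF that(3)] that
        card_subset_eq[of B A] by auto
    then show "A \<in> facets (vdW n k)"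
      using A unfolding facets_def vdW_def by blast
  qed
qed


section \<open>Cohen-Macaulay rings\<close>

definition regular_sequence :: "('a, 'b) ring_scheme \<Rightarrow> 'a list \<Rightarrow> bool" where
  "regular_sequence R xs \<longleftrightarrow>
     set xs \<subseteq> carrier R \<and> Idl\<^bsub>R\<^esub> (set xs) \<noteq> carrier R \<and>
     (\<forall>i<length xs. \<forall>a\<in>carrier R.
        xs ! i \<otimes>\<^bsub>R\<^esub> a \<in> Idl\<^bsub>R\<^esub> (set (take i xs)) \<longrightarrow> a \<in> Idl\<^bsub>R\<^esub> (set (take i xs)))"

definition ideal_depth :: "('a, 'b) ring_scheme \<Rightarrow> 'a set \<Rightarrow> enat" where
  "ideal_depth R I = Sup {enat (length xs) | xs. regular_sequence R xs \<and> set xs \<subseteq> I}"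

definition prime_height :: "('a, 'b) ring_scheme \<Rightarrow> 'a set \<Rightarrow> enat" where
  "prime_height R P = Sup {enat r | r. \<exists>Q :: nat \<Rightarrow> 'a set.
     (\<forall>i\<le>r. primeideal (Q i) R) \<and> (\<forall>i<r. Q i \<subset> Q (Suc i)) \<and> Q r = P}"

text \<open>The definition of Eisenbud, Commutative Algebra, Chapter 18: depth equals codimension at
  every maximal ideal. For a maximal ideal of a Noetherian ring neither side changes on
  localization, so this says that all local rings at maximal ideals are Cohen-Macaulay.\<close>

definition Cohen_Macaulay_ring :: "('a, 'b) ring_scheme \<Rightarrow> bool" where
  "Cohen_Macaulay_ring R \<longleftrightarrow> cring R \<and> noetherian_ring R \<and>
     (\<forall>M. maximalideal M R \<longrightarrow> ideal_depth R M = prime_height R M)"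


section \<open>Stanley-Reisner rings\<close>

text \<open>A polynomial maps exponent vectors to coefficients; both maps are finitely supported, and
  multiplication on the type is convolution. Variables are restricted to \<open>V\<close> by the carrier.\<close>

definition poly_ring :: "'v set \<Rightarrow> (('v \<Rightarrow>\<^sub>0 nat) \<Rightarrow>\<^sub>0 'k::field) ring" where
  "poly_ring V = \<lparr>carrier = {p. \<forall>m\<in>Poly_Mapping.keys p. Poly_Mapping.keys m \<subseteq> V},
     mult = (*), one = 1, zero = 0, add = (+)\<rparr>"

definition squarefree_monomial :: "'v set \<Rightarrow> (('v \<Rightarrow>\<^sub>0 nat) \<Rightarrow>\<^sub>0 'k::field)" where
  "squarefree_monomial F = (\<Prod>v\<in>F. Poly_Mapping.single (Poly_Mapping.single v 1) 1)"

definition stanley_reisner_ideal :: "'v set \<Rightarrow> 'v set set \<Rightarrow> (('v \<Rightarrow>\<^sub>0 nat) \<Rightarrow>\<^sub>0 'k::field) set" where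
  "stanley_reisner_ideal V \<Delta> =
     Idl\<^bsub>poly_ring V\<^esub> {squarefree_monomial F | F. F \<subseteq> V \<and> F \<notin> \<Delta>}"

definition stanley_reisner_ring ::
    "'v set \<Rightarrow> 'v set set \<Rightarrow> (('v \<Rightarrow>\<^sub>0 nat) \<Rightarrow>\<^sub>0 'k::field) set ring" where
  "stanley_reisner_ring V \<Delta> = poly_ring V Quot stanley_reisner_ideal V \<Delta>"

definition Cohen_Macaulay_over :: "'k::field itself \<Rightarrow> 'v set \<Rightarrow> 'v set set \<Rightarrow> bool" where
  "Cohen_Macaulay_over _ V \<Delta> \<longleftrightarrow>
     Cohen_Macaulay_ring (stanley_reisner_ring V \<Delta> :: (('v \<Rightarrow>\<^sub>0 nat) \<Rightarrow>\<^sub>0 'k) set ring)"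

lemma cring_poly_ring: "cring (poly_ring V :: (('v \<Rightarrow>\<^sub>0 nat) \<Rightarrow>\<^sub>0 'k::field) ring)"
proof (rule cringI)
  let ?R = "poly_ring V :: (('v \<Rightarrow>\<^sub>0 nat) \<Rightarrow>\<^sub>0 'k) ring"
  show "abelian_group ?R"
  proof (rule abelian_groupI)
    fix x y assume "x \<in> carrier ?R" "y \<in> carrier ?R"
    then show "x \<oplus>\<^bsub>?R\<^esub> y \<in> carrier ?R"
      using Poly_Mapping.keys_add[of x y] by (auto simp: poly_ring_def)
  next
    fix x assume "x \<in> carrier ?R"
    then have "- x \<in> carrier ?R" "- x \<oplus>\<^bsub>?R\<^esub> x = \<zero>\<^bsub>?R\<^esub>"
      by (auto simp: poly_ring_def)
    then show "\<exists>y\<in>carrier ?R. y \<oplus>\<^bsub>?R\<^esub> x = \<zero>\<^bsub>?R\<^esub>"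
      by blast
  qed (simp_all add: poly_ring_def add.assoc add.commute)
  show "comm_monoid ?R"
  proof (rule comm_monoidI)
    fix x y assume xy: "x \<in> carrier ?R" "y \<in> carrier ?R"
    have "Poly_Mapping.keys m \<subseteq> V" if m: "m \<in> Poly_Mapping.keys (x * y)" for m
    proof -
      obtain a b where "m = a + b" "a \<in> Poly_Mapping.keys x" "b \<in> Poly_Mapping.keys y"
        using m keys_mult[of x y] by blast
      then show ?thesis
        using xy Poly_Mapping.keys_add[of a b] unfolding poly_ring_def by fastforce
    qed
    then show "x \<otimes>\<^bsub>?R\<^esub> y \<in> carrier ?R"
      by (simp add: poly_ring_def)
  qed (simp_all add: poly_ring_def mult.assoc mult.commute)
qed (simp add: poly_ring_def distrib_right)

lemma ideal_stanley_reisner_ideal: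
  fixes \<Delta> :: "'v set set"
  assumes "finite V"
  shows "ideal (stanley_reisner_ideal V \<Delta>) (poly_ring V :: (('v \<Rightarrow>\<^sub>0 nat) \<Rightarrow>\<^sub>0 'k::field) ring)"
proof -
  let ?R = "poly_ring V :: (('v \<Rightarrow>\<^sub>0 nat) \<Rightarrow>\<^sub>0 'k) ring"
  interpret cring ?R by (rule cring_poly_ring)
  have 1: "squarefree_monomial F \<in> carrier ?R" if "F \<subseteq> V" for F
  proof -
    have "finite F" using that assms by (rule finite_subset)
    then show ?thesis using that
    proof (induction F rule: finite_induct)
      case empty
      have "(squarefree_monomial {} :: ('v \<Rightarrow>\<^sub>0 nat) \<Rightarrow>\<^sub>0 'k) = \<one>\<^bsub>?R\<^esub>"
        unfolding squarefree_monomial_def poly_ring_def by simp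
      then show ?case using one_closed by simp
    next
      case (insert v F)
      let ?x = "Poly_Mapping.single (Poly_Mapping.single v 1) 1 :: ('v \<Rightarrow>\<^sub>0 nat) \<Rightarrow>\<^sub>0 'k"
      have x: "?x \<in> carrier ?R"
        using insert.prems unfolding poly_ring_def by simp
      have "squarefree_monomial (insert v F) = ?x \<otimes>\<^bsub>?R\<^esub> squarefree_monomial F"
        using insert.hyps unfolding squarefree_monomial_def poly_ring_def by simp
      moreover have "squarefree_monomial F \<in> carrier ?R"
        using insert.IH insert.prems by blast
      ultimately show ?case
        using m_closed[OF x] by metis
    qed
  qed
  show ?thesis
    unfolding stanley_reisner_ideal_def by (rule genideal_ideal) (use 1 in blast)
qed

lemma cring_stanley_reisner_ring:
  assumes "finite V"
  shows "cring (stanley_reisner_ring V \<Delta> :: (('v \<Rightarrow>\<^sub>0 nat) \<Rightarrow>\<^sub>0 'k::field) set ring)"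
  unfolding stanley_reisner_ring_def
  using ideal.quotient_is_cring[OF ideal_stanley_reisner_ideal[OF assms] cring_poly_ring] .

end

theory Submission
  imports Defs
begin

text \<open>
  Let \<open>A\<close> be the polynomial ring in all variables and \<open>I\<^sub>\<Delta>\<close> the ideal of polynomials without
  monomials supported on faces of \<open>\<Delta>\<close>. By Zariski's lemma every maximal ideal \<open>M\<close> above \<open>I\<^sub>\<Delta>\<close>
  contains polynomials \<open>g\<^sub>v = x\<^sub>v q\<^sub>v(x\<^sub>v)\<close>. If \<open>\<Delta>\<close> is vertex decomposable with facets of size \<open>d\<close>, the
  elementary symmetric polynomials \<open>e\<^sub>d, \<dots>, e\<^sub>1\<close> in the \<open>g\<^sub>v\<close> form a regular sequence in \<open>M\<close>: shedding
  a vertex makes \<open>A/I\<^sub>\<Delta>\<close> an extension of the rings of the deletion and of a cone over the link, which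
  reduces the claim to simplices. Together with a counting bound for the length of chains of
  primes and the inequality depth \<open>\<le>\<close> height, this makes \<open>\<Delta>\<close> Cohen-Macaulay.

  Conversely, if the link of a face \<open>G\<close> is disconnected, then the Koszul cohomology of \<open>A/I\<^sub>\<Delta>\<close> at the
  point with coordinates \<open>1\<close> on \<open>G\<close> and \<open>0\<close> elsewhere does not vanish in degree \<open>card G + 1\<close>, so that
  no regular sequence in the maximal ideal of this point is longer than \<open>card G + 1\<close>. For \<open>n > 6\<close> and
  \<open>2 \<le> k < n/2\<close> this applies to \<open>G = {1, 3, \<dots>, 1 + 2 \<lfloor>k/2\<rfloor>}\<close>, and to \<open>G = {1}\<close> if \<open>k = 2\<close>.
\<close>

text \<open>The Cohen-Macaulay condition concerns all maximal ideals over an arbitrary field, so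
  neither the homogeneous one nor rational points suffice; \<open>M\<close> enters only through the
  one-variable polynomials. Their symmetric combination is decisive: the deletion and the cone over
  the link have different facets, yet one and the same list must be regular for both before they can
  be glued. The factor \<open>x\<^sub>v\<close> kills the polynomials of vertices missing from a
  face, so on a simplex the top elementary symmetric polynomial is a plain product. The cone stands
  in for the link because its facets keep the size of those of the complex. In the converse, the
  coordinates 1 on \<open>G\<close> make these variables invertible near the point, which therefore
  sees the link of \<open>G\<close>. Setting them to 1 costs \<open>card G\<close> regular elements,
  and a separation of the link leaves a class in degree one. A face with two vertices beyond
  \<open>G\<close> yields a longer chain of primes than this depth allows. For \<open>k = 2\<close>
  the general \<open>G\<close> would leave only one vertex in a facet, hence the other choice.
  Variables outside the vertex set lie in the ideal, so admitting all of them leaves the quotient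
  unchanged and makes the ring a whole type.\<close>

abbreviation keys where "keys \<equiv> Poly_Mapping.keys"
abbreviation lookup where "lookup \<equiv> Poly_Mapping.lookup"
abbreviation single where "single \<equiv> Poly_Mapping.single"

section \<open>Ideals and regular sequences in a commutative ring\<close>

text \<open>The ring is a whole type here, so no carrier has to be tracked;
  \<open>ring_presentation\<close> transports the results to the ideals of HOL-Algebra.\<close>

definition is_ideal :: "'a::comm_ring_1 set \<Rightarrow> bool" where
  "is_ideal J \<longleftrightarrow> 0 \<in> J \<and> (\<forall>a\<in>J. \<forall>b\<in>J. a + b \<in> J) \<and> (\<forall>a\<in>J. \<forall>b. b * a \<in> J)"

definition is_prime_ideal :: "'a::comm_ring_1 set \<Rightarrow> bool" where
  "is_prime_ideal P \<longleftrightarrow> is_ideal P \<and> 1 \<notin> P \<and> (\<forall>a b. a * b \<in> P \<longrightarrow> a \<in> P \<or> b \<in> P)"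

text \<open>The last clause says that the quotient is a field, which hands out inverses
  directly.\<close>

definition is_maximal_ideal :: "'a::comm_ring_1 set \<Rightarrow> bool" where
  "is_maximal_ideal M \<longleftrightarrow> is_ideal M \<and> 1 \<notin> M \<and> (\<forall>a. a \<notin> M \<longrightarrow> (\<exists>b. 1 - a * b \<in> M))"

definition adjoin :: "'a::comm_ring_1 set \<Rightarrow> 'a \<Rightarrow> 'a set" where
  "adjoin J f = {a + b * f | a b. a \<in> J}"

definition colon :: "'a::comm_ring_1 set \<Rightarrow> 'a \<Rightarrow> 'a set" where
  "colon J x = {a. x * a \<in> J}"

text \<open>The final quotient may be zero. This lets the unit ideal occur in inductions; properness
  returns in \<open>regular_sequence_iff\<close>.\<close>

fun weakly_regular :: "'a::comm_ring_1 set \<Rightarrow> 'a list \<Rightarrow> bool" where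
  "weakly_regular J [] \<longleftrightarrow> True"
| "weakly_regular J (f # fs) \<longleftrightarrow> (\<forall>a. f * a \<in> J \<longrightarrow> a \<in> J) \<and> weakly_regular (adjoin J f) fs"

lemma is_idealD:
  assumes "is_ideal J"
  shows "0 \<in> J" "a \<in> J \<Longrightarrow> b \<in> J \<Longrightarrow> a + b \<in> J" "a \<in> J \<Longrightarrow> c * a \<in> J" "a \<in> J \<Longrightarrow> a * c \<in> J"
    "a \<in> J \<Longrightarrow> - a \<in> J" "a \<in> J \<Longrightarrow> b \<in> J \<Longrightarrow> a - b \<in> J"
proof -
  show 1: "0 \<in> J" "a \<in> J \<Longrightarrow> b \<in> J \<Longrightarrow> a + b \<in> J" "a \<in> J \<Longrightarrow> c * a \<in> J" for a b c
    using assms by (auto simp: is_ideal_def)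
  show 2: "a \<in> J \<Longrightarrow> a * c \<in> J" using 1(3)[of a c] by (simp add: mult.commute)
  show 3: "a \<in> J \<Longrightarrow> - a \<in> J" for a using 1(3)[of a "-1"] by simp
  show "a \<in> J \<Longrightarrow> b \<in> J \<Longrightarrow> a - b \<in> J" using 1(2)[of a "-b"] 3[of b] by simp
qed

lemma is_ideal_sum:
  assumes "is_ideal J" "\<And>x. x \<in> X \<Longrightarrow> f x \<in> J"
  shows "sum f X \<in> J"
  using assms(2) by (induction X rule: infinite_finite_induct) (auto intro: is_idealD[OF assms(1)])

lemma is_ideal_cong:
  assumes "is_ideal J" "a - b \<in> J"
  shows "a \<in> J \<longleftrightarrow> b \<in> J"
  using is_idealD(2)[OF assms(1), of "a - b" b] is_idealD(6)[OF assms(1), of a "a - b"] assms(2) by auto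

lemma is_ideal_one: "is_ideal J \<Longrightarrow> 1 \<in> J \<Longrightarrow> J = UNIV"
  using is_idealD(3)[of J 1] by auto

lemma is_ideal_adjoin [simp]:
  assumes "is_ideal J"
  shows "is_ideal (adjoin J f)"
  unfolding is_ideal_def
proof (intro conjI ballI allI)
  show "0 \<in> adjoin J f"
    unfolding adjoin_def using is_idealD(1)[OF assms] by (auto intro!: exI[of _ 0])
  fix a b assume "a \<in> adjoin J f"
  then obtain a1 a2 where a: "a = a1 + a2 * f" "a1 \<in> J" unfolding adjoin_def by auto
  have "b * a = b * a1 + (b * a2) * f" using a by (simp add: algebra_simps)
  then show "b * a \<in> adjoin J f"
    unfolding adjoin_def using is_idealD(3)[OF assms a(2)] by blast
  assume "b \<in> adjoin J f"
  then obtain b1 b2 where b: "b = b1 + b2 * f" "b1 \<in> J" unfolding adjoin_def by auto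
  have "a + b = (a1 + b1) + (a2 + b2) * f" using a b by (simp add: algebra_simps)
  then show "a + b \<in> adjoin J f"
    unfolding adjoin_def using is_idealD(2)[OF assms a(2) b(2)] by blast
qed

lemma is_ideal_colon [simp]:
  assumes "is_ideal J"
  shows "is_ideal (colon J f)"
  using is_idealD[OF assms] unfolding is_ideal_def colon_def
  by (auto simp: distrib_left mult.left_commute[of f])

lemma mem_adjoin_iff: "a \<in> adjoin J f \<longleftrightarrow> (\<exists>b. a - b * f \<in> J)"
proof
  assume "\<exists>b. a - b * f \<in> J"
  then obtain b where "a - b * f \<in> J" by blast
  moreover have "a = (a - b * f) + b * f" by simp
  ultimately show "a \<in> adjoin J f" unfolding adjoin_def by blast
next
  assume "a \<in> adjoin J f"
  then obtain c b where "a = c + b * f" "c \<in> J" unfolding adjoin_def by blast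
  then have "a - b * f \<in> J" by simp
  then show "\<exists>b. a - b * f \<in> J" ..
qed

lemma adjoin_superset: "J \<subseteq> adjoin J f"
proof
  fix a assume "a \<in> J"
  moreover have "a = a + 0 * f" by simp
  ultimately show "a \<in> adjoin J f" unfolding adjoin_def by blast
qed

lemma adjoin_self: "is_ideal J \<Longrightarrow> f \<in> adjoin J f"
  unfolding mem_adjoin_iff by (rule exI[of _ 1]) (simp add: is_idealD(1))

lemma adjoin_minimal:
  assumes "is_ideal K" "J \<subseteq> K" "f \<in> K"
  shows "adjoin J f \<subseteq> K"
  using assms is_idealD[OF assms(1)] unfolding adjoin_def by auto

lemma adjoin_cong:
  assumes "is_ideal J" "f - g \<in> J"
  shows "adjoin J f = adjoin J g"
proof -
  have "g - f \<in> J" using is_idealD(5)[OF assms] by simp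
  then have "f \<in> adjoin J g" "g \<in> adjoin J f"
    using assms(2) by (auto simp: mem_adjoin_iff intro: exI[of _ 1])
  then show ?thesis
    using adjoin_minimal adjoin_superset is_ideal_adjoin assms(1) by (metis subset_antisym)
qed

lemma adjoin_commute:
  assumes "is_ideal J"
  shows "adjoin (adjoin J f) g = adjoin (adjoin J g) f"
proof -
  have "adjoin (adjoin J f) g \<subseteq> adjoin (adjoin J g) f" for f g
    using assms by (meson adjoin_minimal adjoin_self adjoin_superset is_ideal_adjoin subset_iff)
  then show ?thesis by blast
qed

lemma adjoin_absorb:
  assumes "is_ideal J" "f \<in> J"
  shows "adjoin J f = J"
  using adjoin_minimal[OF assms(1) order_refl assms(2)] adjoin_superset by blast

lemma weakly_regular_UNIV: "weakly_regular UNIV fs"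
proof (induction fs)
  case (Cons f fs)
  have "adjoin UNIV f = UNIV" using adjoin_superset[of UNIV f] by blast
  then show ?case using Cons by simp
qed simp

lemma weakly_regular_cong:
  assumes "is_ideal J" "f - g \<in> J"
  shows "weakly_regular J (f # fs) \<longleftrightarrow> weakly_regular J (g # fs)"
proof -
  have "f * a \<in> J \<longleftrightarrow> g * a \<in> J" for a
    using is_ideal_cong[OF assms(1), of "f * a" "g * a"] is_idealD(4)[OF assms, of a]
    by (simp add: left_diff_distrib)
  then show ?thesis using adjoin_cong[OF assms] by simp
qed

lemma weakly_regular_nth:
  "weakly_regular J fs \<longleftrightarrow>
    (\<forall>i<length fs. \<forall>a. fs ! i * a \<in> foldl adjoin J (take i fs) \<longrightarrow> a \<in> foldl adjoin J (take i fs))"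
proof (induction fs arbitrary: J)
  case (Cons f fs)
  show ?case
    unfolding weakly_regular.simps Cons.IH by (simp add: All_less_Suc2)
qed simp

text \<open>A sequence that is regular on both ends of
  \<open>0 \<rightarrow> A/(J:x) \<rightarrow> A/J \<rightarrow> A/(J+(x)) \<rightarrow> 0\<close> is regular in the middle.\<close>

lemma weakly_regular_extension:
  assumes "is_ideal J" "weakly_regular (colon J x) fs" "weakly_regular (adjoin J x) fs"
  shows "weakly_regular J fs"
  using assms
proof (induction fs arbitrary: J)
  case (Cons f fs)
  note J = is_idealD[OF Cons.prems(1)]
  have c: "f * a \<in> colon J x \<Longrightarrow> a \<in> colon J x" and a: "f * a \<in> adjoin J x \<Longrightarrow> a \<in> adjoin J x" for a
    using Cons.prems by auto
  have 1: "a \<in> J" if "f * a \<in> J" for a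
  proof -
    have "a \<in> adjoin J x" using a adjoin_superset that by blast
    then obtain b where b: "a - b * x \<in> J" unfolding mem_adjoin_iff by blast
    have "x * (f * b) = f * a - f * (a - b * x)" by (simp add: algebra_simps)
    then have "x * (f * b) \<in> J" using J(6)[OF that J(3)[OF b]] by simp
    then have "x * b \<in> J" using c[of b] by (simp add: colon_def)
    then show "a \<in> J" using J(2)[OF b, of "x * b"] by (simp add: mult.commute)
  qed
  have 2: "colon (adjoin J f) x = adjoin (colon J x) f"
  proof
    show "adjoin (colon J x) f \<subseteq> colon (adjoin J f) x"
    proof (rule adjoin_minimal)
      show "colon J x \<subseteq> colon (adjoin J f) x"
        using adjoin_superset unfolding colon_def by blast
      show "f \<in> colon (adjoin J f) x"
        using is_idealD(3)[OF is_ideal_adjoin adjoin_self] Cons.prems(1) unfolding colon_def by auto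
    qed (use Cons.prems in simp)
    show "colon (adjoin J f) x \<subseteq> adjoin (colon J x) f"
    proof
      fix b assume "b \<in> colon (adjoin J f) x"
      then obtain c where cc: "x * b - c * f \<in> J" unfolding colon_def mem_adjoin_iff by blast
      have "f * c - b * x \<in> J" using J(5)[OF cc] by (simp add: algebra_simps)
      then have "f * c \<in> adjoin J x" unfolding mem_adjoin_iff by blast
      then have "c \<in> adjoin J x" by (rule a)
      then obtain e where e: "c - e * x \<in> J" unfolding mem_adjoin_iff by blast
      have "x * (b - e * f) = (x * b - c * f) + f * (c - e * x)" by (simp add: algebra_simps)
      then have "b - e * f \<in> colon J x" unfolding colon_def using J(2)[OF cc J(3)[OF e]] by simp
      then show "b \<in> adjoin (colon J x) f" unfolding mem_adjoin_iff by blast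
    qed
  qed
  have "weakly_regular (adjoin J f) fs"
    by (rule Cons.IH) (use Cons.prems 2 adjoin_commute[OF Cons.prems(1), of f x] in auto)
  then show ?case using 1 by simp
qed simp

text \<open>By Zorn there is a largest ideal \<open>M\<close> above \<open>J\<close> that misses
  \<open>S\<close>. If neither \<open>a\<close> nor \<open>b\<close> is in \<open>M\<close>,
  adjoining either of them reaches some \<open>s\<close>, respectively \<open>t\<close>, in
  \<open>S\<close>; with \<open>a * b\<close> in \<open>M\<close> the product \<open>s * t\<close>
  would fall into \<open>M\<close>.\<close>

lemma prime_ideal_avoiding:
  assumes J: "is_ideal J" and S: "1 \<in> S" "\<And>a b. a \<in> S \<Longrightarrow> b \<in> S \<Longrightarrow> a * b \<in> S" "J \<inter> S = {}"
  shows "\<exists>P. is_prime_ideal P \<and> J \<subseteq> P \<and> P \<inter> S = {}"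
proof -
  let ?A = "{K. is_ideal K \<and> J \<subseteq> K \<and> K \<inter> S = {}}"
  have "\<exists>M\<in>?A. \<forall>X\<in>?A. M \<subseteq> X \<longrightarrow> X = M"
  proof (rule subset_Zorn_nonempty)
    show "?A \<noteq> {}" using assms by blast
    fix C assume C: "C \<noteq> {}" "subset.chain ?A C"
    then have i: "is_ideal K" "J \<subseteq> K" "K \<inter> S = {}" if "K \<in> C" for K
      using that unfolding subset.chain_def by blast+
    have lin: "K \<subseteq> L \<or> L \<subseteq> K" if "K \<in> C" "L \<in> C" for K L
      using C(2) that unfolding subset.chain_def by blast
    have "is_ideal (\<Union>C)"
      unfolding is_ideal_def
    proof (intro conjI ballI allI)
      show "0 \<in> \<Union>C" using C(1) is_idealD(1)[OF i(1)] by blast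
      fix a b assume "a \<in> \<Union>C"
      then obtain K where K: "a \<in> K" "K \<in> C" by blast
      then show "b * a \<in> \<Union>C" using is_idealD(3)[OF i(1)[OF K(2)]] by blast
      assume "b \<in> \<Union>C"
      then obtain L where L: "b \<in> L" "L \<in> C" by blast
      show "a + b \<in> \<Union>C"
        using lin[OF K(2) L(2)] K L is_idealD(2)[OF i(1)[OF K(2)], of a b]
          is_idealD(2)[OF i(1)[OF L(2)], of a b] by blast
    qed
    then show "\<Union>C \<in> ?A" using i C(1) by blast
  qed
  then obtain M where MA: "M \<in> ?A" and Mmax: "\<forall>X\<in>?A. M \<subseteq> X \<longrightarrow> X = M" by (elim bexE)
  have M: "is_ideal M" "J \<subseteq> M" "M \<inter> S = {}" using MA by auto
  have max: "X = M" if "is_ideal X" "J \<subseteq> X" "X \<inter> S = {}" "M \<subseteq> X" for X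
    using Mmax that by simp
  have ex: "\<exists>b. \<exists>s\<in>S. s - b * a \<in> M" if "a \<notin> M" for a
  proof -
    have "adjoin M a \<noteq> M" using adjoin_self[OF M(1)] that by blast
    then have "adjoin M a \<inter> S \<noteq> {}"
      using max[of "adjoin M a"] adjoin_superset[of M a] M by auto
    then obtain s where "s \<in> S" "s \<in> adjoin M a" by blast
    then show ?thesis unfolding mem_adjoin_iff by blast
  qed
  have "a \<in> M \<or> b \<in> M" if ab: "a * b \<in> M" for a b
  proof (rule ccontr)
    assume "\<not> (a \<in> M \<or> b \<in> M)"
    then obtain c s e t where c: "s - c * a \<in> M" "s \<in> S" and e: "t - e * b \<in> M" "t \<in> S"
      using ex by meson
    have "s * t = (s - c * a) * t + (t - e * b) * (c * a) + (c * e) * (a * b)"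
      by (simp add: algebra_simps)
    then have "s * t \<in> M"
      using is_idealD[OF M(1)] c e ab by metis
    then show False using S(2)[OF c(2) e(2)] M(3) by blast
  qed
  then show ?thesis using M S(1) unfolding is_prime_ideal_def by blast
qed

text \<open>Every regular element buys one more prime at the bottom. The chain over
  \<open>adjoin J f\<close> starts at some \<open>Q 0\<close> containing \<open>f\<close>. The
  products of a power of \<open>f\<close> with an element outside \<open>Q 0\<close> avoid
  \<open>J\<close>, since \<open>f\<close> is regular modulo \<open>J\<close>; a prime avoiding them
  lies inside \<open>Q 0\<close> and omits \<open>f\<close>.\<close>

lemma prime_chain_of_weakly_regular:
  assumes "is_ideal J" "weakly_regular J fs" "is_prime_ideal P" "J \<subseteq> P" "set fs \<subseteq> P"
  shows "\<exists>Q. (\<forall>i\<le>length fs. is_prime_ideal (Q i)) \<and> (\<forall>i<length fs. Q i \<subset> Q (Suc i)) \<and>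
    J \<subseteq> Q 0 \<and> Q (length fs) = P"
  using assms
proof (induction fs arbitrary: J)
  case Nil
  then show ?case by (intro exI[of _ "\<lambda>_. P"]) auto
next
  case (Cons f fs)
  have "adjoin J f \<subseteq> P"
    using Cons.prems by (intro adjoin_minimal) (auto simp: is_prime_ideal_def)
  then obtain Q where Q: "\<And>i. i \<le> length fs \<Longrightarrow> is_prime_ideal (Q i)" "\<And>i. i < length fs \<Longrightarrow> Q i \<subset> Q (Suc i)"
    "adjoin J f \<subseteq> Q 0" "Q (length fs) = P"
    using Cons.IH[of "adjoin J f"] Cons.prems by auto
  have p: "is_prime_ideal (Q 0)" using Q(1)[of 0] by simp
  define S where "S = {f ^ i * s | i s. s \<notin> Q 0}"
  have reg: "a \<in> J" if "f * a \<in> J" for a using that Cons.prems by simp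
  have regs: "a \<in> J" if "f ^ i * a \<in> J" for a i
    using that by (induction i) (auto simp: mult.assoc intro: reg)
  have in0: "f \<in> Q 0" "J \<subseteq> Q 0"
    using Q(3) adjoin_self[OF Cons.prems(1)] adjoin_superset by blast+
  have "\<exists>P. is_prime_ideal P \<and> J \<subseteq> P \<and> P \<inter> S = {}"
  proof (rule prime_ideal_avoiding)
    have "1 \<notin> Q 0" using p by (simp add: is_prime_ideal_def)
    then have "f ^ 0 * 1 \<in> S" unfolding S_def by blast
    then show "1 \<in> S" by simp
    show "J \<inter> S = {}" unfolding S_def using regs in0 by blast
    fix a b assume "a \<in> S" "b \<in> S"
    then obtain i s j t where a: "a = f ^ i * s" "s \<notin> Q 0" and b: "b = f ^ j * t" "t \<notin> Q 0"
      unfolding S_def by blast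
    have "a * b = f ^ (i + j) * (s * t)" by (simp add: a b power_add algebra_simps)
    moreover have "s * t \<notin> Q 0" using a b p by (auto simp: is_prime_ideal_def)
    ultimately show "a * b \<in> S" unfolding S_def by blast
  qed (use Cons.prems in simp)
  then obtain P0 where P0: "is_prime_ideal P0" "J \<subseteq> P0" "P0 \<inter> S = {}" by blast
  have "1 \<notin> Q 0" using p by (simp add: is_prime_ideal_def)
  then have "f ^ 1 * 1 \<in> S" unfolding S_def by blast
  then have "f \<notin> P0" using P0(3) by auto
  moreover have "P0 \<subseteq> Q 0"
  proof
    fix s assume "s \<in> P0"
    then have "f ^ 0 * s \<notin> S" using P0(3) by auto
    then show "s \<in> Q 0" unfolding S_def by blast
  qed
  ultimately have "P0 \<subset> Q 0" using in0 by blast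
  then show ?case
    using Q P0
    by (intro exI[of _ "\<lambda>i. case i of 0 \<Rightarrow> P0 | Suc j \<Rightarrow> Q j"])
       (auto split: nat.splits)
qed

lemma is_maximal_ideal_prime:
  assumes "is_maximal_ideal M"
  shows "is_prime_ideal M"
  unfolding is_prime_ideal_def
proof (intro conjI allI impI)
  show i: "is_ideal M" "1 \<notin> M" using assms by (auto simp: is_maximal_ideal_def)
  fix a b assume ab: "a * b \<in> M"
  show "a \<in> M \<or> b \<in> M"
  proof (rule ccontr)
    assume "\<not> (a \<in> M \<or> b \<in> M)"
    then obtain c where "b \<notin> M" "1 - a * c \<in> M" using assms by (auto simp: is_maximal_ideal_def)
    moreover have "b = b * (1 - a * c) + c * (a * b)" by (simp add: algebra_simps)
    ultimately show False using is_idealD[OF i(1)] ab by metis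
  qed
qed

section \<open>Polynomials and substitution\<close>

type_synonym ('v, 'k) mpoly = "('v \<Rightarrow>\<^sub>0 nat) \<Rightarrow>\<^sub>0 'k"

abbreviation cst :: "'k::zero \<Rightarrow> ('v, 'k) mpoly" where
  "cst c \<equiv> single 0 c"

definition var :: "'v \<Rightarrow> ('v, 'k::zero_neq_one) mpoly" where
  "var v = single (single v 1) 1"

lemma poly_mapping_sum_single: "(\<Sum>m\<in>keys p. single m (lookup p m)) = (p :: 'a \<Rightarrow>\<^sub>0 'b::comm_monoid_add)"
proof (rule poly_mapping_eqI)
  fix n
  have "lookup (\<Sum>m\<in>keys p. single m (lookup p m)) n = (\<Sum>m\<in>keys p. if m = n then lookup p m else 0)"
    by (simp add: lookup_sum lookup_single when_def)
  also have "\<dots> = lookup p n" by (simp add: in_keys_iff)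
  finally show "lookup (\<Sum>m\<in>keys p. single m (lookup p m)) n = lookup p n" .
qed

lemma poly_mapping_add_induct [case_names single add]:
  assumes "\<And>m c. P (single m c)" "\<And>p q. P p \<Longrightarrow> P q \<Longrightarrow> P (p + q)"
  shows "P (p :: 'a \<Rightarrow>\<^sub>0 'b::comm_monoid_add)"
proof -
  have "P (\<Sum>m\<in>X. single m (lookup p m))" if "finite X" for X
    using that
  proof (induction X)
    case empty
    then show ?case using assms(1)[of undefined 0] by simp
  qed (simp add: assms)
  then show ?thesis by (metis finite_keys poly_mapping_sum_single)
qed

lemma exponent_induct [case_names zero step]:
  assumes "P 0" "\<And>m v. P m \<Longrightarrow> P (single v 1 + m)"
  shows "P (m :: 'v \<Rightarrow>\<^sub>0 nat)"
proof -
  have 1: "P (single v k + m)" if "P m" for v k m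
    using that
  proof (induction k)
    case (Suc k)
    then have "P (single v 1 + (single v k + m))" by (intro assms(2))
    then show ?case by (simp add: add.assoc[symmetric] single_add[symmetric])
  qed simp
  have "P (p + m) \<and> P p" if "P m" for p m using that
    by (induction p arbitrary: m rule: poly_mapping_add_induct)
       (use 1[OF assms(1)] in \<open>auto intro: 1 simp: add.assoc\<close>)
  then show ?thesis using assms(1) by blast
qed

lemma mpoly_induct [case_names cst var add]:
  assumes "\<And>c. P (cst c)" "\<And>v p. P p \<Longrightarrow> P (var v * p)" "\<And>p q. P p \<Longrightarrow> P q \<Longrightarrow> P (p + q)"
  shows "P (p :: ('v, 'k::comm_ring_1) mpoly)"
proof (induction p rule: poly_mapping_add_induct)
  case (single m c)
  show ?case
  proof (induction m rule: exponent_induct)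
    case (step m v)
    then show ?case using assms(2)[OF step, of v] by (simp add: mult_single var_def)
  qed (rule assms(1))
qed (rule assms(3))

lemma lookup_single_mult [simp]:
  "lookup (single n c * p) (n + m) = c * lookup (p :: ('v, 'k::comm_ring_1) mpoly) m"
  by (induction p rule: poly_mapping_add_induct)
     (simp_all add: mult_single lookup_single when_def distrib_left lookup_add)

lemma keys_single_mult_subset: "keys (single n c * p) \<subseteq> (+) n ` keys (p :: ('v, 'k::comm_ring_1) mpoly)"
  using keys_mult[of "single n c" p] by (auto split: if_splits)

lemma lookup_cst_mult [simp]: "lookup (cst c * p) m = c * lookup (p :: ('v, 'k::comm_ring_1) mpoly) m"
  using lookup_single_mult[of 0 c p m] by simp

lemma keys_var_mult: "keys (var v * p) = (+) (single v 1) ` keys (p :: ('v, 'k::comm_ring_1) mpoly)"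
  using keys_single_mult_subset[of "single v 1" 1 p] unfolding var_def by (force simp: in_keys_iff)

lemma keys_exponent_add: "keys (m + n) = keys m \<union> keys (n :: 'v \<Rightarrow>\<^sub>0 nat)"
  by (auto simp: in_keys_iff lookup_add)

definition monom_subst :: "('v \<Rightarrow> 'a::comm_ring_1) \<Rightarrow> ('v \<Rightarrow>\<^sub>0 nat) \<Rightarrow> 'a" where
  "monom_subst s m = (\<Prod>v\<in>keys m. s v ^ lookup m v)"

lemma monom_subst_superset:
  assumes "finite X" "keys m \<subseteq> X"
  shows "monom_subst s m = (\<Prod>v\<in>X. s v ^ lookup m v)"
  unfolding monom_subst_def using assms by (intro prod.mono_neutral_left) (auto simp: in_keys_iff)

lemma monom_subst_add: "monom_subst s (m + n) = monom_subst s m * monom_subst s n"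
proof -
  let ?X = "keys m \<union> keys n"
  have X: "finite ?X" "keys (m + n) \<subseteq> ?X" "keys m \<subseteq> ?X" "keys n \<subseteq> ?X"
    by (auto simp: keys_exponent_add)
  show ?thesis
    unfolding monom_subst_superset[OF X(1,2)] monom_subst_superset[OF X(1,3)]
      monom_subst_superset[OF X(1,4)]
    by (simp add: lookup_add power_add prod.distrib)
qed

lemma monom_subst_zero [simp]: "monom_subst s 0 = 1"
  by (simp add: monom_subst_def)

lemma monom_subst_single [simp]: "monom_subst s (single v k) = s v ^ k"
  by (simp add: monom_subst_def)

text \<open>Restriction to a face, setting the variables of a face to 1, and evaluation at a point
  are all instances, so the ideals studied below become kernels or intersections of kernels.\<close>

definition subst :: "('v \<Rightarrow> ('w, 'k) mpoly) \<Rightarrow> ('v, 'k::comm_ring_1) mpoly \<Rightarrow> ('w, 'k) mpoly" where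
  "subst s p = (\<Sum>m\<in>keys p. cst (lookup p m) * monom_subst s m)"

lemma subst_superset:
  assumes "finite X" "keys p \<subseteq> X"
  shows "subst s p = (\<Sum>m\<in>X. cst (lookup p m) * monom_subst s m)"
  unfolding subst_def using assms by (intro sum.mono_neutral_left) (auto simp: in_keys_iff)

lemma subst_single: "subst s (single m c) = cst c * monom_subst s m"
  by (simp add: subst_def)

lemma subst_add [simp]: "subst s (p + q) = subst s p + subst s q"
proof -
  let ?X = "keys p \<union> keys q"
  have X: "finite ?X" "keys (p + q) \<subseteq> ?X" "keys p \<subseteq> ?X" "keys q \<subseteq> ?X"
    using Poly_Mapping.keys_add[of p q] by auto
  show ?thesis
    unfolding subst_superset[OF X(1,2)] subst_superset[OF X(1,3)] subst_superset[OF X(1,4)]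
    by (simp add: lookup_add single_add distrib_right sum.distrib)
qed

lemma subst_cst [simp]: "subst s (cst c) = cst c"
  by (simp add: subst_single)

lemma subst_0 [simp]: "subst s 0 = 0"
  by (simp add: subst_def)

lemma subst_1 [simp]: "subst s 1 = 1"
  using subst_cst[of s 1] by simp

lemma subst_var [simp]: "subst s (var v) = s v"
  by (simp add: subst_single var_def)

lemma cst_mult: "cst (a * b) = cst a * cst (b :: 'k::comm_ring_1)"
  by (simp add: mult_single)

lemma subst_mult [simp]: "subst s (p * q) = subst s p * subst s q"
proof (induction p rule: poly_mapping_add_induct)
  case (single m c)
  show ?case
  proof (induction q rule: poly_mapping_add_induct)
    case (single n d)
    have "subst s (single m c * single n d) = cst (c * d) * (monom_subst s m * monom_subst s n)"
      by (simp only: mult_single subst_single monom_subst_add)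
    also have "\<dots> = (cst c * monom_subst s m) * (cst d * monom_subst s n)"
      by (simp only: cst_mult mult_ac)
    finally show ?case by (simp only: subst_single)
  qed (simp add: distrib_left)
qed (simp add: distrib_right)

lemma subst_uminus [simp]: "subst s (- p) = - subst s p"
  using subst_add[of s p "-p"] by (simp add: eq_neg_iff_add_eq_0 add.commute del: subst_add)

lemma subst_diff [simp]: "subst s (p - q) = subst s p - subst s q"
  using subst_add[of s p "-q"] by (simp del: subst_add)

lemma subst_subst: "subst s (subst t p) = subst (\<lambda>v. subst s (t v)) p"
  by (induction p rule: mpoly_induct) simp_all

lemma subst_ident [simp]: "subst var p = p"
  by (induction p rule: mpoly_induct) simp_all

lemma var_neq_0 [simp]: "(var v :: ('v, 'k::comm_ring_1) mpoly) \<noteq> 0"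
proof -
  have "lookup (var v :: ('v, 'k) mpoly) (single v 1) = 1" unfolding var_def by simp
  then show ?thesis by (metis lookup_zero zero_neq_one)
qed

lemma var_neq_1 [simp]: "(var v :: ('v, 'k::comm_ring_1) mpoly) \<noteq> 1"
proof
  assume "(var v :: ('v, 'k) mpoly) = 1"
  then have "subst (\<lambda>_. 0) (var v :: ('v, 'k) mpoly) = subst (\<lambda>_. 0 :: ('v, 'k) mpoly) 1" by simp
  then show False by simp
qed

lemma subst_cong_ideal:
  assumes J: "is_ideal J" and "\<And>v. s v - t v \<in> J"
  shows "subst s p - subst t p \<in> J"
proof (induction p rule: mpoly_induct)
  case (var v p)
  have "subst s (var v * p) - subst t (var v * p) =
      (s v - t v) * subst s p + t v * (subst s p - subst t p)"
    by (simp add: algebra_simps)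
  then show ?case using is_idealD[OF J] assms(2) var by metis
next
  case (add p q)
  have "subst s (p + q) - subst t (p + q) = (subst s p - subst t p) + (subst s q - subst t q)"
    by (simp add: algebra_simps)
  then show ?case using is_idealD(2)[OF J add] by metis
qed (simp add: is_idealD[OF J])

text \<open>The order on the variables orders the exponent vectors, which makes the target an
  integral domain.\<close>

lemma is_prime_ideal_kernel:
  fixes s :: "'v \<Rightarrow> ('w::linorder, 'k::field) mpoly"
  shows "is_prime_ideal {p. subst s p = 0}"
  unfolding is_prime_ideal_def is_ideal_def by auto

section \<open>Squarefree monomial ideals\<close>

definition restr :: "'v set \<Rightarrow> 'v \<Rightarrow> ('v, 'k::comm_ring_1) mpoly" where
  "restr F v = (if v \<in> F then var v else 0)"

lemma monom_var: "monom_subst var m = (single m 1 :: ('v, 'k::comm_ring_1) mpoly)"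
  by (induction m rule: exponent_induct) (simp_all add: monom_subst_add mult_single var_def)

lemma monom_subst_restr:
  "monom_subst (restr F) m = (if keys m \<subseteq> F then single m 1 else (0 :: ('v, 'k::comm_ring_1) mpoly))"
proof (cases "keys m \<subseteq> F")
  case True
  then have "monom_subst (restr F) m = (monom_subst var m :: ('v, 'k) mpoly)"
    unfolding monom_subst_def by (intro prod.cong) (auto simp: restr_def)
  then show ?thesis using True by (simp add: monom_var)
next
  case False
  then obtain v where "v \<in> keys m" "v \<notin> F" by blast
  then have "\<exists>v\<in>keys m. restr F v ^ lookup m v = (0 :: ('v, 'k) mpoly)"
    by (intro bexI[of _ v]) (auto simp: restr_def zero_power in_keys_iff)
  then show ?thesis using False by (simp add: monom_subst_def prod_zero)
qed

lemma lookup_subst_restr: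
  "lookup (subst (restr F) p) m = (if keys m \<subseteq> F then lookup (p :: ('v, 'k::comm_ring_1) mpoly) m else 0)"
proof (induction p rule: poly_mapping_add_induct)
  case (single n c)
  then show ?case by (auto simp: subst_single monom_subst_restr mult_single lookup_single when_def)
qed (auto simp: lookup_add)

definition sr_ideal :: "'v set set \<Rightarrow> ('v, 'k::comm_ring_1) mpoly set" where
  "sr_ideal \<Delta> = {p. \<forall>m\<in>keys p. keys m \<notin> \<Delta>}"

lemma is_ideal_sr_ideal:
  assumes "simplicial_complex \<Delta>"
  shows "is_ideal (sr_ideal \<Delta>)"
  unfolding is_ideal_def
proof (intro conjI ballI allI)
  fix p q :: "('a, 'b) mpoly" assume p: "p \<in> sr_ideal \<Delta>"
  show "q * p \<in> sr_ideal \<Delta>"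
    unfolding sr_ideal_def
  proof (intro CollectI ballI)
    fix m assume "m \<in> keys (q * p)"
    then obtain a b where m: "m = a + b" and b: "b \<in> keys p" using keys_mult[of q p] by blast
    have "keys b \<notin> \<Delta>" "keys b \<subseteq> keys m" using p b m by (auto simp: sr_ideal_def keys_exponent_add)
    then show "keys m \<notin> \<Delta>" using assms unfolding simplicial_complex_def by blast
  qed
  assume "q \<in> sr_ideal \<Delta>"
  then show "p + q \<in> sr_ideal \<Delta>"
    using p Poly_Mapping.keys_add[of p q] unfolding sr_ideal_def by blast
qed (simp add: sr_ideal_def)

text \<open>The prime decomposition of a squarefree monomial ideal: one prime for each face.\<close>

lemma sr_ideal_eq_kernels:
  assumes "simplicial_complex \<Delta>"
  shows "p \<in> sr_ideal \<Delta> \<longleftrightarrow> (\<forall>F\<in>\<Delta>. subst (restr F) p = 0)"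
proof
  assume p: "p \<in> sr_ideal \<Delta>"
  show "\<forall>F\<in>\<Delta>. subst (restr F) p = 0"
  proof (intro ballI poly_mapping_eqI)
    fix F :: "'a set" and m :: "'a \<Rightarrow>\<^sub>0 nat" assume F: "F \<in> \<Delta>"
    have "keys m \<in> \<Delta>" if "keys m \<subseteq> F"
      using assms F that unfolding simplicial_complex_def by blast
    then have "lookup p m = 0" if "keys m \<subseteq> F"
      using p that by (auto simp: sr_ideal_def in_keys_iff)
    then show "lookup (subst (restr F) p) m = lookup 0 m"
      by (simp add: lookup_subst_restr)
  qed
next
  assume p: "\<forall>F\<in>\<Delta>. subst (restr F) p = 0"
  show "p \<in> sr_ideal \<Delta>"
    unfolding sr_ideal_def
  proof (intro CollectI ballI notI)
    fix m assume "m \<in> keys p" "keys m \<in> \<Delta>"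
    then have "lookup (subst (restr (keys m)) p) m \<noteq> 0"
      by (simp add: lookup_subst_restr in_keys_iff)
    then show False using p \<open>keys m \<in> \<Delta>\<close> by simp
  qed
qed

lemma sr_ideal_Pow:
  assumes "finite F"
  shows "sr_ideal (Pow F) = {p. subst (restr F) p = 0}"
proof -
  have "p \<in> sr_ideal (Pow F) \<longleftrightarrow> subst (restr F) p = 0" for p :: "('a, 'b) mpoly"
    by (auto simp: sr_ideal_def lookup_subst_restr poly_mapping_eq_iff fun_eq_iff in_keys_iff)
  then show ?thesis by blast
qed

text \<open>The complex on the right is the star of \<open>v\<close>, that is, the cone with apex
  \<open>v\<close> over the link.\<close>

lemma colon_sr_ideal: "colon (sr_ideal \<Delta>) (var v) = sr_ideal {H. insert v H \<in> \<Delta>}"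
  by (auto simp: colon_def sr_ideal_def keys_var_mult keys_exponent_add)

lemma adjoin_sr_ideal:
  fixes \<Delta> :: "'v set set"
  assumes "simplicial_complex \<Delta>"
  shows "adjoin (sr_ideal \<Delta> :: ('v, 'k::comm_ring_1) mpoly set) (var v) = sr_ideal {H \<in> \<Delta>. v \<notin> H}"
proof
  have sc: "simplicial_complex {H \<in> \<Delta>. v \<notin> H}"
    using assms unfolding simplicial_complex_def by blast
  show "adjoin (sr_ideal \<Delta> :: ('v, 'k) mpoly set) (var v) \<subseteq> sr_ideal {H \<in> \<Delta>. v \<notin> H}"
    by (rule adjoin_minimal[OF is_ideal_sr_ideal[OF sc]]) (auto simp: sr_ideal_def var_def)
  show "sr_ideal {H \<in> \<Delta>. v \<notin> H} \<subseteq> adjoin (sr_ideal \<Delta> :: ('v, 'k) mpoly set) (var v)"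
  proof
    fix p :: "('v, 'k) mpoly" assume p: "p \<in> sr_ideal {H \<in> \<Delta>. v \<notin> H}"
    let ?J = "adjoin (sr_ideal \<Delta>) (var v) :: ('v, 'k) mpoly set"
    have J: "is_ideal ?J" by (simp add: is_ideal_sr_ideal[OF assms])
    have "single m (lookup p m) \<in> ?J" if m: "m \<in> keys p" for m
    proof (cases "v \<in> keys m")
      case True
      have "m = single v 1 + (m - single v 1)"
        using True by (intro poly_mapping_eqI) (auto simp: lookup_add lookup_minus lookup_single when_def in_keys_iff)
      then have "single m (lookup p m) = single (m - single v 1) (lookup p m) * var v"
        unfolding var_def by (metis mult_single mult.right_neutral add.commute)
      then show ?thesis
        using is_idealD(3)[OF J adjoin_self[OF is_ideal_sr_ideal[OF assms]]] by metis
    next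
      case False
      then have "single m (lookup p m) \<in> sr_ideal \<Delta>"
        using p m by (auto simp: sr_ideal_def)
      then show ?thesis using adjoin_superset by blast
    qed
    then have "(\<Sum>m\<in>keys p. single m (lookup p m)) \<in> ?J" by (rule is_ideal_sum[OF J])
    then show "p \<in> ?J" by (simp add: poly_mapping_sum_single)
  qed
qed

section \<open>Presentations of a ring\<close>

lemma strict_chain_superset:
  fixes Q :: "nat \<Rightarrow> 'a set"
  assumes "\<And>i. i < r \<Longrightarrow> Q i \<subset> Q (Suc i)" "i \<le> r" "K \<subseteq> Q 0"
  shows "K \<subseteq> Q i"
  using assms(2)
proof (induction i)
  case (Suc i)
  then show ?case using assms(1)[of i] by auto
qed (rule assms(3))

text \<open>The elements of a quotient ring are cosets. Along \<open>\<pi>\<close> every statement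
  about them turns into one about ideals of a type that contain \<open>ker\<close>.\<close>

locale ring_presentation = cring R
  for R :: "('r, 'm) ring_scheme" (structure) and \<pi> :: "'a::comm_ring_1 \<Rightarrow> 'r" +
  assumes surj: "\<pi> ` UNIV = carrier R"
    and hom_add: "\<pi> (a + b) = \<pi> a \<oplus> \<pi> b"
    and hom_mult: "\<pi> (a * b) = \<pi> a \<otimes> \<pi> b"
    and hom_one: "\<pi> 1 = \<one>"
begin

definition ker :: "'a set" where
  "ker = {a. \<pi> a = \<zero>}"

lemma hom_closed [simp, intro]: "\<pi> a \<in> carrier R"
  using surj by blast

lemma hom_zero: "\<pi> 0 = \<zero>"
  using hom_add[of 0 0] by (metis add.l_cancel_one' add_0 hom_closed)

lemma hom_uminus: "\<pi> (- a) = \<ominus> \<pi> a"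
  using hom_add[of "-a" a] by (simp add: hom_zero minus_equality)

lemma hom_diff: "\<pi> (a - b) = \<pi> a \<ominus> \<pi> b"
  using hom_add[of a "-b"] by (simp add: hom_uminus a_minus_def)

lemma carrierE:
  assumes "x \<in> carrier R"
  obtains a where "x = \<pi> a"
  using assms surj by blast

lemma eq_iff_ker: "\<pi> a = \<pi> b \<longleftrightarrow> a - b \<in> ker"
  by (simp add: ker_def hom_diff)

lemma is_ideal_vimage:
  assumes "ideal J R"
  shows "is_ideal (\<pi> -` J)" and "ker \<subseteq> \<pi> -` J"
proof -
  interpret J: ideal J R by fact
  show "is_ideal (\<pi> -` J)"
    unfolding is_ideal_def
    by (auto simp: hom_zero hom_add hom_mult intro: J.I_l_closed)
  show "ker \<subseteq> \<pi> -` J" by (auto simp: ker_def)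
qed

lemma ideal_image:
  assumes J: "is_ideal J"
  shows "ideal (\<pi> ` J) R"
proof (rule idealI)
  show "ring R" by (rule ring_axioms)
  show "subgroup (\<pi> ` J) (add_monoid R)"
  proof (rule add.subgroupI)
    show "\<pi> ` J \<noteq> {}" using is_idealD(1)[OF J] by blast
    fix a assume "a \<in> \<pi> ` J"
    then show "\<ominus> a \<in> \<pi> ` J" using is_idealD(5)[OF J] by (auto simp flip: hom_uminus)
    fix b assume "b \<in> \<pi> ` J"
    then show "a \<oplus> b \<in> \<pi> ` J"
      using \<open>a \<in> \<pi> ` J\<close> is_idealD(2)[OF J] by (auto simp flip: hom_add)
  qed auto
  fix a x assume "a \<in> \<pi> ` J" "x \<in> carrier R"
  then obtain b c where "a = \<pi> b" "b \<in> J" "x = \<pi> c" by (blast elim: carrierE)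
  then show "x \<otimes> a \<in> \<pi> ` J" "a \<otimes> x \<in> \<pi> ` J"
    using is_idealD(3,4)[OF J] by (auto simp flip: hom_mult)
qed

lemma vimage_image:
  assumes "is_ideal J" "ker \<subseteq> J"
  shows "\<pi> -` (\<pi> ` J) = J"
proof
  show "\<pi> -` (\<pi> ` J) \<subseteq> J"
  proof
    fix a assume "a \<in> \<pi> -` (\<pi> ` J)"
    then obtain b where "\<pi> a = \<pi> b" "b \<in> J" by blast
    then have "a - b \<in> J" using assms eq_iff_ker by blast
    then show "a \<in> J" using is_ideal_cong[OF assms(1)] \<open>b \<in> J\<close> by blast
  qed
qed blast

lemma image_vimage: "S \<subseteq> carrier R \<Longrightarrow> \<pi> ` (\<pi> -` S) = S"
  by (simp add: image_vimage_eq surj Int_absorb2)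

lemma is_prime_ideal_vimage:
  assumes "primeideal Q R"
  shows "is_prime_ideal (\<pi> -` Q)"
proof -
  interpret Q: primeideal Q R by fact
  have "\<one> \<notin> Q" using Q.I_notcarr Q.one_imp_carrier by blast
  then show ?thesis
    unfolding is_prime_ideal_def
    using is_ideal_vimage[OF Q.is_ideal] Q.I_prime by (auto simp: hom_one hom_mult)
qed

lemma primeideal_image:
  assumes "is_prime_ideal P" "ker \<subseteq> P"
  shows "primeideal (\<pi> ` P) R"
proof (rule primeidealI)
  have P: "is_ideal P" "1 \<notin> P" using assms by (auto simp: is_prime_ideal_def)
  note mem = vimage_image[OF P(1) assms(2)]
  show "ideal (\<pi> ` P) R" using ideal_image[OF P(1)] .
  show "cring R" by (rule cring_axioms)
  have "\<pi> 1 \<notin> \<pi> ` P" using mem P(2) by (metis vimage_eq)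
  then show "carrier R \<noteq> \<pi> ` P" using hom_closed by metis
  fix a b assume "a \<in> carrier R" "b \<in> carrier R" and ab: "a \<otimes> b \<in> \<pi> ` P"
  then obtain c d where c: "a = \<pi> c" "b = \<pi> d" by (blast elim: carrierE)
  then have "c * d \<in> P" using ab mem hom_mult by (metis vimage_eq)
  then show "a \<in> \<pi> ` P \<or> b \<in> \<pi> ` P" using assms(1) c by (auto simp: is_prime_ideal_def)
qed

lemma is_maximal_ideal_vimage:
  assumes "maximalideal M R"
  shows "is_maximal_ideal (\<pi> -` M)"
proof -
  interpret M: maximalideal M R by fact
  note i = is_ideal_vimage[OF M.is_ideal]
  have "\<one> \<notin> M" using M.I_notcarr M.one_imp_carrier by blast
  then have 1: "1 \<notin> \<pi> -` M" by (simp add: hom_one)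
  have "\<exists>b. 1 - a * b \<in> \<pi> -` M" if a: "a \<notin> \<pi> -` M" for a
  proof -
    let ?J = "adjoin (\<pi> -` M) a"
    have J: "is_ideal ?J" using i by simp
    have "\<pi> ` ?J = M \<or> \<pi> ` ?J = carrier R"
    proof (rule M.I_maximal[OF ideal_image[OF J]])
      show "M \<subseteq> \<pi> ` ?J"
        using image_vimage[of M] M.a_subset adjoin_superset[of "\<pi> -` M" a] by blast
    qed auto
    moreover have "\<pi> ` ?J \<noteq> M" using adjoin_self[OF i(1), of a] a by blast
    ultimately have "\<pi> 1 \<in> \<pi> ` ?J" by simp
    then have "1 \<in> ?J" using vimage_image[OF J] adjoin_superset[of "\<pi> -` M" a] i(2) by blast
    then obtain b where "1 - b * a \<in> \<pi> -` M" unfolding mem_adjoin_iff by blast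
    then show ?thesis by (auto simp: mult.commute)
  qed
  then show ?thesis unfolding is_maximal_ideal_def using i(1) 1 by blast
qed

lemma maximalideal_image:
  assumes "is_maximal_ideal M" "ker \<subseteq> M"
  shows "maximalideal (\<pi> ` M) R"
proof (rule maximalidealI)
  have M: "is_ideal M" "1 \<notin> M" using assms by (auto simp: is_maximal_ideal_def)
  note mem = vimage_image[OF M(1) assms(2)]
  show "ideal (\<pi> ` M) R" using ideal_image[OF M(1)] .
  have "\<pi> 1 \<notin> \<pi> ` M" using mem M(2) by (metis vimage_eq)
  then show "carrier R \<noteq> \<pi> ` M" using hom_closed by metis
  fix J assume J: "ideal J R" "\<pi> ` M \<subseteq> J" "J \<subseteq> carrier R"
  have i: "is_ideal (\<pi> -` J)" using is_ideal_vimage[OF J(1)] by blast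
  have "J = carrier R" if ne: "J \<noteq> \<pi> ` M"
  proof -
    obtain a where a: "\<pi> a \<in> J" "a \<notin> M" using ne J image_vimage by blast
    obtain b where b: "1 - a * b \<in> M" using assms(1) a(2) by (auto simp: is_maximal_ideal_def)
    have "1 - a * b \<in> \<pi> -` J" using b J(2) by blast
    moreover have "a * b \<in> \<pi> -` J" using is_idealD(4)[OF i] a(1) by blast
    ultimately have "1 \<in> \<pi> -` J" using is_idealD(2)[OF i, of "1 - a * b" "a * b"] by simp
    then have "\<pi> -` J = UNIV" by (rule is_ideal_one[OF i])
    then show ?thesis using J(3) by (auto elim!: carrierE)
  qed
  then show "J = \<pi> ` M \<or> J = carrier R" by blast
qed

lemma is_ideal_ker [simp]: "is_ideal ker"
  unfolding is_ideal_def ker_def by (auto simp: hom_zero hom_add hom_mult)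

lemma is_ideal_foldl_adjoin: "is_ideal J \<Longrightarrow> is_ideal (foldl adjoin J fs)"
  by (induction fs arbitrary: J) simp_all

lemma foldl_adjoin_superset: "is_ideal J \<Longrightarrow> J \<union> set fs \<subseteq> foldl adjoin J fs"
proof (induction fs arbitrary: J)
  case (Cons f fs)
  then have "adjoin J f \<union> set fs \<subseteq> foldl adjoin (adjoin J f) fs" by simp
  then show ?case using adjoin_superset[of J f] adjoin_self[OF Cons.prems, of f] by auto
qed simp

lemma foldl_adjoin_minimal: "is_ideal K \<Longrightarrow> J \<subseteq> K \<Longrightarrow> set fs \<subseteq> K \<Longrightarrow> foldl adjoin J fs \<subseteq> K"
  by (induction fs arbitrary: J) (auto intro: adjoin_minimal[THEN subsetD])

lemma vimage_Idl: "\<pi> -` (Idl (\<pi> ` set fs)) = foldl adjoin ker fs"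
proof
  have I: "ideal (Idl (\<pi> ` set fs)) R" by (rule genideal_ideal) auto
  have sub: "\<pi> ` set fs \<subseteq> Idl (\<pi> ` set fs)" by (rule genideal_self) auto
  show "foldl adjoin ker fs \<subseteq> \<pi> -` (Idl (\<pi> ` set fs))"
    using is_ideal_vimage[OF I] sub by (intro foldl_adjoin_minimal) auto
  have i: "is_ideal (foldl adjoin ker fs)" by (simp add: is_ideal_foldl_adjoin)
  have s: "ker \<union> set fs \<subseteq> foldl adjoin ker fs" by (rule foldl_adjoin_superset) simp
  have "Idl (\<pi> ` set fs) \<subseteq> \<pi> ` foldl adjoin ker fs"
    using s by (intro genideal_minimal ideal_image i) auto
  then show "\<pi> -` (Idl (\<pi> ` set fs)) \<subseteq> foldl adjoin ker fs"
    using vimage_image[OF i] s by blast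
qed

lemma regular_sequence_iff:
  "regular_sequence R (map \<pi> fs) \<longleftrightarrow> weakly_regular ker fs \<and> 1 \<notin> foldl adjoin ker fs"
proof -
  have mem: "\<pi> a \<in> Idl (\<pi> ` set gs) \<longleftrightarrow> a \<in> foldl adjoin ker gs" for a gs
    using vimage_Idl[of gs] by blast
  have I: "ideal (Idl (\<pi> ` set fs)) R" by (rule genideal_ideal) auto
  have "Idl (\<pi> ` set fs) \<noteq> carrier R \<longleftrightarrow> \<pi> 1 \<notin> Idl (\<pi> ` set fs)"
    using ideal.one_imp_carrier[OF I] by (metis hom_one one_closed)
  moreover have "(\<forall>x\<in>carrier R. \<pi> f \<otimes> x \<in> Idl (\<pi> ` set gs) \<longrightarrow> x \<in> Idl (\<pi> ` set gs)) \<longleftrightarrow>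
      (\<forall>a. f * a \<in> foldl adjoin ker gs \<longrightarrow> a \<in> foldl adjoin ker gs)" for f gs
    unfolding mem[symmetric] hom_mult by (metis carrierE hom_closed)
  ultimately show ?thesis
    unfolding regular_sequence_def weakly_regular_nth
    by (auto simp: mem take_map image_image)
qed

lemma ideal_depth_ge:
  assumes "is_ideal M" "1 \<notin> M" "ker \<subseteq> M" "weakly_regular ker fs" "set fs \<subseteq> M"
  shows "enat (length fs) \<le> ideal_depth R (\<pi> ` M)"
proof -
  have "foldl adjoin ker fs \<subseteq> M" using assms by (intro foldl_adjoin_minimal) auto
  then have "regular_sequence R (map \<pi> fs)" using assms by (auto simp: regular_sequence_iff)
  then show ?thesis
    unfolding ideal_depth_def using assms(5)
    by (intro Sup_upper CollectI exI[of _ "map \<pi> fs"]) auto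
qed

lemma regular_sequenceE:
  assumes "regular_sequence R xs" "set xs \<subseteq> \<pi> ` M" "is_ideal M" "ker \<subseteq> M"
  obtains fs where "length fs = length xs" "set fs \<subseteq> M" "weakly_regular ker fs"
proof -
  have "xs \<in> lists (\<pi> ` M)" using assms(2) by (simp add: in_lists_conv_set subset_iff)
  then obtain fs where fs: "xs = map \<pi> fs" "set fs \<subseteq> M"
    unfolding lists_image by (auto simp: in_lists_conv_set)
  then show thesis using that[of fs] assms(1) by (simp add: regular_sequence_iff)
qed

lemma ideal_depth_le_prime_height:
  assumes "is_prime_ideal P" "ker \<subseteq> P"
  shows "ideal_depth R (\<pi> ` P) \<le> prime_height R (\<pi> ` P)"
  unfolding ideal_depth_def
proof (rule Sup_least)
  have P: "is_ideal P" using assms by (simp add: is_prime_ideal_def)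
  fix x assume "x \<in> {enat (length xs) | xs. regular_sequence R xs \<and> set xs \<subseteq> \<pi> ` P}"
  then obtain xs where xs: "x = enat (length xs)" "regular_sequence R xs" "set xs \<subseteq> \<pi> ` P" by blast
  obtain fs where fs: "length fs = length xs" "set fs \<subseteq> P" "weakly_regular ker fs"
    using regular_sequenceE[OF xs(2,3) P assms(2)] .
  obtain Q where Q: "\<And>i. i \<le> length fs \<Longrightarrow> is_prime_ideal (Q i)" "\<And>i. i < length fs \<Longrightarrow> Q i \<subset> Q (Suc i)"
    "ker \<subseteq> Q 0" "Q (length fs) = P"
    using prime_chain_of_weakly_regular[OF is_ideal_ker fs(3) assms fs(2)] by blast
  have k: "ker \<subseteq> Q i" if "i \<le> length fs" for i
    using strict_chain_superset[of "length fs" Q, OF Q(2) that Q(3)] .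
  \<comment> \<open>Ideals above \<open>ker\<close> are recovered from their images, so strict
    inclusions survive.\<close>
  have "\<pi> ` Q i \<subset> \<pi> ` Q (Suc i)" if "i < length fs" for i
    using Q(2)[OF that] vimage_image[OF _ k] that Q(1)
    by (metis Suc_leI image_mono is_prime_ideal_def less_imp_le psubset_eq)
  then show "x \<le> prime_height R (\<pi> ` P)"
    unfolding prime_height_def xs(1) using Q primeideal_image k
    by (intro Sup_upper CollectI exI[of _ "length xs"] conjI exI[of _ "\<lambda>i. \<pi> ` Q i"])
       (auto simp: fs(1))
qed

lemma prime_height_le:
  assumes "\<And>Q r. (\<And>i. i \<le> r \<Longrightarrow> is_prime_ideal (Q i)) \<Longrightarrow> (\<And>i. i < r \<Longrightarrow> Q i \<subset> Q (Suc i)) \<Longrightarrow>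
    ker \<subseteq> Q 0 \<Longrightarrow> r \<le> d"
  shows "prime_height R P \<le> enat d"
  unfolding prime_height_def
proof (rule Sup_least)
  fix x assume "x \<in> {enat r | r. \<exists>Q :: nat \<Rightarrow> 'r set.
     (\<forall>i\<le>r. primeideal (Q i) R) \<and> (\<forall>i<r. Q i \<subset> Q (Suc i)) \<and> Q r = P}"
  then obtain r Q where x: "x = enat r" and Q: "\<And>i. i \<le> r \<Longrightarrow> primeideal (Q i) R"
    "\<And>i. i < r \<Longrightarrow> Q i \<subset> Q (Suc i)" by blast
  have i: "ideal (Q i) R" if "i \<le> r" for i using Q(1)[OF that] by (simp add: primeideal_def)
  have "r \<le> d"
  proof (rule assms[of r "\<lambda>i. \<pi> -` Q i"])
    show "ker \<subseteq> \<pi> -` Q 0" using is_ideal_vimage(2)[OF i] by blast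
    fix j
    show "is_prime_ideal (\<pi> -` Q j)" if "j \<le> r" using is_prime_ideal_vimage Q(1) that by blast
    assume j: "j < r"
    have "Q j \<subseteq> carrier R" "Q (Suc j) \<subseteq> carrier R"
      using ideal.Icarr[OF i, of j] ideal.Icarr[OF i, of "Suc j"] j by auto
    then show "\<pi> -` Q j \<subset> \<pi> -` Q (Suc j)"
      using Q(2)[OF j] image_vimage by (metis psubset_eq vimage_mono)
  qed
  then show "x \<le> enat d" by (simp add: x)
qed

lemma prime_height_ge:
  assumes "\<And>i. i \<le> r \<Longrightarrow> is_prime_ideal (Q i)" "\<And>i. i < r \<Longrightarrow> Q i \<subset> Q (Suc i)" "ker \<subseteq> Q 0"
  shows "enat r \<le> prime_height R (\<pi> ` Q r)"
proof -
  have k: "ker \<subseteq> Q i" if "i \<le> r" for i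
    using strict_chain_superset[of r Q, OF assms(2) that assms(3)] .
  have "\<pi> ` Q i \<subset> \<pi> ` Q (Suc i)" if "i < r" for i
    using assms(2)[OF that] vimage_image[OF _ k] that assms(1)
    by (metis Suc_leI image_mono is_prime_ideal_def less_imp_le psubset_eq)
  then show ?thesis
    unfolding prime_height_def using assms primeideal_image k
    by (intro Sup_upper CollectI exI[of _ r] conjI exI[of _ "\<lambda>i. \<pi> ` Q i"]) auto
qed

text \<open>Generation by \<open>T\<close> is phrased through all ideals above \<open>ker\<close>,
  which spares a construction of generated ideals in the type.\<close>

lemma noetherian_ringI':
  assumes "\<And>J. is_ideal J \<Longrightarrow> ker \<subseteq> J \<Longrightarrow>
    \<exists>T. finite T \<and> T \<subseteq> J \<and> (\<forall>J'. is_ideal J' \<longrightarrow> ker \<subseteq> J' \<longrightarrow> T \<subseteq> J' \<longrightarrow> J \<subseteq> J')"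
  shows "noetherian_ring R"
proof (rule noetherian_ringI)
  fix I assume I: "ideal I R"
  obtain T where T: "finite T" "T \<subseteq> \<pi> -` I"
    "\<And>J'. is_ideal J' \<Longrightarrow> ker \<subseteq> J' \<Longrightarrow> T \<subseteq> J' \<Longrightarrow> \<pi> -` I \<subseteq> J'"
    using assms[OF is_ideal_vimage[OF I]] by blast
  have Idl: "ideal (Idl (\<pi> ` T)) R" "\<pi> ` T \<subseteq> Idl (\<pi> ` T)"
    by (rule genideal_ideal, blast) (rule genideal_self, blast)
  have "\<pi> -` I \<subseteq> \<pi> -` (Idl (\<pi> ` T))"
    using is_ideal_vimage[OF Idl(1)] Idl(2) by (intro T(3)) auto
  then have "\<pi> ` (\<pi> -` I) \<subseteq> Idl (\<pi> ` T)" by blast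
  moreover have "I \<subseteq> carrier R" using ideal.Icarr[OF I] by auto
  ultimately have "I \<subseteq> Idl (\<pi> ` T)" by (simp only: image_vimage)
  moreover have "Idl (\<pi> ` T) \<subseteq> I" using T(2) by (intro genideal_minimal I) auto
  ultimately show "\<exists>A\<subseteq>carrier R. finite A \<and> I = Idl A"
    using T(1) by (intro exI[of _ "\<pi> ` T"]) auto
qed

text \<open>One number \<open>d\<close> bounds the depth from below and the height from above at
  every maximal ideal; depth never exceeding height closes the circle.\<close>

theorem Cohen_Macaulay_ringI:
  assumes "noetherian_ring R"
    and chains: "\<And>Q r. (\<And>i. i \<le> r \<Longrightarrow> is_prime_ideal (Q i)) \<Longrightarrow> (\<And>i. i < r \<Longrightarrow> Q i \<subset> Q (Suc i)) \<Longrightarrow>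
      ker \<subseteq> Q 0 \<Longrightarrow> r \<le> d"
    and seqs: "\<And>M. is_maximal_ideal M \<Longrightarrow> ker \<subseteq> M \<Longrightarrow>
      \<exists>fs. length fs = d \<and> set fs \<subseteq> M \<and> weakly_regular ker fs"
  shows "Cohen_Macaulay_ring R"
  unfolding Cohen_Macaulay_ring_def
proof (intro conjI allI impI)
  show "cring R" "noetherian_ring R" by (rule cring_axioms, fact)
  fix M assume M: "maximalideal M R"
  let ?M = "\<pi> -` M"
  have I: "ideal M R" using M by (simp add: maximalideal_def)
  have Mi: "\<pi> ` ?M = M" using ideal.Icarr[OF I] by (intro image_vimage) blast
  have m: "is_maximal_ideal ?M" "ker \<subseteq> ?M"
    using is_maximal_ideal_vimage[OF M] is_ideal_vimage[OF I] by blast+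
  obtain fs where fs: "length fs = d" "set fs \<subseteq> ?M" "weakly_regular ker fs" using seqs[OF m] by blast
  have "enat d \<le> ideal_depth R M"
    using ideal_depth_ge[of ?M fs] m fs unfolding Mi by (simp add: is_maximal_ideal_def)
  moreover have "ideal_depth R M \<le> prime_height R M"
    using ideal_depth_le_prime_height[OF is_maximal_ideal_prime[OF m(1)] m(2)] unfolding Mi .
  moreover have "prime_height R M \<le> enat d" using chains by (rule prime_height_le)
  ultimately show "ideal_depth R M = prime_height R M" by order
qed

theorem Cohen_Macaulay_ringD:
  assumes "Cohen_Macaulay_ring R" and M: "is_maximal_ideal (Q r)"
    and Q: "\<And>i. i \<le> r \<Longrightarrow> is_prime_ideal (Q i)" "\<And>i. i < r \<Longrightarrow> Q i \<subset> Q (Suc i)" "ker \<subseteq> Q 0"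
  obtains fs where "r \<le> length fs" "set fs \<subseteq> Q r" "weakly_regular ker fs"
proof -
  have kr: "ker \<subseteq> Q r"
    using strict_chain_superset[of r Q, OF Q(2) order_refl Q(3)] .
  have ge: "enat r \<le> ideal_depth R (\<pi> ` Q r)"
    using prime_height_ge[of r Q, OF Q] assms(1) maximalideal_image[OF M kr]
    unfolding Cohen_Macaulay_ring_def by simp
  have "\<exists>xs. regular_sequence R xs \<and> set xs \<subseteq> \<pi> ` Q r \<and> r \<le> length xs"
  proof (rule ccontr)
    assume "\<not> ?thesis"
    then have none: "length xs < r" if "regular_sequence R xs" "set xs \<subseteq> \<pi> ` Q r" for xs
      using that by (meson not_le)
    \<comment> \<open>The empty sequence is regular because \<open>ker\<close> is proper. Hence
      \<open>r\<close> is positive and \<open>r - 1\<close> below is not truncated.\<close>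
    have "1 \<notin> ker" using kr M by (auto simp: is_maximal_ideal_def)
    then have "regular_sequence R (map \<pi> [])" unfolding regular_sequence_iff by simp
    then have r: "0 < r" using none[of "[]"] by simp
    have "ideal_depth R (\<pi> ` Q r) \<le> enat (r - 1)"
      unfolding ideal_depth_def
    proof (rule Sup_least)
      fix x assume "x \<in> {enat (length xs) | xs. regular_sequence R xs \<and> set xs \<subseteq> \<pi> ` Q r}"
      then obtain xs where "x = enat (length xs)" "regular_sequence R xs" "set xs \<subseteq> \<pi> ` Q r" by blast
      then show "x \<le> enat (r - 1)" using none[of xs] by simp
    qed
    then have "enat r \<le> enat (r - 1)" using ge by (rule order_trans[rotated])
    then show False using r by simp
  qed
  then obtain xs where xs: "regular_sequence R xs" "set xs \<subseteq> \<pi> ` Q r" "r \<le> length xs" by blast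
  have "is_ideal (Q r)" using M by (simp add: is_maximal_ideal_def)
  then obtain fs where "length fs = length xs" "set fs \<subseteq> Q r" "weakly_regular ker fs"
    using regular_sequenceE[OF xs(1,2) _ kr] by blast
  then show thesis using that[of fs] xs(3) by simp
qed

end

section \<open>The Krull dimension of a Stanley-Reisner ring\<close>

text \<open>Gaussian elimination: an equation with a nonzero coefficient at \<open>x0\<close> is
  solved for \<open>x0\<close>, which removes one equation and one unknown.\<close>

lemma homogeneous_system_solution:
  fixes a :: "'x \<Rightarrow> 'y \<Rightarrow> 'k::field"
  assumes "finite Y" "finite X" "card Y < card X"
  shows "\<exists>c. (\<exists>x\<in>X. c x \<noteq> 0) \<and> (\<forall>y\<in>Y. (\<Sum>x\<in>X. c x * a x y) = 0)"
  using assms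
proof (induction Y arbitrary: X a rule: finite_induct)
  case empty
  then have "X \<noteq> {}" by auto
  then show ?case by (intro exI[of _ "\<lambda>_. 1"]) auto
next
  case (insert y Y)
  show ?case
  proof (cases "\<forall>x\<in>X. a x y = 0")
    case True
    obtain c where "\<exists>x\<in>X. c x \<noteq> 0" "\<forall>z\<in>Y. (\<Sum>x\<in>X. c x * a x z) = 0"
      using insert.IH[of X a] insert.prems insert.hyps by auto
    moreover have "(\<Sum>x\<in>X. c x * a x y) = 0" using True by (intro sum.neutral) auto
    ultimately show ?thesis by (intro exI[of _ c]) auto
  next
    case False
    then obtain x0 where x0: "x0 \<in> X" "a x0 y \<noteq> 0" by blast
    let ?X = "X - {x0}"
    let ?b = "\<lambda>x z. a x z - a x y / a x0 y * a x0 z"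
    have "card Y < card ?X" using insert.prems insert.hyps x0(1) by simp
    then obtain c where c: "\<exists>x\<in>?X. c x \<noteq> 0" "\<forall>z\<in>Y. (\<Sum>x\<in>?X. c x * ?b x z) = 0"
      using insert.IH[of ?X ?b] insert.prems(1) by blast
    let ?c = "c(x0 := - (\<Sum>x\<in>?X. c x * a x y / a x0 y))"
    have eq: "(\<Sum>x\<in>X. ?c x * a x z) = (\<Sum>x\<in>?X. c x * ?b x z)" for z
    proof -
      have "(\<Sum>x\<in>X. ?c x * a x z) = ?c x0 * a x0 z + (\<Sum>x\<in>?X. ?c x * a x z)"
        using insert.prems(1) x0(1) by (rule sum.remove)
      also have "(\<Sum>x\<in>?X. ?c x * a x z) = (\<Sum>x\<in>?X. c x * a x z)" by (intro sum.cong) auto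
      also have "?c x0 * a x0 z = - (\<Sum>x\<in>?X. c x * a x y / a x0 y * a x0 z)"
        by (simp add: sum_distrib_right)
      finally show ?thesis by (simp add: sum_subtractf algebra_simps)
    qed
    have "(\<Sum>x\<in>?X. c x * ?b x y) = 0" using x0(2) by (intro sum.neutral) simp
    then have "\<forall>z\<in>insert y Y. (\<Sum>x\<in>X. ?c x * a x z) = 0" using c(2) unfolding eq by blast
    moreover have "\<exists>x\<in>X. ?c x \<noteq> 0" using c(1) by auto
    ultimately show ?thesis by blast
  qed
qed

section \<open>Counting products of given polynomials against monomials supported on faces\<close>

definition exponents_below :: "nat \<Rightarrow> nat \<Rightarrow> nat list set" where
  "exponents_below N r = {e. set e \<subseteq> {..<N} \<and> length e = r}"

definition list_power :: "'a::comm_monoid_mult list \<Rightarrow> nat list \<Rightarrow> 'a" where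
  "list_power ys e = prod_list (map2 (^) ys e)"

lemma exponents_below_finite_card: "finite (exponents_below N r)" "card (exponents_below N r) = N ^ r"
  unfolding exponents_below_def by (simp_all add: finite_lists_length_eq card_lists_length_eq)

lemma sum_exponents_below_Suc:
  "(\<Sum>e\<in>exponents_below N (Suc r). f e) = (\<Sum>j<N. \<Sum>e\<in>exponents_below N r. f (j # e))"
proof -
  have eq: "exponents_below N (Suc r) = (\<lambda>(j, e). j # e) ` ({..<N} \<times> exponents_below N r)"
    unfolding exponents_below_def by (auto simp: length_Suc_conv image_iff)
  have inj: "inj_on (\<lambda>(j, e). j # e) ({..<N} \<times> exponents_below N r)" by (auto simp: inj_on_def)
  show ?thesis
    unfolding eq sum.reindex[OF inj] by (simp add: sum.cartesian_product case_prod_unfold)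
qed

text \<open>The least exponent of \<open>y\<^sub>1\<close> in a relation modulo \<open>Q\<^sub>0\<close> can be divided out since
  \<open>y\<^sub>1 \<notin> Q\<^sub>0\<close>; since \<open>y\<^sub>1 \<in> Q\<^sub>1\<close>, its coefficient is then a relation modulo \<open>Q\<^sub>1\<close> between the others.\<close>

lemma prime_chain_independent:
  fixes Q :: "nat \<Rightarrow> ('v, 'k::field) mpoly set"
  assumes "\<And>i. i \<le> length ys \<Longrightarrow> is_prime_ideal (Q i)"
    and "\<And>i. i < length ys \<Longrightarrow> Q i \<subseteq> Q (Suc i)"
    and "\<And>i. i < length ys \<Longrightarrow> ys ! i \<in> Q (Suc i) - Q i"
    and "(\<Sum>e\<in>exponents_below N (length ys). cst (c e) * list_power ys e) \<in> Q 0"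
    and "e \<in> exponents_below N (length ys)"
  shows "c e = 0"
  using assms
proof (induction ys arbitrary: Q c e)
  case Nil
  have p: "is_prime_ideal (Q 0)" using Nil(1)[of 0] by simp
  have "exponents_below N 0 = {[]}" by (auto simp: exponents_below_def)
  then have "cst (c []) \<in> Q 0" and e: "e = []" using Nil(4,5) by (auto simp: list_power_def)
  then have "cst (inverse (c [])) * cst (c []) \<in> Q 0"
    using p is_idealD(3) unfolding is_prime_ideal_def by blast
  then have "cst (inverse (c []) * c []) \<in> Q 0" by (simp add: mult_single)
  then show "c e = 0" using p e by (cases "c [] = 0") (auto simp: is_prime_ideal_def)
next
  case (Cons y ys)
  define S where "S j = (\<Sum>e\<in>exponents_below N (length ys). cst (c (j # e)) * list_power ys e)" for j
  have p: "is_prime_ideal (Q i)" if "i \<le> 1" for i using Cons.prems(1)[of i] that by simp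
  have i0: "is_ideal (Q 0)" and i1: "is_ideal (Q 1)" using p[of 0] p[of 1] by (auto simp: is_prime_ideal_def)
  have y: "y \<notin> Q 0" "y \<in> Q 1" "Q 0 \<subseteq> Q 1" using Cons.prems(2,3)[of 0] by auto
  have "(\<Sum>e\<in>exponents_below N (length (y # ys)). cst (c e) * list_power (y # ys) e) =
      (\<Sum>j<N. y ^ j * S j)"
    by (simp add: sum_exponents_below_Suc S_def sum_distrib_left list_power_def mult.left_commute)
  then have sum: "(\<Sum>j<N. y ^ j * S j) \<in> Q 0" using Cons.prems(4) by simp
  have zero: "c (j # e) = 0" if "S j \<in> Q 1" "e \<in> exponents_below N (length ys)" for j e
  proof (rule Cons.IH[of "\<lambda>i. Q (Suc i)" "\<lambda>e. c (j # e)"])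
    fix i
    show "is_prime_ideal (Q (Suc i))" if "i \<le> length ys" using Cons.prems(1)[of "Suc i"] that by simp
    assume "i < length ys"
    then show "Q (Suc i) \<subseteq> Q (Suc (Suc i))" "ys ! i \<in> Q (Suc (Suc i)) - Q (Suc i)"
      using Cons.prems(2,3)[of "Suc i"] by auto
  qed (use that in \<open>auto simp: S_def\<close>)
  have S: "S j \<in> Q 1" if "j < N" for j
    using that
  proof (induction j rule: less_induct)
    case (less j)
    \<comment> \<open>By induction these \<open>S i\<close> lie in \<open>Q 1\<close>, which forces
      all their coefficients to vanish; what remains of the sum is divisible by
      \<open>y ^ j\<close>.\<close>
    have "S i = 0" if "i < j" for i
      unfolding S_def using zero less that by (intro sum.neutral) auto
    then have "(\<Sum>i<N. y ^ i * S i) = (\<Sum>i\<in>{j..<N}. y ^ i * S i)"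
      using less.prems by (intro sum.mono_neutral_right) auto
    also have "\<dots> = y ^ j * S j + (\<Sum>i\<in>{Suc j..<N}. y ^ i * S i)"
      using less.prems by (simp add: sum.atLeast_Suc_lessThan)
    also have "(\<Sum>i\<in>{Suc j..<N}. y ^ i * S i) = y ^ j * (y * (\<Sum>i\<in>{Suc j..<N}. y ^ (i - Suc j) * S i))"
      unfolding sum_distrib_left
    proof (rule sum.cong)
      fix i assume "i \<in> {Suc j..<N}"
      then have "i = j + Suc (i - Suc j)" by simp
      then have "y ^ i = y ^ j * (y * y ^ (i - Suc j))" by (metis power_Suc power_add)
      then show "y ^ i * S i = y ^ j * (y * (y ^ (i - Suc j) * S i))" by (simp add: mult.assoc)
    qed simp
    finally have "y ^ j * (S j + y * (\<Sum>i\<in>{Suc j..<N}. y ^ (i - Suc j) * S i)) \<in> Q 0"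
      using sum by (simp add: distrib_left)
    moreover have "y ^ j \<notin> Q 0"
      using p[of 0] y(1) by (induction j) (auto simp: is_prime_ideal_def)
    ultimately have "S j + y * (\<Sum>i\<in>{Suc j..<N}. y ^ (i - Suc j) * S i) \<in> Q 1"
      using p[of 0] y(3) unfolding is_prime_ideal_def by blast
    then show ?case
      using is_idealD(6)[OF i1 _ is_idealD(4)[OF i1 y(2)], of "S j + y * T" T for T] by simp
  qed
  from Cons.prems(5) obtain j e' where "e = j # e'" "j < N" "e' \<in> exponents_below N (length ys)"
    by (auto simp: exponents_below_def length_Suc_conv)
  then show ?case using zero S by blast
qed

text \<open>Bounding each exponent separately, not the total degree, gives a box of monomials for
  each face, which is easy to count.\<close>

definition exponents_le :: "nat \<Rightarrow> ('v, 'k::zero) mpoly \<Rightarrow> bool" where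
  "exponents_le B p \<longleftrightarrow> (\<forall>m\<in>keys p. \<forall>v. lookup m v \<le> B)"

lemma exponents_le_mult:
  fixes p q :: "('v, 'k::comm_ring_1) mpoly"
  assumes "exponents_le A p" "exponents_le B q"
  shows "exponents_le (A + B) (p * q)"
  unfolding exponents_le_def
proof (intro ballI allI)
  fix m v assume "m \<in> keys (p * q)"
  then obtain a b where "m = a + b" "a \<in> keys p" "b \<in> keys q" using keys_mult[of p q] by blast
  then show "lookup m v \<le> A + B" using assms by (simp add: exponents_le_def lookup_add add_mono)
qed

lemma exponents_le_one: "exponents_le 0 (1 :: ('v, 'k::comm_ring_1) mpoly)"
  by (simp add: exponents_le_def)

lemma exponents_le_mono: "exponents_le A p \<Longrightarrow> A \<le> B \<Longrightarrow> exponents_le B p"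
  unfolding exponents_le_def by (meson order_trans)

lemma exponents_le_power:
  fixes p :: "('v, 'k::comm_ring_1) mpoly"
  assumes "exponents_le D p"
  shows "exponents_le (j * D) (p ^ j)"
  by (induction j) (auto intro: exponents_le_mult assms exponents_le_one)

lemma exponents_le_exists: "\<exists>B. exponents_le B (p :: ('v, 'k::comm_ring_1) mpoly)"
proof (induction p rule: poly_mapping_add_induct)
  case (single m c)
  have "lookup m v \<le> Max (insert 0 (Poly_Mapping.range m))" for v
    by (cases "lookup m v = 0") (auto intro!: Max_ge in_keys_lookup_in_range simp: in_keys_iff)
  then show ?case unfolding exponents_le_def by auto
next
  case (add p q)
  then obtain A B where "exponents_le A p" "exponents_le B q" by blast
  then have "exponents_le (max A B) p" "exponents_le (max A B) q" by (auto intro: exponents_le_mono)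
  then show ?case using Poly_Mapping.keys_add[of p q] unfolding exponents_le_def by blast
qed

lemma exponents_le_list_power:
  assumes "\<And>y. y \<in> set ys \<Longrightarrow> exponents_le D (y :: ('v, 'k::comm_ring_1) mpoly)"
    "e \<in> exponents_below N (length ys)"
  shows "exponents_le (length ys * N * D) (list_power ys e)"
  using assms
proof (induction ys arbitrary: e)
  case Nil
  then show ?case by (simp add: list_power_def exponents_le_one)
next
  case (Cons y ys)
  then obtain j e' where e: "e = j # e'" "j < N" "e' \<in> exponents_below N (length ys)"
    by (auto simp: exponents_below_def length_Suc_conv)
  have "exponents_le (N * D) (y ^ j)"
    using exponents_le_mono[OF exponents_le_power[of D y j]] e(2) Cons.prems(1) by simp
  then have "exponents_le (N * D + length ys * N * D) (y ^ j * list_power ys e')"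
    using Cons.IH[of e'] Cons.prems(1) e(3) by (intro exponents_le_mult) auto
  then show ?case by (simp add: e(1) list_power_def algebra_simps)
qed

definition face_monomials :: "'v set set \<Rightarrow> nat \<Rightarrow> ('v \<Rightarrow>\<^sub>0 nat) set" where
  "face_monomials \<Delta> B = {m. keys m \<in> \<Delta> \<and> (\<forall>v. lookup m v \<le> B)}"

text \<open>A monomial is determined by its support and its exponents there, so each face
  contributes at most \<open>(B + 1) ^ d\<close> of them.\<close>

lemma face_monomials_finite_card:
  assumes "finite \<Delta>" "\<And>F. F \<in> \<Delta> \<Longrightarrow> finite F \<and> card F \<le> d"
  shows "finite (face_monomials \<Delta> B) \<and> card (face_monomials \<Delta> B) \<le> card \<Delta> * (B + 1) ^ d"
proof -
  let ?M = "\<lambda>F. {m :: 'a \<Rightarrow>\<^sub>0 nat. keys m = F \<and> (\<forall>v. lookup m v \<le> B)}"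
  have M: "finite (?M F) \<and> card (?M F) \<le> (B + 1) ^ d" if F: "F \<in> \<Delta>" for F
  proof -
    have fin: "finite F" "card F \<le> d" using assms(2)[OF F] by auto
    let ?f = "\<lambda>m :: 'a \<Rightarrow>\<^sub>0 nat. restrict (lookup m) F"
    have inj: "inj_on ?f (?M F)"
    proof (rule inj_onI)
      fix m n assume m: "m \<in> ?M F" "n \<in> ?M F" "?f m = ?f n"
      show "m = n"
      proof (rule poly_mapping_eqI)
        fix v
        show "lookup m v = lookup n v"
          using fun_cong[OF m(3), of v] m(1,2) by (cases "v \<in> F") (auto simp: in_keys_iff)
      qed
    qed
    have sub: "?f ` ?M F \<subseteq> PiE F (\<lambda>_. {..B})" by auto
    have finP: "finite (PiE F (\<lambda>_. {..B}))" using fin by (simp add: finite_PiE)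
    have "finite (?M F)" "card (?M F) \<le> card (PiE F (\<lambda>_. {..B}))"
      using inj_on_finite[OF inj sub finP] card_inj_on_le[OF inj sub finP] .
    moreover have "card (PiE F (\<lambda>_. {..B})) = (B + 1) ^ card F" using fin by (simp add: card_PiE)
    moreover have "(B + 1) ^ card F \<le> (B + 1) ^ d" using fin by (intro power_increasing) auto
    ultimately show ?thesis by linarith
  qed
  have eq: "face_monomials \<Delta> B = (\<Union>F\<in>\<Delta>. ?M F)" by (auto simp: face_monomials_def)
  have "card (face_monomials \<Delta> B) \<le> (\<Sum>F\<in>\<Delta>. card (?M F))"
    unfolding eq by (rule card_UN_le[OF assms(1)])
  also have "\<dots> \<le> (\<Sum>F\<in>\<Delta>. (B + 1) ^ d)" using M by (intro sum_mono) blast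
  also have "\<dots> = card \<Delta> * (B + 1) ^ d" by simp
  finally show ?thesis using M assms(1) by (auto simp: eq)
qed

text \<open>With \<open>d + 1\<close> strict steps there are \<open>N ^ (d + 1)\<close> products of
  the witnesses \<open>ys\<close>, but the monomials on faces that occur in them grow only like
  \<open>N ^ d\<close>. For large \<open>N\<close> some nontrivial combination lies in
  \<open>sr_ideal \<Delta>\<close>, contradicting \<open>prime_chain_independent\<close>.\<close>

theorem prime_chain_length_sr:
  fixes Q :: "nat \<Rightarrow> ('v, 'k::field) mpoly set"
  assumes \<Delta>: "finite \<Delta>" "\<And>F. F \<in> \<Delta> \<Longrightarrow> finite F \<and> card F \<le> d"
    and Q: "\<And>i. i \<le> r \<Longrightarrow> is_prime_ideal (Q i)" "\<And>i. i < r \<Longrightarrow> Q i \<subset> Q (Suc i)" "sr_ideal \<Delta> \<subseteq> Q 0"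
  shows "r \<le> d"
proof (rule ccontr)
  assume "\<not> r \<le> d"
  then have r: "Suc d \<le> r" by simp
  define y where "y i = (SOME a. a \<in> Q (Suc i) - Q i)" for i
  have y: "y i \<in> Q (Suc i) - Q i" if "i < Suc d" for i
  proof -
    have "\<exists>a. a \<in> Q (Suc i) - Q i" using Q(2)[of i] r that by auto
    then show ?thesis unfolding y_def by (rule someI_ex)
  qed
  define ys where "ys = map y [0..<Suc d]"
  have len: "length ys = Suc d" by (simp add: ys_def)
  have nth: "ys ! i = y i" if "i < Suc d" for i
    using that unfolding ys_def by (simp del: upt_Suc)
  define bnd where "bnd p = (SOME B. exponents_le B p)" for p :: "('v, 'k) mpoly"
  have bnd: "exponents_le (bnd p) p" for p unfolding bnd_def using exponents_le_exists by (rule someI_ex)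
  define D where "D = (\<Sum>p\<in>set ys. bnd p)"
  have D: "exponents_le D p" if "p \<in> set ys" for p
    using that by (intro exponents_le_mono[OF bnd]) (auto simp: D_def intro!: member_le_sum)
  \<comment> \<open>\<open>A\<close> is chosen so that \<open>B + 1 \<le> N * A\<close>. The face
    monomials then number at most \<open>N ^ d * (card \<Delta> * A ^ d)\<close>, and
    \<open>N\<close> exceeds the second factor by one.\<close>
  define A where "A = Suc d * D + 1"
  define N where "N = card \<Delta> * A ^ d + 1"
  define B where "B = Suc d * N * D"
  have "B + 1 \<le> N * A" by (simp add: B_def A_def N_def algebra_simps)
  have "card (face_monomials \<Delta> B) \<le> card \<Delta> * (B + 1) ^ d"
    using face_monomials_finite_card[OF \<Delta>] by blast
  also have "\<dots> \<le> card \<Delta> * (N * A) ^ d"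
    using \<open>B + 1 \<le> N * A\<close> by (intro mult_le_mono2 power_mono) auto
  also have "\<dots> = N ^ d * (card \<Delta> * A ^ d)" by (simp add: power_mult_distrib)
  also have "\<dots> < N ^ d * N" by (simp add: N_def)
  also have "\<dots> = card (exponents_below N (Suc d))" by (simp add: exponents_below_finite_card)
  finally obtain c where c: "\<exists>e\<in>exponents_below N (Suc d). c e \<noteq> 0"
    "\<forall>m\<in>face_monomials \<Delta> B. (\<Sum>e\<in>exponents_below N (Suc d). c e * lookup (list_power ys e) m) = 0"
    using homogeneous_system_solution[of "face_monomials \<Delta> B" "exponents_below N (Suc d)"
        "\<lambda>e. lookup (list_power ys e)"]
      face_monomials_finite_card[OF \<Delta>] exponents_below_finite_card(1) by blast
  let ?p = "\<Sum>e\<in>exponents_below N (Suc d). cst (c e) * list_power ys e"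
  have "?p \<in> sr_ideal \<Delta>"
    unfolding sr_ideal_def
  proof (intro CollectI ballI notI)
    fix m assume m: "m \<in> keys ?p" "keys m \<in> \<Delta>"
    have lp: "lookup ?p m = (\<Sum>e\<in>exponents_below N (Suc d). c e * lookup (list_power ys e) m)"
      by (simp add: lookup_sum)
    show False
    proof (cases "m \<in> face_monomials \<Delta> B")
      case True
      then show False using c(2) m(1) lp by (simp add: in_keys_iff)
    next
      case False
      have "lookup (list_power ys e) m = 0" if "e \<in> exponents_below N (Suc d)" for e
      proof -
        have "exponents_le B (list_power ys e)"
          using exponents_le_list_power[of ys D e N] D that unfolding B_def len by blast
        then show ?thesis
          using False m(2) by (auto simp: exponents_le_def face_monomials_def in_keys_iff)
      qed
      then show False using m(1) lp by (simp add: in_keys_iff)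
    qed
  qed
  then have p: "?p \<in> Q 0" using Q(3) by blast
  have "c e = 0" if "e \<in> exponents_below N (Suc d)" for e
  proof (rule prime_chain_independent[where ys = ys and Q = Q and N = N])
    fix i
    show "is_prime_ideal (Q i)" if "i \<le> length ys" using Q(1)[of i] that r len by simp
    assume "i < length ys"
    then show "Q i \<subseteq> Q (Suc i)" "ys ! i \<in> Q (Suc i) - Q i"
      using Q(2)[of i] y[of i] nth[of i] r len by auto
  qed (use p that len in auto)
  then show False using c(1) by blast
qed

section \<open>Leading monomials and the basis theorem\<close>

definition lead_monom :: "('v::linorder, 'k::zero) mpoly \<Rightarrow> ('v \<Rightarrow>\<^sub>0 nat)" where
  "lead_monom p = Max (keys p)"

lemma lead_monom_in_keys: "p \<noteq> 0 \<Longrightarrow> lead_monom p \<in> keys p"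
  unfolding lead_monom_def by (rule Max_in) (auto simp: poly_mapping_eq_iff fun_eq_iff in_keys_iff)

lemma lead_monom_max: "m \<in> keys p \<Longrightarrow> m \<le> lead_monom p"
  unfolding lead_monom_def by simp

lemma exponent_zero_le: "0 \<le> (m :: 'v::linorder \<Rightarrow>\<^sub>0 nat)"
proof (rule ccontr)
  assume "\<not> 0 \<le> m"
  then have "m < 0" by simp
  then show False by (auto simp: less_poly_mapping.rep_eq less_fun_def)
qed

text \<open>Once the leading term of \<open>p\<close> is split off, no product of remaining
  monomials reaches the sum of the two leading ones.\<close>

lemma lookup_lead_monom_mult:
  fixes p q :: "('v::linorder, 'k::field) mpoly"
  shows "lookup (p * q) (lead_monom p + lead_monom q) = lookup p (lead_monom p) * lookup q (lead_monom q)"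
proof -
  let ?m = "lead_monom p" and ?n = "lead_monom q"
  define r where "r = p - single ?m (lookup p ?m)"
  have r: "a < ?m" if "a \<in> keys r" for a
  proof -
    have "a \<noteq> ?m" "a \<in> keys p"
      using that by (auto simp: r_def in_keys_iff lookup_minus lookup_single when_def split: if_splits)
    then show ?thesis using lead_monom_max[of a p] by simp
  qed
  have "?m + ?n \<notin> keys (r * q)"
  proof
    assume "?m + ?n \<in> keys (r * q)"
    then obtain a b where "?m + ?n = a + b" "a \<in> keys r" "b \<in> keys q"
      using keys_mult[of r q] by blast
    then show False using add_less_le_mono[OF r[of a] lead_monom_max[of b q]] by simp
  qed
  moreover have "p * q = r * q + single ?m (lookup p ?m) * q" by (simp add: r_def algebra_simps)
  ultimately show ?thesis by (simp add: lookup_add in_keys_iff)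
qed

lemma lead_monom_mult:
  fixes p q :: "('v::linorder, 'k::field) mpoly"
  assumes "p \<noteq> 0" "q \<noteq> 0"
  shows "lead_monom (p * q) = lead_monom p + lead_monom q"
  unfolding lead_monom_def[of "p * q"]
proof (rule Max_eqI)
  show "lead_monom p + lead_monom q \<in> keys (p * q)"
    using lookup_lead_monom_mult[of p q] assms lead_monom_in_keys[of p] lead_monom_in_keys[of q]
    by (simp add: in_keys_iff)
  fix m assume "m \<in> keys (p * q)"
  then obtain a b where "m = a + b" "a \<in> keys p" "b \<in> keys q" using keys_mult[of p q] by blast
  then show "m \<le> lead_monom p + lead_monom q" by (simp add: add_mono lead_monom_max)
qed simp

text \<open>Leading monomials add up in products and 0 is the least exponent vector, so both factors
  of 1 have leading monomial 0 and are constants.\<close>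

lemma unit_keys:
  fixes p q :: "('v::linorder, 'k::field) mpoly"
  assumes "p * q = 1" "m \<in> keys p"
  shows "m = 0"
proof -
  have "p \<noteq> 0" "q \<noteq> 0" using assms(1) by auto
  then have "lead_monom p + lead_monom q = lead_monom (1 :: ('v, 'k) mpoly)"
    using lead_monom_mult[of p q] assms(1) by simp
  then have 0: "lead_monom p + lead_monom q = 0" by (simp add: lead_monom_def)
  have "lookup (lead_monom p) v = 0" for v
    using arg_cong[OF 0, of "\<lambda>m. lookup m v"] by (simp add: lookup_add)
  then have "lead_monom p = 0" by (intro poly_mapping_eqI) simp
  then show "m = 0" using lead_monom_max[OF assms(2)] exponent_zero_le[of m] by simp
qed

section \<open>Dickson's lemma and the well-foundedness of the monomial order\<close>

lemma nat_incseq_subsequence: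
  fixes a :: "nat \<Rightarrow> nat"
  shows "\<exists>r. strict_mono (r :: nat \<Rightarrow> nat) \<and> incseq (\<lambda>i. a (r i))"
proof -
  obtain f where f: "strict_mono f" "monoseq (\<lambda>i. a (f i))" using seq_monosub[of a] by blast
  show ?thesis
  proof (cases "incseq (\<lambda>i. a (f i))")
    case False
    then have dec: "decseq (\<lambda>i. a (f i))" using f(2) by (simp add: monoseq_iff)
    \<comment> \<open>A nonincreasing sequence of natural numbers is constant from the index of its
      least value on.\<close>
    obtain i0 where i0: "\<forall>i. a (f i0) \<le> a (f i)"
      using ex_has_least_nat[of "\<lambda>_. True" 0 "\<lambda>i. a (f i)"] by blast
    have "a (f (i + i0)) = a (f i0)" for i
      using i0 decseqD[OF dec, of i0 "i + i0"] by (simp add: le_antisym)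
    then have "incseq (\<lambda>i. a (f (i + i0)))" by (simp add: incseq_def)
    moreover have "strict_mono (\<lambda>i. f (i + i0))" using f(1) by (simp add: strict_mono_def)
    ultimately show ?thesis by (intro exI[of _ "\<lambda>i. f (i + i0)"]) blast
  qed (use f in blast)
qed

lemma dickson_subsequence:
  fixes l :: "nat \<Rightarrow> 'v \<Rightarrow>\<^sub>0 nat"
  assumes "finite V"
  shows "\<exists>r. strict_mono (r :: nat \<Rightarrow> nat) \<and> (\<forall>v\<in>V. incseq (\<lambda>i. lookup (l (r i)) v))"
  using assms
proof induction
  case empty
  then show ?case by (intro exI[of _ id]) (simp add: strict_mono_def)
next
  case (insert v V)
  then obtain r where r: "strict_mono r" "\<forall>v\<in>V. incseq (\<lambda>i. lookup (l (r i)) v)" by blast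
  obtain f where f: "strict_mono f" "incseq (\<lambda>i. lookup (l (r (f i))) v)"
    using nat_incseq_subsequence[of "\<lambda>i. lookup (l (r i)) v"] by blast
  have "incseq (\<lambda>i. lookup (l (r (f i))) w)" if "w \<in> V" for w
    using r(2) that f(1) by (simp add: incseq_def strict_mono_less_eq)
  then show ?case
    using f(2) strict_mono_o[OF r(1) f(1)] by (intro exI[of _ "r \<circ> f"]) (auto simp: comp_def)
qed

text \<open>Along a subsequence with all exponents nondecreasing, the first term already divides the
  second.\<close>

lemma dickson:
  fixes l :: "nat \<Rightarrow> 'v \<Rightarrow>\<^sub>0 nat"
  assumes "finite V" "\<And>i. keys (l i) \<subseteq> V"
  shows "\<exists>i j n. i < j \<and> l j = l i + n"
proof -
  obtain r where r: "strict_mono (r :: nat \<Rightarrow> nat)" "\<forall>v\<in>V. incseq (\<lambda>i. lookup (l (r i)) v)"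
    using dickson_subsequence[OF assms(1)] by blast
  have le: "lookup (l (r 0)) v \<le> lookup (l (r 1)) v" for v
  proof (cases "v \<in> V")
    case True
    then show ?thesis using r(2) by (auto simp: incseq_def)
  next
    case False
    then have "v \<notin> keys (l (r 0))" using assms(2) by blast
    then show ?thesis by (simp add: in_keys_iff)
  qed
  have "l (r 1) = l (r 0) + (l (r 1) - l (r 0))"
    by (intro poly_mapping_eqI) (simp add: lookup_add lookup_minus le[simplified])
  moreover have "r 0 < r 1" using r(1) by (simp add: strict_mono_def)
  ultimately show ?thesis by blast
qed

text \<open>In an infinite descent some term would divide a later one and hence be at most as
  large.\<close>

lemma exponent_wf:
  assumes "finite (V :: 'v::linorder set)"
  shows "wf {(m, n :: 'v \<Rightarrow>\<^sub>0 nat). m < n \<and> keys m \<subseteq> V \<and> keys n \<subseteq> V}"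
  unfolding wf_iff_no_infinite_down_chain
proof
  assume "\<exists>f. \<forall>i. (f (Suc i), f i) \<in> {(m, n :: 'v \<Rightarrow>\<^sub>0 nat). m < n \<and> keys m \<subseteq> V \<and> keys n \<subseteq> V}"
  then obtain f :: "nat \<Rightarrow> 'v \<Rightarrow>\<^sub>0 nat" where f: "\<And>i. f (Suc i) < f i" "\<And>i. keys (f i) \<subseteq> V" by auto
  obtain i j n where ij: "i < j" "f j = f i + n" using dickson[OF assms f(2)] by blast
  have "f j < f i"
    using ij(1) f(1) by (induction j) (auto simp: less_Suc_eq intro: less_trans)
  moreover have "f i \<le> f j" using add_left_mono[OF exponent_zero_le[of n], of "f i"] by (simp add: ij(2))
  ultimately show False by simp
qed

section \<open>Polynomials in a subset of the variables, and finite generation\<close>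

definition poly_in :: "'v set \<Rightarrow> ('v, 'k::comm_ring_1) mpoly set" where
  "poly_in B = {p. \<forall>m\<in>keys p. keys m \<subseteq> B}"

lemma poly_in_add: "p \<in> poly_in B \<Longrightarrow> q \<in> poly_in B \<Longrightarrow> p + q \<in> poly_in B"
  using Poly_Mapping.keys_add[of p q] unfolding poly_in_def by blast

lemma poly_in_mult: "p \<in> poly_in B \<Longrightarrow> q \<in> poly_in B \<Longrightarrow> p * q \<in> poly_in B"
proof -
  assume pq: "p \<in> poly_in B" "q \<in> poly_in B"
  show "p * q \<in> poly_in B"
    unfolding poly_in_def
  proof (intro CollectI ballI)
    fix m assume "m \<in> keys (p * q)"
    then obtain a b where "m = a + b" "a \<in> keys p" "b \<in> keys q" using keys_mult[of p q] by blast
    then show "keys m \<subseteq> B" using pq by (auto simp: poly_in_def keys_exponent_add)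
  qed
qed

lemma poly_in_cst [simp]: "cst c \<in> poly_in B"
  by (simp add: poly_in_def)

lemma poly_in_0 [simp]: "0 \<in> poly_in B" and poly_in_1 [simp]: "1 \<in> poly_in B"
  by (simp_all add: poly_in_def)

lemma poly_in_var [simp]: "v \<in> B \<Longrightarrow> var v \<in> poly_in B"
  by (simp add: poly_in_def var_def)

lemma poly_in_uminus: "p \<in> poly_in B \<Longrightarrow> - p \<in> poly_in B"
  using poly_in_mult[OF poly_in_cst[of "-1"], of p B] by (simp add: single_uminus)

lemma poly_in_diff: "p \<in> poly_in B \<Longrightarrow> q \<in> poly_in B \<Longrightarrow> p - q \<in> poly_in B"
  using poly_in_add[of p B "-q"] poly_in_uminus[of q B] by simp

lemma poly_in_power: "p \<in> poly_in B \<Longrightarrow> p ^ k \<in> poly_in B"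
  by (induction k) (auto intro: poly_in_mult)

lemma poly_in_prod: "(\<And>x. x \<in> X \<Longrightarrow> f x \<in> poly_in B) \<Longrightarrow> prod f X \<in> poly_in B"
  by (induction X rule: infinite_finite_induct) (auto intro: poly_in_mult)

lemma poly_in_sum: "(\<And>x. x \<in> X \<Longrightarrow> f x \<in> poly_in B) \<Longrightarrow> sum f X \<in> poly_in B"
  by (induction X rule: infinite_finite_induct) (auto intro: poly_in_add)

lemma subst_restr_poly_in: "subst (restr V) p \<in> poly_in V"
  unfolding poly_in_def
proof (intro CollectI ballI, rule ccontr)
  fix m assume m: "m \<in> keys (subst (restr V) p)" "\<not> keys m \<subseteq> V"
  then have "lookup (subst (restr V) p) m = 0" by (simp add: lookup_subst_restr)
  then show False using m(1) by (simp add: in_keys_iff)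
qed

text \<open>There may be infinitely many variables, so generation is understood relative to those
  outside \<open>V\<close>, which belong to \<open>J\<close> and to every competing
  \<open>J'\<close>. In the variables of \<open>V\<close> the leading monomials of \<open>J\<close>
  have finitely many minimal divisors, and polynomials with these leading monomials generate by the
  division algorithm.\<close>

theorem finitely_generated_modulo_vars:
  fixes J :: "('v::linorder, 'k::field) mpoly set"
  assumes V: "finite V" and J: "is_ideal J" and vars: "\<And>u. u \<notin> V \<Longrightarrow> var u \<in> J"
  shows "\<exists>T. finite T \<and> T \<subseteq> J \<and>
    (\<forall>J'. is_ideal J' \<longrightarrow> (\<forall>u. u \<notin> V \<longrightarrow> var u \<in> J') \<longrightarrow> T \<subseteq> J' \<longrightarrow> J \<subseteq> J')"
proof -
  let ?JV = "{p \<in> J. p \<in> poly_in V \<and> p \<noteq> 0}"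
  define L where "L = lead_monom ` ?JV"
  have LV: "keys l \<subseteq> V" if "l \<in> L" for l
    using that lead_monom_in_keys unfolding L_def poly_in_def by blast
  have "\<exists>L0. finite L0 \<and> L0 \<subseteq> L \<and> (\<forall>l\<in>L. \<exists>l0\<in>L0. \<exists>n. l = l0 + n)"
  proof (rule ccontr)
    assume none: "\<not> ?thesis"
    \<comment> \<open>If no finite set of divisors exists, one can keep choosing leading monomials
      not divisible by any earlier one, against \<open>dickson\<close>.\<close>
    define P where "P f i s \<longleftrightarrow> s \<in> L \<and> (\<forall>j<i. \<not> (\<exists>n. s = f j + n))" for f :: "nat \<Rightarrow> 'v \<Rightarrow>\<^sub>0 nat" and i :: nat and s
    have "\<exists>f. \<forall>i. P f i (f i)"
    proof (rule dependent_wellorder_choice)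
      fix r :: nat and f g :: "nat \<Rightarrow> 'v \<Rightarrow>\<^sub>0 nat" and x
      show "(\<And>y. y < r \<Longrightarrow> f y = g y) \<Longrightarrow> P f r x = P g r x" by (simp add: P_def)
      assume "\<And>y. y < r \<Longrightarrow> P f y (f y)"
      then have "finite (f ` {..<r})" "f ` {..<r} \<subseteq> L" by (auto simp: P_def)
      then obtain l where "l \<in> L" "\<forall>l0\<in>f ` {..<r}. \<not> (\<exists>n. l = l0 + n)" using none by meson
      then show "\<exists>x. P f r x" unfolding P_def by auto
    qed
    then obtain f where f: "\<And>i. P f i (f i)" by blast
    have "keys (f i) \<subseteq> V" for i using f[of i] LV by (simp add: P_def)
    then obtain i j n where "i < j" "f j = f i + n" using dickson[OF V, of f] by blast
    then show False using f[of j] by (auto simp: P_def)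
  qed
  then obtain L0 where L0: "finite L0" "L0 \<subseteq> L" and div: "\<forall>l\<in>L. \<exists>l0\<in>L0. \<exists>n. l = l0 + n"
    by (elim exE conjE)
  obtain T where T: "T \<subseteq> ?JV" "finite T" "L0 = lead_monom ` T"
    using finite_subset_image[OF L0[unfolded L_def]] by blast
  have "J \<subseteq> J'" if J': "is_ideal J'" "\<And>u. u \<notin> V \<Longrightarrow> var u \<in> J'" "T \<subseteq> J'" for J'
  proof
    have red: "p \<in> J'" if "p \<in> ?JV" for p
      using exponent_wf[OF V] that
    proof (induction "lead_monom p" arbitrary: p rule: wf_induct_rule)
      case less
      have "lead_monom p \<in> L" using less.prems by (auto simp: L_def)
      then obtain t n where t: "t \<in> T" "lead_monom p = lead_monom t + n"
        using div T(3) by blast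
      have t0: "t \<in> ?JV" using t(1) T(1) by blast
      \<comment> \<open>The multiple \<open>single n a * t\<close> has the same leading term as
        \<open>p\<close>, so the difference \<open>q\<close> has a smaller one or vanishes.\<close>
      define a where "a = lookup p (lead_monom p) / lookup t (lead_monom t)"
      define q where "q = p - single n a * t"
      have p0: "p \<noteq> 0" "t \<noteq> 0" using less.prems t0 by auto
      have lt0: "lookup t (lead_monom t) \<noteq> 0" "lookup p (lead_monom p) \<noteq> 0"
        using p0 lead_monom_in_keys in_keys_iff by metis+
      have pin: "keys (lead_monom p) \<subseteq> V"
        using lead_monom_in_keys[OF p0(1)] less.prems by (auto simp: poly_in_def)
      have "keys n \<subseteq> V" using pin t(2) by (simp add: keys_exponent_add)
      then have qV: "q \<in> poly_in V"
        using less.prems t0 unfolding q_def by (intro poly_in_diff poly_in_mult) (auto simp: poly_in_def)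
      have tJ: "single n a * t \<in> J'" using J'(3) t(1) is_idealD(3)[OF J'(1)] by blast
      have qJ: "q \<in> J" using less.prems t0 is_idealD(3,6)[OF J] unfolding q_def by blast
      have lt: "m < lead_monom p" if m: "m \<in> keys q" for m
      proof -
        have "m \<in> keys p \<or> m \<in> keys (single n a * t)"
          using m by (auto simp: q_def in_keys_iff lookup_minus)
        then have "m \<le> lead_monom p"
        proof
          assume "m \<in> keys (single n a * t)"
          then obtain b where "m = n + b" "b \<in> keys t" using keys_single_mult_subset[of n a t] by blast
          then show ?thesis using add_left_mono[OF lead_monom_max[of b t], of n] t(2) by (simp add: add.commute)
        qed (rule lead_monom_max)
        moreover have "lookup q (lead_monom p) = 0"
          using lt0 lookup_single_mult[of n a t "lead_monom t"]
          by (simp add: q_def lookup_minus t(2) add.commute a_def)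
        ultimately show ?thesis using m by (metis in_keys_iff order_le_imp_less_or_eq)
      qed
      have "q \<in> J'"
      proof (cases "q = 0")
        case True
        then show ?thesis using is_idealD(1)[OF J'(1)] by simp
      next
        case False
        then have "q \<in> ?JV" using qJ qV by blast
        moreover have "lead_monom q < lead_monom p" using lt lead_monom_in_keys[OF False] by blast
        moreover have "keys (lead_monom q) \<subseteq> V" using lead_monom_in_keys[OF False] qV by (auto simp: poly_in_def)
        ultimately show ?thesis using pin by (intro less.hyps) auto
      qed
      then have "q + single n a * t \<in> J'" using tJ by (rule is_idealD(2)[OF J'(1)])
      then show "p \<in> J'" by (simp add: q_def)
    qed
    fix p assume p: "p \<in> J"
    \<comment> \<open>The part of \<open>p\<close> in the variables of \<open>V\<close>; it differs
      from \<open>p\<close> by an element of any ideal containing the other variables.\<close>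
    let ?r = "subst (restr V) p"
    have d: "p - ?r \<in> K" if "is_ideal K" "\<And>u. u \<notin> V \<Longrightarrow> var u \<in> K" for K
    proof -
      have "subst var p - ?r \<in> K"
        by (rule subst_cong_ideal[OF that(1)]) (auto simp: restr_def that is_idealD(1)[OF that(1)])
      then show ?thesis by simp
    qed
    have "?r \<in> J" using is_ideal_cong[OF J d[OF J vars]] p by blast
    moreover have "?r \<in> poly_in V" by (rule subst_restr_poly_in)
    ultimately have "?r \<in> J'" using red is_idealD(1)[OF J'(1)] by (cases "?r = 0") auto
    then show "p \<in> J'" using is_ideal_cong[OF J'(1) d[OF J'(1,2)]] by blast
  qed
  then show ?thesis using T by (intro exI[of _ T]) auto
qed

section \<open>Koszul cochains\<close>

text \<open>Unnormalized Koszul cochains: a cochain of degree \<open>i\<close> is the restriction of \<open>c\<close> to lists of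
  length \<open>i\<close>. Its cohomology in low degrees detects the length of regular sequences.\<close>

fun koszul :: "('v \<Rightarrow> 'a::comm_ring_1) \<Rightarrow> ('v list \<Rightarrow> 'a) \<Rightarrow> 'v list \<Rightarrow> 'a" where
  "koszul y c [] = 0"
| "koszul y c (u # vs) = y u * c vs - koszul y (\<lambda>ws. c (u # ws)) vs"

lemma koszul_add: "koszul y (\<lambda>ws. c ws + d ws) vs = koszul y c vs + koszul y d vs"
  by (induction vs arbitrary: c d) (simp_all add: algebra_simps)

lemma koszul_scale: "koszul y (\<lambda>ws. f * c ws) vs = f * koszul y c vs"
  by (induction vs arbitrary: c) (simp_all add: algebra_simps)

lemma koszul_diff: "koszul y (\<lambda>ws. c ws - d ws) vs = koszul y c vs - koszul y d vs"
  by (induction vs arbitrary: c d) (simp_all add: algebra_simps)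

lemma koszul_koszul: "koszul y (koszul y c) vs = 0"
proof (induction vs arbitrary: c)
  case (Cons u vs)
  have "koszul y (\<lambda>ws. koszul y c (u # ws)) vs =
      koszul y (\<lambda>ws. y u * c ws) vs - koszul y (koszul y (\<lambda>ws. c (u # ws))) vs"
    by (simp add: koszul_diff)
  then show ?case using Cons.IH by (simp add: koszul_scale)
qed simp

lemma koszul_in_ideal:
  assumes "is_ideal J" "\<And>ws. Suc (length ws) = length vs \<Longrightarrow> c ws \<in> J"
  shows "koszul y c vs \<in> J"
  using assms(2)
proof (induction vs arbitrary: c)
  case (Cons u vs)
  have "koszul y (\<lambda>ws. c (u # ws)) vs \<in> J" using Cons.prems by (intro Cons.IH) simp
  then show ?case using Cons.prems is_idealD(3,6)[OF assms(1)] by simp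
qed (simp add: is_idealD(1)[OF assms(1)])

definition cocycle :: "('v \<Rightarrow> 'a::comm_ring_1) \<Rightarrow> 'a set \<Rightarrow> nat \<Rightarrow> ('v list \<Rightarrow> 'a) \<Rightarrow> bool" where
  "cocycle y J i c \<longleftrightarrow> (\<forall>vs. length vs = Suc i \<longrightarrow> koszul y c vs \<in> J)"

definition coboundary :: "('v \<Rightarrow> 'a::comm_ring_1) \<Rightarrow> 'a set \<Rightarrow> nat \<Rightarrow> ('v list \<Rightarrow> 'a) \<Rightarrow> bool" where
  "coboundary y J i c \<longleftrightarrow> (\<exists>b. \<forall>vs. length vs = i \<longrightarrow> c vs - koszul y b vs \<in> J)"

definition koszul_vanishes_below :: "('v \<Rightarrow> 'a::comm_ring_1) \<Rightarrow> 'a set \<Rightarrow> nat \<Rightarrow> bool" where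
  "koszul_vanishes_below y J r \<longleftrightarrow> (\<forall>i<r. \<forall>c. cocycle y J i c \<longrightarrow> coboundary y J i c)"

text \<open>Contraction with \<open>u\<close> is a homotopy between multiplication by \<open>y\<^sub>u\<close> and zero.\<close>

lemma coboundary_scale:
  assumes J: "is_ideal J" and c: "cocycle y J i c" and f: "f \<in> M"
    and M: "\<And>K. is_ideal K \<Longrightarrow> J \<subseteq> K \<Longrightarrow> (\<And>u. y u \<in> K) \<Longrightarrow> M \<subseteq> K"
  shows "coboundary y J i (\<lambda>vs. f * c vs)"
proof -
  let ?K = "{f. coboundary y J i (\<lambda>vs. f * c vs)}"
  have "is_ideal ?K"
    unfolding is_ideal_def
  proof (intro conjI ballI allI)
    have "koszul y (\<lambda>_. 0) vs = 0" for vs using koszul_scale[of y 0 "\<lambda>_. 0" vs] by simp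
    then show "0 \<in> ?K"
      using is_idealD(1)[OF J] by (auto simp: coboundary_def intro!: exI[of _ "\<lambda>_. 0"])
    fix a b assume "a \<in> ?K"
    then obtain e where e: "\<And>vs. length vs = i \<Longrightarrow> a * c vs - koszul y e vs \<in> J"
      by (auto simp: coboundary_def)
    have "b * a * c vs - koszul y (\<lambda>ws. b * e ws) vs \<in> J" if "length vs = i" for vs
      using is_idealD(3)[OF J e[OF that], of b] by (simp add: koszul_scale algebra_simps)
    then show "b * a \<in> ?K" by (auto simp: coboundary_def)
    assume "b \<in> ?K"
    then obtain g where g: "\<And>vs. length vs = i \<Longrightarrow> b * c vs - koszul y g vs \<in> J"
      by (auto simp: coboundary_def)
    have "(a + b) * c vs - koszul y (\<lambda>ws. e ws + g ws) vs \<in> J" if "length vs = i" for vs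
      using is_idealD(2)[OF J e[OF that] g[OF that]] by (simp add: koszul_add algebra_simps)
    then show "a + b \<in> ?K" by (auto simp: coboundary_def)
  qed
  moreover have "J \<subseteq> ?K"
  proof
    fix a assume a: "a \<in> J"
    have "koszul y (\<lambda>_. 0) vs = 0" for vs using koszul_scale[of y 0 "\<lambda>_. 0" vs] by simp
    then show "a \<in> ?K"
      using is_idealD(4)[OF J a] by (auto simp: coboundary_def intro!: exI[of _ "\<lambda>_. 0"])
  qed
  moreover have "y u \<in> ?K" for u
  proof -
    have "y u * c vs - koszul y (\<lambda>ws. c (u # ws)) vs \<in> J" if "length vs = i" for vs
      using c that by (simp add: cocycle_def flip: koszul.simps(2))
    then show ?thesis by (auto simp: coboundary_def)
  qed
  ultimately show ?thesis using M[of ?K] f by blast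
qed

text \<open>The long exact sequence for multiplication by \<open>f\<close>, done by hand. Since
  \<open>f\<close> annihilates cohomology, \<open>f * c\<close> is the coboundary of some
  \<open>b\<close> modulo \<open>J\<close>. Then \<open>b\<close> is a cocycle modulo
  \<open>adjoin J f\<close>, hence a coboundary there up to a multiple \<open>f * g\<close>, and
  cancelling \<open>f\<close> shows that \<open>c\<close> is the coboundary of
  \<open>g\<close>.\<close>

lemma koszul_vanishes_of_weakly_regular:
  fixes y :: "'v \<Rightarrow> 'a::comm_ring_1"
  assumes "is_ideal J" "weakly_regular J fs" "set fs \<subseteq> M"
    and "\<And>K. is_ideal K \<Longrightarrow> J \<subseteq> K \<Longrightarrow> (\<And>u. y u \<in> K) \<Longrightarrow> M \<subseteq> K"
  shows "koszul_vanishes_below y J (length fs)"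
  using assms
proof (induction fs arbitrary: J)
  case (Cons f fs)
  note J = is_idealD[OF Cons.prems(1)]
  have reg: "f * a \<in> J \<Longrightarrow> a \<in> J" for a using Cons.prems(2) by simp
  have IH: "koszul_vanishes_below y (adjoin J f) (length fs)"
  proof (rule Cons.IH)
    fix K assume "is_ideal K" "adjoin J f \<subseteq> K" "\<And>u. y u \<in> K"
    then show "M \<subseteq> K" using Cons.prems(4)[of K] adjoin_superset[of J f] by blast
  qed (use Cons.prems in simp_all)
  show ?case
    unfolding koszul_vanishes_below_def
  proof (intro allI impI)
    fix i c assume i: "i < length (f # fs)" and c: "cocycle y J i c"
    have "coboundary y J i (\<lambda>vs. f * c vs)"
    proof (rule coboundary_scale[OF Cons.prems(1) c])
      show "f \<in> M" using Cons.prems(3) by simp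
    qed (rule Cons.prems(4))
    then obtain b where b: "\<And>vs. length vs = i \<Longrightarrow> f * c vs - koszul y b vs \<in> J"
      unfolding coboundary_def by blast
    show "coboundary y J i c"
    proof (cases i)
      case 0
      have "f * c [] \<in> J" using b[of "[]"] 0 by simp
      then show ?thesis using reg 0 by (auto simp: coboundary_def)
    next
      case (Suc i')
      have "cocycle y (adjoin J f) i' b"
        unfolding cocycle_def mem_adjoin_iff
      proof (intro allI impI)
        fix vs :: "'v list" assume "length vs = Suc i'"
        then have "- (f * c vs - koszul y b vs) \<in> J" using b Suc J(5) by blast
        then show "\<exists>e. koszul y b vs - e * f \<in> J" by (intro exI[of _ "c vs"]) (simp add: mult.commute)
      qed
      then have "coboundary y (adjoin J f) i' b"
        using IH i Suc unfolding koszul_vanishes_below_def by simp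
      then obtain e where e: "\<And>vs. length vs = i' \<Longrightarrow> \<exists>g. b vs - koszul y e vs - g * f \<in> J"
        unfolding coboundary_def mem_adjoin_iff by blast
      then obtain g where g: "\<And>vs. length vs = i' \<Longrightarrow> b vs - koszul y e vs - g vs * f \<in> J" by metis
      have "c vs - koszul y g vs \<in> J" if l: "length vs = i" for vs
      proof (rule reg)
        have "koszul y (\<lambda>ws. b ws - koszul y e ws - f * g ws) vs \<in> J"
          using g l Suc by (intro koszul_in_ideal[OF Cons.prems(1)]) (simp add: mult.commute)
        then have "koszul y b vs - f * koszul y g vs \<in> J"
          by (simp add: koszul_diff koszul_koszul koszul_scale)
        then have "(f * c vs - koszul y b vs) + (koszul y b vs - f * koszul y g vs) \<in> J"
          using b[OF l] by (intro J(2))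
        then show "f * (c vs - koszul y g vs) \<in> J" by (simp add: right_diff_distrib)
      qed
      then show ?thesis unfolding coboundary_def by blast
    qed
  qed
qed (simp add: koszul_vanishes_below_def)

text \<open>The same exact sequence read in the other direction, at the cost of one degree: the
  coboundary of \<open>c\<close> is \<open>x * b\<close> with a cocycle \<open>b\<close>. Writing
  \<open>b\<close> as the coboundary of \<open>e\<close> makes \<open>c - x * e\<close> a cocycle
  modulo \<open>J\<close>.\<close>

lemma koszul_vanishes_adjoin:
  fixes y :: "'v \<Rightarrow> 'a::comm_ring_1"
  assumes J: "is_ideal J" and V: "koszul_vanishes_below y J (Suc r)"
    and reg: "\<And>a. x * a \<in> J \<Longrightarrow> a \<in> J"
  shows "koszul_vanishes_below y (adjoin J x) r"
  unfolding koszul_vanishes_below_def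
proof (intro allI impI)
  fix i c assume i: "i < r" and "cocycle y (adjoin J x) i c"
  then have "\<forall>vs. \<exists>b. length vs = Suc i \<longrightarrow> koszul y c vs - b * x \<in> J"
    unfolding cocycle_def mem_adjoin_iff by blast
  then obtain b where b: "\<And>vs. length vs = Suc i \<Longrightarrow> koszul y c vs - b vs * x \<in> J" by metis
  have b': "koszul y c vs - x * b vs \<in> J" if "length vs = Suc i" for vs
    using b[OF that] by (simp only: mult.commute)
  have "cocycle y J (Suc i) b"
    unfolding cocycle_def
  proof (intro allI impI, rule reg)
    fix vs :: "'v list" assume l: "length vs = Suc (Suc i)"
    have "koszul y (\<lambda>ws. koszul y c ws - x * b ws) vs \<in> J"
    proof (rule koszul_in_ideal[OF J])
      fix ws :: "'v list" assume "Suc (length ws) = length vs"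
      then show "koszul y c ws - x * b ws \<in> J" using l by (intro b') simp
    qed
    then have "- (x * koszul y b vs) \<in> J"
      by (simp add: koszul_diff koszul_koszul koszul_scale)
    then show "x * koszul y b vs \<in> J" using is_idealD(5)[OF J] by fastforce
  qed
  then have "coboundary y J (Suc i) b" using V i unfolding koszul_vanishes_below_def by simp
  then obtain e where e: "\<And>vs. length vs = Suc i \<Longrightarrow> b vs - koszul y e vs \<in> J"
    unfolding coboundary_def by blast
  have "cocycle y J i (\<lambda>vs. c vs - x * e vs)"
    unfolding cocycle_def
  proof (intro allI impI)
    fix vs :: "'v list" assume "length vs = Suc i"
    then have "(koszul y c vs - b vs * x) + x * (b vs - koszul y e vs) \<in> J"
      using is_idealD(2,3)[OF J] b e by blast
    then show "koszul y (\<lambda>vs. c vs - x * e vs) vs \<in> J"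
      by (simp add: koszul_diff koszul_scale algebra_simps)
  qed
  then have "coboundary y J i (\<lambda>vs. c vs - x * e vs)"
    using V i unfolding koszul_vanishes_below_def by simp
  then obtain g where g: "\<And>vs. length vs = i \<Longrightarrow> c vs - x * e vs - koszul y g vs \<in> J"
    unfolding coboundary_def by blast
  have "c vs - koszul y g vs \<in> adjoin J x" if "length vs = i" for vs
    unfolding mem_adjoin_iff using g[OF that]
    by (intro exI[of _ "e vs"]) (simp add: algebra_simps)
  then show "coboundary y (adjoin J x) i c" unfolding coboundary_def by blast
qed

section \<open>Disconnected links\<close>

definition link_subst :: "'v set \<Rightarrow> 'v set \<Rightarrow> 'v \<Rightarrow> ('v, 'k::comm_ring_1) mpoly" where
  "link_subst F G v = (if v \<in> G then 1 else if v \<in> F then var v else 0)"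

text \<open>The ideal of \<open>\<Delta>\<close> together with \<open>x\<^sub>v - 1\<close> for \<open>v \<in> G\<close>.\<close>

definition link_ideal :: "'v set set \<Rightarrow> 'v set \<Rightarrow> ('v, 'k::comm_ring_1) mpoly set" where
  "link_ideal \<Delta> G = {p. \<forall>F\<in>\<Delta>. G \<subseteq> F \<longrightarrow> subst (link_subst F G) p = 0}"

lemma is_ideal_link_ideal [simp]: "is_ideal (link_ideal \<Delta> G)"
  by (auto simp: is_ideal_def link_ideal_def)

lemma link_ideal_empty:
  assumes "simplicial_complex \<Delta>"
  shows "link_ideal \<Delta> {} = sr_ideal \<Delta>"
proof -
  have "link_subst F {} = (restr F :: 'a \<Rightarrow> ('a, 'b) mpoly)" for F
    by (auto simp: link_subst_def restr_def)
  then show ?thesis using sr_ideal_eq_kernels[OF assms] by (auto simp: link_ideal_def)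
qed

text \<open>On each face \<open>var v\<close> becomes \<open>var v\<close> or 0, never 1, so the
  factor \<open>var v - 1\<close> stays nonzero in a domain.\<close>

lemma link_ideal_regular:
  assumes "v \<notin> G" "(var v - 1) * p \<in> (link_ideal \<Delta> G :: ('v::linorder, 'k::field) mpoly set)"
  shows "p \<in> link_ideal \<Delta> G"
  unfolding link_ideal_def
proof (intro CollectI ballI impI)
  fix F assume F: "F \<in> \<Delta>" "G \<subseteq> F"
  have "(link_subst F G v - 1) * subst (link_subst F G) p = 0"
    using assms(2) F by (auto simp: link_ideal_def)
  moreover have "link_subst F G v \<noteq> (1 :: ('v, 'k) mpoly)"
    using assms(1) by (auto simp: link_subst_def)
  ultimately show "subst (link_subst F G) p = 0" by simp
qed

text \<open>Setting \<open>var v\<close> to 1 changes a polynomial by a multiple of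
  \<open>var v - 1\<close>, and modulo \<open>var v - 1\<close> the result \<open>?q\<close> agrees
  with \<open>var v * ?q\<close>.\<close>

lemma link_ideal_insert:
  assumes "v \<notin> G"
  shows "link_ideal \<Delta> (insert v G) = adjoin (link_ideal \<Delta> G) (var v - 1 :: ('v, 'k::comm_ring_1) mpoly)"
proof
  have comp: "subst (link_subst F (insert v G)) p = subst (var(v := 1)) (subst (link_subst F G) p)"
    if "v \<in> F" for F and p :: "('v, 'k) mpoly"
  proof -
    have "link_subst F (insert v G) = (\<lambda>w. subst (var(v := 1)) (link_subst F G w) :: ('v, 'k) mpoly)"
      using that by (auto simp: link_subst_def)
    then show ?thesis by (simp add: subst_subst)
  qed
  show "adjoin (link_ideal \<Delta> G) (var v - 1) \<subseteq> (link_ideal \<Delta> (insert v G) :: ('v, 'k) mpoly set)"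
  proof (rule adjoin_minimal)
    show "link_ideal \<Delta> G \<subseteq> (link_ideal \<Delta> (insert v G) :: ('v, 'k) mpoly set)"
      by (auto simp: link_ideal_def comp)
    show "var v - 1 \<in> (link_ideal \<Delta> (insert v G) :: ('v, 'k) mpoly set)"
      by (auto simp: link_ideal_def link_subst_def)
  qed simp
  show "link_ideal \<Delta> (insert v G) \<subseteq> adjoin (link_ideal \<Delta> G) (var v - 1 :: ('v, 'k) mpoly)"
  proof
    fix p :: "('v, 'k) mpoly" assume p: "p \<in> link_ideal \<Delta> (insert v G)"
    let ?J = "adjoin (link_ideal \<Delta> G) (var v - 1 :: ('v, 'k) mpoly)"
    have J: "is_ideal ?J" and self: "var v - 1 \<in> ?J" by (simp_all add: adjoin_self)
    let ?q = "subst (var(v := 1)) p"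
    have "subst var p - ?q \<in> ?J"
      by (rule subst_cong_ideal[OF J]) (use self is_idealD(1)[OF J] in auto)
    then have 1: "p - ?q \<in> ?J" by simp
    \<comment> \<open>The factor \<open>var v\<close> takes care of the faces without
      \<open>v\<close>, about which membership in \<open>link_ideal \<Delta> (insert v G)\<close>
      says nothing.\<close>
    have "var v * ?q \<in> link_ideal \<Delta> G"
      unfolding link_ideal_def
    proof (intro CollectI ballI impI)
      fix F assume F: "F \<in> \<Delta>" "G \<subseteq> F"
      show "subst (link_subst F G) (var v * ?q) = 0"
      proof (cases "v \<in> F")
        case True
        have "(\<lambda>w. subst (link_subst F G) ((var(v := 1)) w)) = (link_subst F (insert v G) :: 'v \<Rightarrow> ('v, 'k) mpoly)"
          by (auto simp: link_subst_def)
        then have "subst (link_subst F G) ?q = subst (link_subst F (insert v G)) p"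
          by (simp add: subst_subst)
        then show ?thesis using p True F by (simp add: link_ideal_def)
      qed (use assms in \<open>simp add: link_subst_def\<close>)
    qed
    then have "var v * ?q \<in> ?J" using adjoin_superset by blast
    moreover have "(var v - 1) * ?q \<in> ?J" using is_idealD(4)[OF J self] .
    ultimately have "var v * ?q - (var v - 1) * ?q \<in> ?J" by (rule is_idealD(6)[OF J])
    then have "?q \<in> ?J" by (simp add: algebra_simps)
    then show "p \<in> ?J" using is_ideal_cong[OF J 1] by blast
  qed
qed

lemma koszul_vanishes_link_ideal:
  fixes \<Delta> :: "'v::linorder set set" and y :: "'w \<Rightarrow> ('v, 'k::field) mpoly"
  assumes "simplicial_complex \<Delta>" "finite G" "koszul_vanishes_below y (sr_ideal \<Delta>) (card G + r)"
  shows "koszul_vanishes_below y (link_ideal \<Delta> G) r"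
  using assms(2,3)
proof (induction G arbitrary: r rule: finite_induct)
  case (insert v G)
  have "koszul_vanishes_below y (link_ideal \<Delta> G) (Suc r)"
    using insert.prems insert.hyps by (intro insert.IH) simp
  then show ?case
    unfolding link_ideal_insert[OF insert.hyps(2)]
    using link_ideal_regular[OF insert.hyps(2)] by (intro koszul_vanishes_adjoin) auto
qed (simp add: link_ideal_empty[OF assms(1)])

definition point_ideal :: "'v set \<Rightarrow> ('v, 'k::comm_ring_1) mpoly set" where
  "point_ideal G = {p. subst (\<lambda>v. if v \<in> G then 1 else 0 :: ('v, 'k) mpoly) p = 0}"

lemma point_ideal_minimal:
  fixes K :: "('v, 'k::comm_ring_1) mpoly set"
  assumes "is_ideal K" "\<And>u. var u - (if u \<in> G then 1 else 0) \<in> K"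
  shows "point_ideal G \<subseteq> K"
proof
  fix p :: "('v, 'k) mpoly" assume p: "p \<in> point_ideal G"
  have "subst var p - subst (\<lambda>v. if v \<in> G then 1 else 0) p \<in> K"
    by (rule subst_cong_ideal[OF assms])
  then show "p \<in> K" using p by (simp add: point_ideal_def)
qed

text \<open>The cochain \<open>c\<close> takes \<open>u\<close> to \<open>var u\<close> on the
  \<open>W\<close> side and to 0 elsewhere. It is a cocycle because products of variables from
  different sides vanish. A primitive \<open>b []\<close> would have the value 1 at the point when
  seen from \<open>w\<close> and 0 when seen from \<open>w'\<close>.\<close>

lemma not_koszul_vanishes_disconnected:
  fixes \<Delta> :: "'v::linorder set set" and G :: "'v set"
  defines "y \<equiv> \<lambda>u. var u - (if u \<in> G then 1 else 0 :: ('v, 'k::field) mpoly)"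
  assumes disj: "\<And>F a b. F \<in> \<Delta> \<Longrightarrow> G \<subseteq> F \<Longrightarrow> a \<in> F - G \<Longrightarrow> b \<in> F - G \<Longrightarrow> a \<in> W \<longleftrightarrow> b \<in> W"
    and w: "insert w G \<in> \<Delta>" "w \<notin> G" "w \<in> W" and w': "insert w' G \<in> \<Delta>" "w' \<notin> G" "w' \<notin> W"
  shows "\<not> koszul_vanishes_below y (link_ideal \<Delta> G) 2"
proof
  assume V: "koszul_vanishes_below y (link_ideal \<Delta> G) 2"
  let ?J = "link_ideal \<Delta> G :: ('v, 'k) mpoly set"
  define c where "c vs = (if hd vs \<in> W - G then var (hd vs) else 0 :: ('v, 'k) mpoly)" for vs
  have yG: "y u * a \<in> ?J" if "u \<in> G" for u a
    using that by (auto simp: link_ideal_def y_def link_subst_def)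
  have xx: "var u * var v \<in> ?J" if "u \<in> W - G" "v \<notin> W \<union> G" for u v
    using that disj by (auto simp: link_ideal_def link_subst_def)
  have "y u * c [v] - y v * c [u] \<in> ?J" for u v
  proof -
    consider "u \<in> G" "v \<in> G" | "u \<in> G" "v \<notin> G" | "u \<notin> G" "v \<in> G" | "u \<notin> G" "v \<notin> G" by blast
    then show ?thesis
    proof cases
      case 4
      then show ?thesis
        using xx[of u v] xx[of v u] is_idealD(1,5)[of ?J] by (auto simp: y_def c_def mult.commute)
    qed (use yG is_idealD(1,5)[of ?J] in \<open>auto simp: c_def\<close>)
  qed
  then have "cocycle y ?J 1 c"
    unfolding cocycle_def by (auto simp: length_Suc_conv)
  then have "coboundary y ?J 1 c" using V by (simp add: koszul_vanishes_below_def)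
  then obtain b where b: "c [u] - y u * b [] \<in> ?J" for u
    unfolding coboundary_def by (force simp: length_Suc_conv)
  let ?\<epsilon> = "subst (\<lambda>v. if v \<in> G then 1 else 0 :: ('v, 'k) mpoly)"
  \<comment> \<open>On the face \<open>insert u G\<close> the factor \<open>var u\<close> can be
    cancelled, since polynomials form a domain; only then is the point inserted, where
    \<open>var u\<close> is 0.\<close>
  have ev: "?\<epsilon> (b []) = e" if "insert u G \<in> \<Delta>" "u \<notin> G" "var u * (e - b []) \<in> ?J" "e = 0 \<or> e = 1" for u e
  proof -
    let ?F = "insert u G"
    have "subst (link_subst ?F G) (var u * (e - b [])) = 0"
      using that unfolding link_ideal_def by blast
    then have "subst (link_subst ?F G) (e - b []) = 0" using that(2) by (auto simp: link_subst_def)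
    then have "?\<epsilon> (subst (link_subst ?F G) (e - b [])) = 0" by (simp only: subst_0)
    moreover have "(\<lambda>v. ?\<epsilon> (link_subst ?F G v)) = (\<lambda>v. if v \<in> G then 1 else 0)"
      using that(2) by (auto simp: link_subst_def)
    ultimately have "?\<epsilon> (e - b []) = 0" by (simp only: subst_subst)
    then show ?thesis using that(4) by auto
  qed
  have "?\<epsilon> (b []) = 1"
    using b[of w] w by (intro ev[of w]) (auto simp: c_def y_def algebra_simps)
  moreover have "?\<epsilon> (b []) = 0"
    using b[of w'] w' by (intro ev[of w']) (auto simp: c_def y_def algebra_simps)
  ultimately show False by simp
qed

theorem regular_sequence_short_of_disconnected_link:
  fixes \<Delta> :: "'v::linorder set set"
  assumes "simplicial_complex \<Delta>" "finite G"
    and "\<And>F a b. F \<in> \<Delta> \<Longrightarrow> G \<subseteq> F \<Longrightarrow> a \<in> F - G \<Longrightarrow> b \<in> F - G \<Longrightarrow> a \<in> W \<longleftrightarrow> b \<in> W"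
    and "insert w G \<in> \<Delta>" "w \<notin> G" "w \<in> W" and "insert w' G \<in> \<Delta>" "w' \<notin> G" "w' \<notin> W"
    and fs: "weakly_regular (sr_ideal \<Delta>) fs" "set fs \<subseteq> (point_ideal G :: ('v, 'k::field) mpoly set)"
  shows "length fs \<le> card G + 1"
proof (rule ccontr)
  assume len: "\<not> ?thesis"
  let ?y = "\<lambda>u. var u - (if u \<in> G then 1 else 0 :: ('v, 'k) mpoly)"
  have "koszul_vanishes_below ?y (sr_ideal \<Delta>) (length fs)"
    using is_ideal_sr_ideal[OF assms(1)] fs point_ideal_minimal
    by (intro koszul_vanishes_of_weakly_regular[where M = "point_ideal G"]) blast+
  then have "koszul_vanishes_below ?y (sr_ideal \<Delta>) (card G + 2)"
    using len by (auto simp: koszul_vanishes_below_def)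
  then have "koszul_vanishes_below ?y (link_ideal \<Delta> G) 2"
    by (rule koszul_vanishes_link_ideal[OF assms(1,2)])
  then show False using not_koszul_vanishes_disconnected[of \<Delta> G W w w'] assms by blast
qed

section \<open>Coefficients with respect to one variable\<close>

definition var_coeff :: "'v \<Rightarrow> nat \<Rightarrow> ('v, 'k::comm_ring_1) mpoly \<Rightarrow> ('v, 'k) mpoly" where
  "var_coeff u i p = (\<Sum>m\<in>keys p. if lookup m u = i then single (m - single u i) (lookup p m) else 0)"

lemma var_coeff_superset:
  assumes "finite X" "keys p \<subseteq> X"
  shows "var_coeff u i p = (\<Sum>m\<in>X. if lookup m u = i then single (m - single u i) (lookup p m) else 0)"
  unfolding var_coeff_def using assms by (intro sum.mono_neutral_left) (auto simp: in_keys_iff)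

lemma var_coeff_add: "var_coeff u i (p + q) = var_coeff u i p + var_coeff u i q"
proof -
  let ?X = "keys p \<union> keys q"
  have X: "finite ?X" "keys (p + q) \<subseteq> ?X" "keys p \<subseteq> ?X" "keys q \<subseteq> ?X"
    using Poly_Mapping.keys_add[of p q] by auto
  show ?thesis
    unfolding var_coeff_superset[OF X(1,2)] var_coeff_superset[OF X(1,3)] var_coeff_superset[OF X(1,4)]
      sum.distrib[symmetric]
    by (intro sum.cong) (auto simp: lookup_add single_add)
qed

lemma var_coeff_0 [simp]: "var_coeff u i 0 = 0"
  by (simp add: var_coeff_def)

lemma var_coeff_single: "var_coeff u i (single m c) = (if lookup m u = i then single (m - single u i) c else 0)"
  by (simp add: var_coeff_def)

lemma var_coeff_sum: "var_coeff u i (sum f X) = (\<Sum>x\<in>X. var_coeff u i (f x))"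
  by (induction X rule: infinite_finite_induct) (simp_all add: var_coeff_add)

lemma var_coeff_mult_free:
  fixes p h :: "('v, 'k::comm_ring_1) mpoly"
  assumes "h \<in> poly_in B" "u \<notin> B"
  shows "var_coeff u i (p * h) = var_coeff u i p * h"
proof -
  have 1: "var_coeff u i (p * single n d) = var_coeff u i p * single n d" if n: "lookup n u = 0" for n d
  proof (induction p rule: poly_mapping_add_induct)
    case (single m c)
    have "m + n - single u i = (m - single u i) + n" if "lookup m u = i"
      using that n by (intro poly_mapping_eqI) (auto simp: lookup_add lookup_minus lookup_single when_def)
    then show ?case using n by (auto simp: mult_single var_coeff_single lookup_add)
  qed (simp add: var_coeff_add distrib_right)
  have "var_coeff u i (p * h) = (\<Sum>n\<in>keys h. var_coeff u i (p * single n (lookup h n)))"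
    by (subst poly_mapping_sum_single[of h, symmetric]) (simp only: sum_distrib_left var_coeff_sum)
  also have "\<dots> = (\<Sum>n\<in>keys h. var_coeff u i p * single n (lookup h n))"
  proof (rule sum.cong)
    fix n assume "n \<in> keys h"
    then have "u \<notin> keys n" using assms by (auto simp: poly_in_def)
    then show "var_coeff u i (p * single n (lookup h n)) = var_coeff u i p * single n (lookup h n)"
      by (intro 1) (simp add: in_keys_iff)
  qed simp
  also have "\<dots> = var_coeff u i p * h"
    unfolding sum_distrib_left[symmetric] by (simp add: poly_mapping_sum_single)
  finally show ?thesis .
qed

lemma var_power: "var u ^ j = (single (single u j) 1 :: ('v, 'k::comm_ring_1) mpoly)"
  by (induction j) (simp_all add: var_def mult_single single_add[symmetric])

lemma var_coeff_mult_power: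
  fixes p :: "('v, 'k::comm_ring_1) mpoly"
  shows "var_coeff u (i + j) (p * var u ^ j) = var_coeff u i p"
proof (induction p rule: poly_mapping_add_induct)
  case (single m c)
  have "m + single u j - single u (i + j) = m - single u i"
    by (intro poly_mapping_eqI) (auto simp: lookup_add lookup_minus lookup_single when_def)
  then show ?case by (auto simp: var_power mult_single var_coeff_single lookup_add)
qed (simp add: var_coeff_add distrib_right)

lemma var_coeff_expansion:
  fixes p :: "('v, 'k::comm_ring_1) mpoly"
  assumes "\<And>m. m \<in> keys p \<Longrightarrow> lookup m u \<le> N"
  shows "p = (\<Sum>i\<le>N. var_coeff u i p * var u ^ i)"
proof -
  have 1: "(\<Sum>i\<le>N. var_coeff u i (single m c) * var u ^ i) = single m c" if "lookup m u \<le> N" for m c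
  proof -
    have "(\<Sum>i\<le>N. var_coeff u i (single m c) * var u ^ i) =
        (\<Sum>i\<le>N. if i = lookup m u then single (m - single u i + single u i) c else 0)"
      by (intro sum.cong) (auto simp: var_coeff_single var_power mult_single)
    also have "\<dots> = single (m - single u (lookup m u) + single u (lookup m u)) c" using that by simp
    also have "m - single u (lookup m u) + single u (lookup m u) = m"
      by (intro poly_mapping_eqI) (auto simp: lookup_add lookup_minus lookup_single when_def)
    finally show ?thesis .
  qed
  have "(\<Sum>i\<le>N. var_coeff u i p * var u ^ i) =
      (\<Sum>i\<le>N. \<Sum>m\<in>keys p. var_coeff u i (single m (lookup p m)) * var u ^ i)"
    by (subst poly_mapping_sum_single[of p, symmetric]) (simp only: var_coeff_sum sum_distrib_right)
  also have "\<dots> = (\<Sum>m\<in>keys p. \<Sum>i\<le>N. var_coeff u i (single m (lookup p m)) * var u ^ i)"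
    by (rule sum.swap)
  also have "\<dots> = (\<Sum>m\<in>keys p. single m (lookup p m))"
    using assms by (intro sum.cong refl 1)
  finally show ?thesis by (simp add: poly_mapping_sum_single)
qed

lemma var_coeff_poly_in:
  assumes "p \<in> poly_in (insert u B)"
  shows "var_coeff u i p \<in> poly_in (B - {u})"
  unfolding var_coeff_def
proof (rule poly_in_sum)
  fix m assume m: "m \<in> keys p"
  have "keys (m - single u i) \<subseteq> B - {u}" if "lookup m u = i"
  proof
    fix v assume "v \<in> keys (m - single u i)"
    then have "lookup m v - lookup (single u i) v \<noteq> 0" by (simp add: in_keys_iff lookup_minus)
    then have "v \<noteq> u" "v \<in> keys m" using that by (auto simp: in_keys_iff)
    then show "v \<in> B - {u}" using assms m by (auto simp: poly_in_def)
  qed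
  then show "(if lookup m u = i then single (m - single u i) (lookup p m) else 0) \<in> poly_in (B - {u})"
    by (auto simp: poly_in_def)
qed

lemma var_coeff_top:
  fixes p :: "('v, 'k::comm_ring_1) mpoly"
  assumes "p \<noteq> 0"
  obtains d where "var_coeff u d p \<noteq> 0" "p = (\<Sum>i\<le>d. var_coeff u i p * var u ^ i)"
proof -
  define N where "N = Max (insert 0 ((\<lambda>m. lookup m u) ` keys p))"
  have N: "lookup m u \<le> N" if "m \<in> keys p" for m using that by (simp add: N_def)
  define d where "d = (GREATEST i. i \<le> N \<and> var_coeff u i p \<noteq> 0)"
  note ex = var_coeff_expansion[of p u N, OF N]
  have "\<exists>i. i \<le> N \<and> var_coeff u i p \<noteq> 0"
  proof (rule ccontr)
    assume "\<not> ?thesis"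
    then have "(\<Sum>i\<le>N. var_coeff u i p * var u ^ i) = 0" by (intro sum.neutral) auto
    then show False using ex assms by simp
  qed
  then have d: "d \<le> N \<and> var_coeff u d p \<noteq> 0"
    unfolding d_def by (rule GreatestI_ex_nat[where b = N]) simp
  have z: "var_coeff u i p = 0" if "i \<le> N" "d < i" for i
    using Greatest_le_nat[of "\<lambda>i. i \<le> N \<and> var_coeff u i p \<noteq> 0" i N] that by (auto simp: d_def)
  have "(\<Sum>i\<le>N. var_coeff u i p * var u ^ i) = (\<Sum>i\<le>d. var_coeff u i p * var u ^ i)"
    using d z by (intro sum.mono_neutral_right) auto
  then show thesis using that d ex by metis
qed

section \<open>Zariski's lemma\<close>

text \<open>The module generated by a list over \<open>D\<close>, taken modulo \<open>M\<close>. The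
  recursion exposes the head so that generators can be eliminated one at a time.\<close>

fun module_span :: "'a::comm_ring_1 set \<Rightarrow> 'a set \<Rightarrow> 'a list \<Rightarrow> 'a set" where
  "module_span D M [] = M"
| "module_span D M (e # es) = {d * e + z | d z. d \<in> D \<and> z \<in> module_span D M es}"

text \<open>The variables in \<open>B\<close> are algebraically independent modulo \<open>M\<close>,
  and each other variable of \<open>V\<close> satisfies an equation of degree \<open>deg u\<close>
  over them with leading coefficient \<open>c u\<close>. The aim is \<open>B = {}\<close>.\<close>

locale zariski =
  fixes M :: "('v::linorder, 'k::field) mpoly set" and V B :: "'v set"
    and c :: "'v \<Rightarrow> ('v, 'k) mpoly" and deg :: "'v \<Rightarrow> nat"
  assumes max: "is_maximal_ideal M" and V: "finite V" and BV: "B \<subseteq> V"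
    and outside: "\<And>u. u \<notin> V \<Longrightarrow> var u \<in> M"
    and indep: "\<And>p. p \<in> poly_in B \<Longrightarrow> p \<in> M \<Longrightarrow> p = 0"
    and deg: "\<And>u. u \<in> V - B \<Longrightarrow> 0 < deg u"
    and c: "\<And>u. u \<in> V - B \<Longrightarrow> c u \<in> poly_in B \<and> c u \<noteq> 0"
    and rel: "\<And>u. u \<in> V - B \<Longrightarrow> \<exists>g. (\<forall>i. g i \<in> poly_in B) \<and>
      c u * var u ^ deg u - (\<Sum>i<deg u. g i * var u ^ i) \<in> M"
begin

abbreviation "D \<equiv> poly_in B :: ('v, 'k) mpoly set"

lemma M_ideal: "is_ideal M" and M_prime: "is_prime_ideal M"
  using max is_maximal_ideal_prime by (auto simp: is_maximal_ideal_def)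

text \<open>The common denominator: after inverting \<open>C\<close> the equations for the variables
  outside \<open>B\<close> become monic.\<close>

definition C :: "('v, 'k) mpoly" where
  "C = (\<Prod>u\<in>V - B. c u)"

lemma C_in: "C \<in> D" and C_nz: "C \<noteq> 0"
  unfolding C_def using c V by (auto intro: poly_in_prod)

text \<open>The monomials that are reduced with respect to these equations.\<close>

definition exps :: "('v \<Rightarrow>\<^sub>0 nat) set" where
  "exps = {m. keys m \<subseteq> V - B \<and> (\<forall>u\<in>V - B. lookup m u < deg u)}"

definition gens :: "('v, 'k) mpoly list" where
  "gens = (SOME l. set l = (\<lambda>m. single m 1) ` exps)"

lemma finite_exps: "finite exps"
proof (rule finite_imageD)
  let ?f = "\<lambda>m :: 'v \<Rightarrow>\<^sub>0 nat. restrict (lookup m) (V - B)"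
  have "?f ` exps \<subseteq> PiE (V - B) (\<lambda>u. {..<deg u})" by (auto simp: exps_def split: if_splits)
  then show "finite (?f ` exps)" by (rule finite_subset) (use V in \<open>simp add: finite_PiE\<close>)
  show "inj_on ?f exps"
  proof (rule inj_onI)
    fix m n assume m: "m \<in> exps" "n \<in> exps" "?f m = ?f n"
    show "m = n"
    proof (rule poly_mapping_eqI)
      fix v
      show "lookup m v = lookup n v"
      proof (cases "v \<in> V - B")
        case True
        then show ?thesis using fun_cong[OF m(3), of v] by simp
      next
        case False
        then have "v \<notin> keys m" "v \<notin> keys n" using m(1,2) unfolding exps_def by blast+
        then show ?thesis by (simp add: in_keys_iff)
      qed
    qed
  qed
qed

lemma set_gens: "set gens = (\<lambda>m. single m 1) ` exps"
  unfolding gens_def by (rule someI_ex) (rule finite_list, simp add: finite_exps)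

lemma span_add: "a \<in> module_span D M l \<Longrightarrow> b \<in> module_span D M l \<Longrightarrow> a + b \<in> module_span D M l"
proof (induction l arbitrary: a b)
  case (Cons e l)
  then obtain d z d' z' where a: "a = d * e + z" "d \<in> D" "z \<in> module_span D M l"
    and b: "b = d' * e + z'" "d' \<in> D" "z' \<in> module_span D M l" by auto
  have "a + b = (d + d') * e + (z + z')" by (simp add: a b algebra_simps)
  moreover have "d + d' \<in> D" "z + z' \<in> module_span D M l"
    using Cons.IH a b by (auto intro: poly_in_add)
  ultimately show ?case by auto
qed (simp add: is_idealD(2)[OF M_ideal])

lemma span_scale: "a \<in> module_span D M l \<Longrightarrow> f \<in> D \<Longrightarrow> f * a \<in> module_span D M l"
proof (induction l arbitrary: a)
  case (Cons e l)
  then obtain d z where a: "a = d * e + z" "d \<in> D" "z \<in> module_span D M l" by auto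
  have "f * a = (f * d) * e + f * z" by (simp add: a algebra_simps)
  moreover have "f * d \<in> D" "f * z \<in> module_span D M l"
    using Cons a by (auto intro: poly_in_mult)
  ultimately show ?case by auto
qed (simp add: is_idealD(3)[OF M_ideal])

lemma M_span: "a \<in> M \<Longrightarrow> a \<in> module_span D M l"
proof (induction l)
  case (Cons e l)
  then have "a = 0 * e + a" "0 \<in> D" "a \<in> module_span D M l" by auto
  then show ?case unfolding module_span.simps by blast
qed simp

lemma span_gen: "e \<in> set l \<Longrightarrow> e \<in> module_span D M l"
proof (induction l)
  case (Cons a l)
  show ?case
  proof (cases "e = a")
    case True
    have "1 \<in> D" "0 \<in> module_span D M l" using M_span is_idealD(1)[OF M_ideal] by auto
    moreover have "e = 1 * a + 0" using True by simp
    ultimately show ?thesis unfolding module_span.simps by blast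
  next
    case False
    then have "e = 0 * a + e" "0 \<in> D" "e \<in> module_span D M l" using Cons by auto
    then show ?thesis unfolding module_span.simps by blast
  qed
qed simp

lemma span_sum: "(\<And>x. x \<in> X \<Longrightarrow> f x \<in> module_span D M l) \<Longrightarrow> sum f X \<in> module_span D M l"
  by (induction X rule: infinite_finite_induct) (auto intro: span_add M_span is_idealD(1)[OF M_ideal])

abbreviation "N \<equiv> module_span D M gens"

lemma span_rule:
  assumes "z \<in> module_span D M l" "\<And>e. e \<in> set l \<Longrightarrow> P e" "\<And>z. z \<in> M \<Longrightarrow> P z"
    "\<And>d z. d \<in> D \<Longrightarrow> P z \<Longrightarrow> P (d * z)" "\<And>z w. P z \<Longrightarrow> P w \<Longrightarrow> P (z + w)"
  shows "P z"
  using assms(1,2)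
proof (induction l arbitrary: z)
  case (Cons e l)
  then obtain d w where "z = d * e + w" "d \<in> D" "w \<in> module_span D M l" by auto
  then show ?case using Cons assms(4,5) by auto
qed (use assms(3) in simp)

text \<open>What the reduced monomials span once \<open>C\<close> is inverted. That \<open>T\<close>
  is everything (\<open>T_UNIV\<close>) says that the field modulo \<open>M\<close> is finitely
  generated as a module over \<open>D\<close> with \<open>C\<close> inverted.\<close>

definition T :: "('v, 'k) mpoly set" where
  "T = {z. \<exists>s. C ^ s * z \<in> N}"

lemma T_N: "z \<in> N \<Longrightarrow> z \<in> T"
  unfolding T_def by (auto intro!: exI[of _ 0])

lemma T_add: assumes "z \<in> T" "w \<in> T" shows "z + w \<in> T"
proof -
  obtain s t where s: "C ^ s * z \<in> N" "C ^ t * w \<in> N" using assms unfolding T_def by blast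
  have "C ^ t * (C ^ s * z) + C ^ s * (C ^ t * w) \<in> N"
    using span_add[OF span_scale[OF s(1) poly_in_power[OF C_in]] span_scale[OF s(2) poly_in_power[OF C_in]]] .
  also have "C ^ t * (C ^ s * z) + C ^ s * (C ^ t * w) = C ^ (s + t) * (z + w)"
    by (simp add: power_add algebra_simps)
  finally show ?thesis unfolding T_def by blast
qed

lemma T_scale: assumes "z \<in> T" "f \<in> D" shows "f * z \<in> T"
proof -
  obtain s where "C ^ s * z \<in> N" using assms unfolding T_def by blast
  then have "f * (C ^ s * z) \<in> N" using assms(2) by (rule span_scale)
  then show ?thesis unfolding T_def by (auto simp: mult.left_commute intro!: exI[of _ s])
qed

lemma T_cancel: assumes "C ^ s * z \<in> T" shows "z \<in> T"
proof -
  obtain t where "C ^ t * (C ^ s * z) \<in> N" using assms unfolding T_def by blast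
  then have "C ^ (t + s) * z \<in> N" by (simp add: power_add mult.assoc)
  then show ?thesis unfolding T_def by blast
qed

text \<open>Either the product is again reduced, or its exponent at \<open>u\<close> reaches
  \<open>deg u\<close> and the equation for \<open>u\<close> rewrites it by lower powers; the factor
  \<open>c u\<close> this costs is part of \<open>C\<close>.\<close>

lemma T_var_gen:
  assumes u: "u \<in> V - B" and m: "m \<in> exps"
  shows "var u * single m 1 \<in> T"
proof (cases "lookup m u + 1 < deg u")
  case True
  then have "single u 1 + m \<in> exps"
    using u m by (auto simp: exps_def keys_exponent_add lookup_add lookup_single when_def)
  then have "single (single u 1 + m) 1 \<in> N" by (intro span_gen) (auto simp: set_gens)
  then show ?thesis by (intro T_N) (simp add: var_def mult_single)
next
  case False
  have "lookup m u < deg u" using u m unfolding exps_def by blast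
  with False have du: "deg u = lookup m u + 1" by simp
  define m' where "m' = m - single u (lookup m u)"
  have km': "keys m' \<subseteq> keys m" by (auto simp: m'_def in_keys_iff lookup_minus)
  have e: "single u (deg u) + m' = single u 1 + m"
    by (intro poly_mapping_eqI) (auto simp: m'_def du lookup_add lookup_minus lookup_single when_def)
  have "var u * single m 1 = (single (single u 1 + m) 1 :: ('v, 'k) mpoly)"
    by (simp add: var_def mult_single)
  moreover have "var u ^ deg u * single m' 1 = (single (single u (deg u) + m') 1 :: ('v, 'k) mpoly)"
    by (simp add: var_power mult_single)
  ultimately have eq: "var u * single m 1 = (var u ^ deg u * single m' 1 :: ('v, 'k) mpoly)"
    by (simp only: e)
  obtain g where g: "\<And>i. g i \<in> D" "c u * var u ^ deg u - (\<Sum>i<deg u. g i * var u ^ i) \<in> M"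
    using rel[OF u] by blast
  have "(\<Sum>i<deg u. g i * (var u ^ i * single m' 1)) \<in> N"
  proof (rule span_sum, rule span_scale[OF span_gen g(1)])
    fix i assume i: "i \<in> {..<deg u}"
    have "keys (single u i + m') \<subseteq> V - B"
      using u m km' unfolding exps_def keys_exponent_add by (auto split: if_splits)
    moreover have "lookup (single u i + m') w < deg w" if "w \<in> V - B" for w
      using m i that by (auto simp: exps_def m'_def lookup_add lookup_minus lookup_single when_def)
    ultimately have "single u i + m' \<in> exps" by (simp add: exps_def)
    then show "var u ^ i * single m' 1 \<in> set gens"
      by (auto simp: set_gens var_power mult_single)
  qed
  moreover have "(c u * var u ^ deg u - (\<Sum>i<deg u. g i * var u ^ i)) * single m' 1 \<in> N"
    using g(2) by (intro M_span is_idealD(4)[OF M_ideal])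
  ultimately have "(\<Sum>i<deg u. g i * (var u ^ i * single m' 1)) +
      (c u * var u ^ deg u - (\<Sum>i<deg u. g i * var u ^ i)) * single m' 1 \<in> N" by (rule span_add)
  then have "c u * (var u * single m 1) \<in> N"
    unfolding eq by (simp add: algebra_simps sum_distrib_left sum_distrib_right)
  then have "(\<Prod>w\<in>V - B - {u}. c w) * (c u * (var u * single m 1)) \<in> N"
    by (rule span_scale) (use c in \<open>auto intro!: poly_in_prod\<close>)
  also have "(\<Prod>w\<in>V - B - {u}. c w) * (c u * (var u * single m 1)) = C ^ 1 * (var u * single m 1)"
    unfolding C_def using V u by (subst prod.remove[of "V - B" u]) (auto simp: algebra_simps)
  finally show ?thesis unfolding T_def by blast
qed

lemma T_var: assumes "z \<in> T" shows "var u * z \<in> T"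
proof -
  obtain s where s: "C ^ s * z \<in> N" using assms unfolding T_def by blast
  have "var u * w \<in> T" if "w \<in> N" for w
    using that
  proof (rule span_rule)
    fix e assume "e \<in> set gens"
    then obtain m where m: "e = single m 1" "m \<in> exps" by (auto simp: set_gens)
    consider "u \<in> B" | "u \<notin> V" | "u \<in> V - B" by blast
    then show "var u * e \<in> T"
    proof cases
      case 1
      then show ?thesis using span_gen[OF \<open>e \<in> set gens\<close>] by (intro T_N span_scale) simp_all
    next
      case 2
      then show ?thesis using is_idealD(4)[OF M_ideal outside] by (intro T_N M_span)
    next
      case 3
      then show ?thesis using T_var_gen m by simp
    qed
  next
    fix w assume "w \<in> M"
    then show "var u * w \<in> T" using is_idealD(3)[OF M_ideal] by (intro T_N M_span)
  next
    fix d w assume "d \<in> D" "var u * w \<in> T"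
    then show "var u * (d * w) \<in> T" using T_scale by (simp add: mult.left_commute)
  next
    fix w w' assume "var u * w \<in> T" "var u * w' \<in> T"
    then show "var u * (w + w') \<in> T" using T_add by (simp add: distrib_left)
  qed
  then have "C ^ s * (var u * z) \<in> T" using s by (simp add: mult.left_commute)
  then show ?thesis by (rule T_cancel)
qed

lemma one_in_N: "1 \<in> N"
proof (rule span_gen)
  have "0 \<in> exps" using deg by (auto simp: exps_def)
  then show "1 \<in> set gens" unfolding set_gens by (metis imageI single_one)
qed

lemma T_UNIV: "z \<in> T"
proof (induction z rule: mpoly_induct)
  case (cst a)
  show ?case using span_scale[OF one_in_N poly_in_cst[of a]] by (intro T_N) simp
qed (auto intro: T_var T_add)

text \<open>Nakayama's elimination of generators: \<open>p\<close> is invertible modulo \<open>M\<close>, so \<open>p\<close> acts surjectively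
  on the finitely generated module \<open>A/M\<close> over \<open>D[1/C]\<close>.\<close>

lemma nakayama:
  assumes p: "p \<in> D" "p \<noteq> 0" and "set l \<subseteq> set gens"
    and "a \<in> D" "w \<in> D" "a = C ^ s + p * w" "\<And>z. z \<in> N \<Longrightarrow> a * z \<in> module_span D M l"
  shows "\<exists>s w. w \<in> D \<and> C ^ s + p * w = 0"
  using assms(3-)
proof (induction l arbitrary: a w s)
  case Nil
  have "a \<in> M" using Nil(5)[OF one_in_N] by simp
  then have "a = 0" using indep Nil by blast
  then show ?case using Nil by metis
next
  case (Cons e l)
  have "p \<notin> M" using indep p by blast
  then obtain q where q: "1 - p * q \<in> M" using max by (auto simp: is_maximal_ideal_def)
  have eN: "e \<in> N" using Cons.prems(1) by (intro span_gen) simp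
  obtain t where "C ^ t * (q * e) \<in> N" using T_UNIV[of "q * e"] unfolding T_def by blast
  then obtain d z where d: "a * (C ^ t * (q * e)) = d * e + z" "d \<in> D" "z \<in> module_span D M l"
    using Cons.prems(5)[of "C ^ t * (q * e)"] by auto
  \<comment> \<open>Multiplying the relation for \<open>q * e\<close> by \<open>p\<close>, with
    \<open>p * q\<close> congruent to 1, shows that \<open>a' * e\<close> lies in the span without
    \<open>e\<close>. Modulo \<open>p\<close>, \<open>a'\<close> is still a power of
    \<open>C\<close>.\<close>
  define a' where "a' = a * C ^ t - p * d"
  have a'D: "a' \<in> D"
    unfolding a'_def using Cons.prems p d C_in by (intro poly_in_diff poly_in_mult poly_in_power)
  have "a' * e = p * z + (1 - p * q) * (a * C ^ t * e)"
  proof -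
    have "p * (a * (C ^ t * (q * e))) = p * (d * e + z)" using d(1) by simp
    then show ?thesis by (simp add: a'_def algebra_simps)
  qed
  then have a'e: "a' * e \<in> module_span D M l"
    using span_add[OF span_scale[OF d(3) p(1)] M_span[OF is_idealD(4)[OF M_ideal q]]] by simp
  show ?case
  proof (rule Cons.IH[of "a' * a" "(w + w) * C ^ (s + t) + p * w * w * C ^ t - d * a" "s + s + t"])
    show "a' * a \<in> D" using a'D Cons.prems by (intro poly_in_mult)
    show "(w + w) * C ^ (s + t) + p * w * w * C ^ t - d * a \<in> D"
      using Cons.prems(2,3) p(1) d(2) C_in
      by (intro poly_in_diff poly_in_add poly_in_mult poly_in_power)
    show "a' * a = C ^ (s + s + t) + p * ((w + w) * C ^ (s + t) + p * w * w * C ^ t - d * a)"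
      unfolding a'_def Cons.prems(4) by (simp add: power_add algebra_simps)
    fix z' assume "z' \<in> N"
    then obtain d1 z1 where z1: "a * z' = d1 * e + z1" "d1 \<in> D" "z1 \<in> module_span D M l"
      using Cons.prems(5)[of z'] by auto
    have "a' * a * z' = a' * (a * z')" by (simp add: mult.assoc)
    also have "\<dots> = d1 * (a' * e) + a' * z1" by (simp add: z1(1) algebra_simps)
    finally show "a' * a * z' \<in> module_span D M l"
      using span_add[OF span_scale[OF a'e z1(2)] span_scale[OF z1(3) a'D]] by simp
  qed (use Cons.prems in auto)
qed

text \<open>For \<open>v\<close> in \<open>B\<close>, the elimination shows that
  \<open>1 + var v * C\<close> divides a power of \<open>C\<close>. Modulo this polynomial
  \<open>var v * C\<close> is -1, so the polynomial divides a power of -1 and is a unit, although it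
  is not constant.\<close>

lemma B_empty: "B = {}"
proof (rule ccontr)
  assume "B \<noteq> {}"
  then obtain v where v: "v \<in> B" by blast
  let ?p = "1 + var v * C"
  have pD: "?p \<in> D" using v C_in by (intro poly_in_add poly_in_mult) auto
  have p0: "?p \<noteq> 0"
  proof
    assume "?p = 0"
    then have "subst (\<lambda>_. 0 :: ('v, 'k) mpoly) ?p = subst (\<lambda>_. 0) (0 :: ('v, 'k) mpoly)"
      by (rule arg_cong)
    then show False by simp
  qed
  have "\<exists>s w. w \<in> D \<and> C ^ s + ?p * w = 0"
    by (rule nakayama[OF pD p0, of gens 1 0 0]) auto
  then obtain s w where w: "C ^ s + ?p * w = 0" by blast
  have xC: "\<exists>b. (var v * C) ^ s = (-1) ^ s + ?p * b"
  proof (induction s)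
    case (Suc s)
    then obtain b where "(var v * C) ^ s = (-1) ^ s + ?p * b" by blast
    then have "(var v * C) ^ Suc s = (?p - 1) * ((-1) ^ s + ?p * b)" by simp
    also have "\<dots> = (-1) ^ Suc s + ?p * ((-1) ^ s + (var v * C) * b)" by (simp add: algebra_simps)
    finally show ?case by blast
  qed (auto intro: exI[of _ 0])
  then obtain b where b: "(var v * C) ^ s = (-1) ^ s + ?p * b" by blast
  have "?p * (- ((-1) ^ s * (var v ^ s * w + b))) = (-1) ^ s * (var v ^ s * (- (?p * w)) - ?p * b)"
    by (simp add: algebra_simps)
  also have "- (?p * w) = C ^ s" using w by (simp add: add_eq_0_iff)
  also have "var v ^ s * C ^ s - ?p * b = (-1) ^ s" using b by (simp add: power_mult_distrib)
  also have "(-1) ^ s * (-1) ^ s = (1 :: ('v, 'k) mpoly)" by (simp flip: power_mult_distrib)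
  finally have unit: "?p * (- ((-1) ^ s * (var v ^ s * w + b))) = 1" .
  \<comment> \<open>A monomial of \<open>C\<close> multiplied by \<open>var v\<close> cannot cancel
    against 1, so \<open>?p\<close> has a nonconstant monomial.\<close>
  obtain m where m: "m \<in> keys C" using lead_monom_in_keys[OF C_nz] by blast
  have n: "single v 1 + m \<noteq> 0"
  proof
    assume "single v 1 + m = 0"
    then have "lookup (single v 1 + m) v = lookup 0 v" by (simp only:)
    then show False by (simp add: lookup_add)
  qed
  have "lookup ?p (single v 1 + m) = lookup C m"
    using n lookup_single_mult[of "single v 1" 1 C m] by (simp add: lookup_add lookup_one var_def)
  then have "single v 1 + m \<in> keys ?p" using m by (simp add: in_keys_iff)
  then show False using unit_keys[OF unit] n by blast
qed

end

text \<open>If no such \<open>q\<close> existed, \<open>{v}\<close> would be independent modulo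
  \<open>M\<close>. A maximal independent set above it meets the assumptions of the locale, and
  \<open>B_empty\<close> contradicts \<open>v\<close> being a member.\<close>

theorem zariski_lemma:
  fixes M :: "('v::linorder, 'k::field) mpoly set"
  assumes max: "is_maximal_ideal M" and V: "finite V" and outside: "\<And>u. u \<notin> V \<Longrightarrow> var u \<in> M"
  shows "\<exists>q. q \<in> poly_in {v} \<and> q \<noteq> 0 \<and> q \<in> M"
proof (cases "v \<in> V")
  case False
  then show ?thesis using outside by (intro exI[of _ "var v"]) simp
next
  case True
  show ?thesis
  proof (rule ccontr)
    assume none: "\<not> ?thesis"
    let ?A = "{B. B \<subseteq> V \<and> (\<forall>p\<in>poly_in B. p \<in> M \<longrightarrow> p = 0)}"
    have "finite ?A" by (rule finite_subset[of _ "Pow V"]) (use V in auto)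
    moreover have "{v} \<in> ?A" using True none by auto
    ultimately have "\<exists>B\<in>?A. {v} \<subseteq> B \<and> (\<forall>B'\<in>?A. B \<subseteq> B' \<longrightarrow> B = B')"
      by (rule finite_has_maximal2)
    then obtain B where B: "B \<in> ?A" "{v} \<subseteq> B" and Bmax: "\<forall>B'\<in>?A. B \<subseteq> B' \<longrightarrow> B = B'"
      by (elim bexE conjE)
    have I: "is_ideal M" using max by (simp add: is_maximal_ideal_def)
    define R where "R u a e \<longleftrightarrow> 0 < e \<and> a \<in> poly_in B \<and> a \<noteq> 0 \<and>
      (\<exists>g. (\<forall>i. g i \<in> poly_in B) \<and> a * var u ^ e - (\<Sum>i<e. g i * var u ^ i) \<in> M)" for u a e
    have ex: "\<exists>a e. R u a e" if u: "u \<in> V - B" for u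
    proof -
      \<comment> \<open>Maximality of \<open>B\<close> provides a relation \<open>h\<close>;
        expanding it in powers of \<open>var u\<close> yields leading coefficient and degree. The
        degree is positive because \<open>B\<close> itself is independent.\<close>
      have "insert u B \<notin> ?A" using Bmax[rule_format, of "insert u B"] u by auto
      then obtain h where h: "h \<in> poly_in (insert u B)" "h \<in> M" "h \<noteq> 0" using u B by auto
      obtain e where e: "var_coeff u e h \<noteq> 0" "h = (\<Sum>i\<le>e. var_coeff u i h * var u ^ i)"
        using var_coeff_top[OF h(3)] .
      have vB: "var_coeff u i h \<in> poly_in B" for i using var_coeff_poly_in[OF h(1), of i] u by simp
      have "e \<noteq> 0"
      proof
        assume "e = 0"
        then have "h \<in> poly_in B" using e(2) vB[of 0] by simp
        then show False using h B by blast
      qed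
      moreover have "var_coeff u e h * var u ^ e - (\<Sum>i<e. - var_coeff u i h * var u ^ i) \<in> M"
      proof -
        have "var_coeff u e h * var u ^ e - (\<Sum>i<e. - var_coeff u i h * var u ^ i) =
            (\<Sum>i\<le>e. var_coeff u i h * var u ^ i)"
          by (simp add: lessThan_Suc_atMost[symmetric] sum_negf)
        then show ?thesis using e(2) h(2) by simp
      qed
      ultimately have "R u (var_coeff u e h) e"
        unfolding R_def using e(1) vB poly_in_uminus[OF vB]
        by (intro conjI exI[of _ "\<lambda>i. - var_coeff u i h"]) auto
      then show ?thesis by blast
    qed
    define c where "c u = (SOME a. \<exists>e. R u a e)" for u
    define deg where "deg u = (SOME e. R u (c u) e)" for u
    have "\<exists>e. R u (c u) e" if "u \<in> V - B" for u
      unfolding c_def using ex[OF that] by (rule someI_ex)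
    then have "R u (c u) (deg u)" if "u \<in> V - B" for u
      unfolding deg_def using that by (metis someI_ex)
    note cd = this[unfolded R_def]
    interpret zariski M V B c deg
      by unfold_locales (use assms B cd in auto)
    show False using B_empty B(2) by blast
  qed
qed

section \<open>Permutably regular families and elementary symmetric polynomials\<close>

definition adjoin_set :: "'a::comm_ring_1 set \<Rightarrow> 'a set \<Rightarrow> 'a set" where
  "adjoin_set J X = \<Inter>{K. is_ideal K \<and> J \<subseteq> K \<and> X \<subseteq> K}"

lemma is_ideal_adjoin_set [simp]: "is_ideal (adjoin_set J X)"
  unfolding adjoin_set_def is_ideal_def by blast

lemma adjoin_set_superset: "J \<subseteq> adjoin_set J X" "X \<subseteq> adjoin_set J X"
  unfolding adjoin_set_def by blast+

lemma adjoin_set_minimal: "is_ideal K \<Longrightarrow> J \<subseteq> K \<Longrightarrow> X \<subseteq> K \<Longrightarrow> adjoin_set J X \<subseteq> K"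
  unfolding adjoin_set_def by blast

lemma adjoin_set_empty: "is_ideal J \<Longrightarrow> adjoin_set J {} = J"
  using adjoin_set_minimal[of J J "{}"] adjoin_set_superset(1)[of J "{}"] by blast

lemma adjoin_set_adjoin:
  assumes "is_ideal J"
  shows "adjoin_set (adjoin J x) X = adjoin_set J (insert x X)"
proof
  show "adjoin_set (adjoin J x) X \<subseteq> adjoin_set J (insert x X)"
    using adjoin_set_superset(1)[of J "insert x X"] adjoin_set_superset(2)[of "insert x X" J]
    by (intro adjoin_set_minimal adjoin_minimal) auto
  show "adjoin_set J (insert x X) \<subseteq> adjoin_set (adjoin J x) X"
    using adjoin_set_superset(1)[of "adjoin J x" X] adjoin_set_superset(2)[of X "adjoin J x"] adjoin_superset[of J x] adjoin_self[OF assms, of x]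
    by (intro adjoin_set_minimal) auto
qed

text \<open>Regularity in every order. Unlike regularity of a list it passes to
  \<open>adjoin J (g v)\<close> for any member \<open>v\<close>, so members can be split off
  arbitrarily.\<close>

definition permutably_regular :: "'a::comm_ring_1 set \<Rightarrow> ('v \<Rightarrow> 'a) \<Rightarrow> 'v set \<Rightarrow> bool" where
  "permutably_regular J g S \<longleftrightarrow> (\<forall>T v a. T \<subseteq> S \<longrightarrow> v \<in> S - T \<longrightarrow>
     g v * a \<in> adjoin_set J (g ` T) \<longrightarrow> a \<in> adjoin_set J (g ` T))"

lemma permutably_regularD:
  assumes "permutably_regular J g S" "is_ideal J" "v \<in> S" "g v * a \<in> J"
  shows "a \<in> J"
  using assms(1)[unfolded permutably_regular_def, rule_format, of "{}" v a] assms(3,4)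
  by (simp add: adjoin_set_empty[OF assms(2)])

lemma permutably_regular_adjoin:
  assumes "permutably_regular J g S" "is_ideal J" "v \<in> S"
  shows "permutably_regular (adjoin J (g v)) g (S - {v})"
  unfolding permutably_regular_def adjoin_set_adjoin[OF assms(2)]
proof (intro allI impI)
  fix T w a assume T: "T \<subseteq> S - {v}" "w \<in> S - {v} - T" "g w * a \<in> adjoin_set J (insert (g v) (g ` T))"
  then have "insert v T \<subseteq> S" "w \<in> S - insert v T" "g w * a \<in> adjoin_set J (g ` insert v T)"
    using assms(3) by auto
  then have "a \<in> adjoin_set J (g ` insert v T)"
    using assms(1) unfolding permutably_regular_def by blast
  then show "a \<in> adjoin_set J (insert (g v) (g ` T))" by simp
qed

definition elem_sym :: "'v set \<Rightarrow> ('v \<Rightarrow> 'a::comm_ring_1) \<Rightarrow> nat \<Rightarrow> 'a" where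
  "elem_sym V g i = (\<Sum>T | T \<subseteq> V \<and> card T = i. \<Prod>v\<in>T. g v)"

lemma prod_in_ideal:
  assumes "is_ideal J" "finite T" "v \<in> T" "g v \<in> J"
  shows "(\<Prod>v\<in>T. g v) \<in> J"
  using assms by (subst prod.remove[of T v]) (auto intro: is_idealD(4)[OF assms(1)])

text \<open>Any other set of the same size contains some \<open>v\<close> outside \<open>S\<close>,
  and its product lies in \<open>J\<close>.\<close>

lemma elem_sym_cong:
  assumes V: "finite V" "S \<subseteq> V" and J: "is_ideal J" "\<And>v. v \<in> V - S \<Longrightarrow> g v \<in> J"
  shows "elem_sym V g (card S) - (\<Prod>v\<in>S. g v) \<in> J"
proof -
  let ?X = "{T. T \<subseteq> V \<and> card T = card S}"
  have "finite ?X" by (rule finite_subset[of _ "Pow V"]) (use V in auto)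
  then have "elem_sym V g (card S) - (\<Prod>v\<in>S. g v) = (\<Sum>T\<in>?X - {S}. \<Prod>v\<in>T. g v)"
    unfolding elem_sym_def using V(2) by (subst sum.remove[of ?X S]) auto
  also have "\<dots> \<in> J"
  proof (rule is_ideal_sum[OF J(1)])
    fix T assume T: "T \<in> ?X - {S}"
    have fin: "finite S" "finite T" using T V finite_subset by blast+
    have "\<not> T \<subseteq> S" using T fin card_subset_eq[of S T] by auto
    then obtain v where "v \<in> T" "v \<in> V - S" using T by blast
    then show "(\<Prod>v\<in>T. g v) \<in> J" using prod_in_ideal[OF J(1) fin(2)] J(2) by blast
  qed
  finally show ?thesis .
qed

text \<open>Modulo \<open>J\<close> the top elementary symmetric polynomial is the product of the family, and
  \<open>A/(J + \<Prod>g)\<close> is an iterated extension of quotients of the \<open>A/(J + g\<^sub>v)\<close>.\<close>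

lemma elem_sym_weakly_regular:
  assumes "finite V" "is_ideal J" "permutably_regular J g S" "S \<subseteq> V" "\<And>v. v \<in> V - S \<Longrightarrow> g v \<in> J"
  shows "weakly_regular J (map (elem_sym V g) (rev [1..<Suc (card S)]))"
  using assms(2-)
proof (induction "card S" arbitrary: J S)
  case 0
  then show ?case by simp
next
  case (Suc r)
  \<comment> \<open>The symmetric polynomials are always formed over all of \<open>V\<close>, so
    every \<open>v\<close> yields regularity of this same list, as
    \<open>weakly_regular_extension\<close> requires.\<close>
  let ?fs = "map (elem_sym V g) (rev [1..<Suc r])"
  have finS: "finite S" using Suc.prems(3) assms(1) finite_subset by blast
  have step: "weakly_regular (adjoin J (g v)) ?fs" if v: "v \<in> S" for v
  proof -
    have "r = card (S - {v})" using Suc.hyps(2) v finS by simp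
    moreover have "weakly_regular (adjoin J (g v)) (map (elem_sym V g) (rev [1..<Suc (card (S - {v}))]))"
    proof (rule Suc.hyps(1))
      show "permutably_regular (adjoin J (g v)) g (S - {v})"
        using permutably_regular_adjoin[OF Suc.prems(2,1) v] .
      fix w assume "w \<in> V - (S - {v})"
      then show "g w \<in> adjoin J (g v)"
        using Suc.prems(4) adjoin_superset[of J "g v"] adjoin_self[OF Suc.prems(1), of "g v"] by blast
    qed (use Suc.prems \<open>r = card (S - {v})\<close> in auto)
    ultimately show ?thesis by simp
  qed
  have reg: "a \<in> J" if "g v * a \<in> J" "v \<in> S" for v a
    using permutably_regularD[OF Suc.prems(2,1) that(2,1)] .
  have prods: "weakly_regular (adjoin J (\<Prod>v\<in>T. g v)) ?fs \<and> (\<forall>a. (\<Prod>v\<in>T. g v) * a \<in> J \<longrightarrow> a \<in> J)"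
    if "T \<subseteq> S" for T
    using finite_subset[OF that finS] that
  proof (induction T rule: finite_induct)
    case empty
    have "adjoin J 1 = UNIV" using is_ideal_one[OF is_ideal_adjoin adjoin_self] Suc.prems(1) by blast
    then show ?case by (simp add: weakly_regular_UNIV)
  next
    case (insert v T)
    let ?p = "\<Prod>v\<in>T. g v"
    let ?K = "adjoin J (g v * ?p)"
    have K: "is_ideal ?K" using Suc.prems(1) by simp
    have "colon ?K (g v) = adjoin J ?p"
    proof
      show "adjoin J ?p \<subseteq> colon ?K (g v)"
      proof (rule adjoin_minimal)
        show "J \<subseteq> colon ?K (g v)"
          using adjoin_superset[of J "g v * ?p"] is_idealD(3)[OF Suc.prems(1)] unfolding colon_def by blast
        show "?p \<in> colon ?K (g v)"
          using adjoin_self[OF Suc.prems(1), of "g v * ?p"] by (simp add: colon_def)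
      qed (use K in simp)
      show "colon ?K (g v) \<subseteq> adjoin J ?p"
      proof
        fix a assume "a \<in> colon ?K (g v)"
        then obtain b where "g v * a - b * (g v * ?p) \<in> J" unfolding colon_def mem_adjoin_iff by blast
        then have "g v * (a - b * ?p) \<in> J" by (simp add: algebra_simps)
        then have "a - b * ?p \<in> J" using reg insert.prems by blast
        then show "a \<in> adjoin J ?p" unfolding mem_adjoin_iff by blast
      qed
    qed
    moreover have "adjoin ?K (g v) = adjoin J (g v)"
      using adjoin_absorb[OF is_ideal_adjoin[OF Suc.prems(1)], of "g v * ?p" "g v"]
        is_idealD(4)[OF is_ideal_adjoin[OF Suc.prems(1)] adjoin_self[OF Suc.prems(1)], of "g v" ?p]
        adjoin_commute[OF Suc.prems(1), of "g v * ?p" "g v"] by simp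
    ultimately have "weakly_regular ?K ?fs"
      using insert.IH insert.prems step[of v] by (intro weakly_regular_extension[OF K, of "g v"]) auto
    moreover have "a \<in> J" if "g v * ?p * a \<in> J" for a
    proof -
      have "?p * a \<in> J" using reg[of v "?p * a"] that insert.prems by (simp add: mult.assoc)
      then show ?thesis using insert.IH insert.prems by blast
    qed
    ultimately show ?case using insert.hyps by simp
  qed
  have "elem_sym V g (card S) - (\<Prod>v\<in>S. g v) \<in> J"
    by (rule elem_sym_cong[OF assms(1) Suc.prems(3,1)]) (rule Suc.prems(4))
  moreover have "\<forall>a. (\<Prod>v\<in>S. g v) * a \<in> J \<longrightarrow> a \<in> J" "weakly_regular (adjoin J (\<Prod>v\<in>S. g v)) ?fs"
    using prods[of S] by simp_all
  then have "weakly_regular J ((\<Prod>v\<in>S. g v) # ?fs)" unfolding weakly_regular.simps by blast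
  ultimately have "weakly_regular J (elem_sym V g (card S) # ?fs)"
    using weakly_regular_cong[OF Suc.prems(1)] by blast
  then show ?case by (simp flip: Suc.hyps(2))
qed

section \<open>One-variable polynomials are permutably regular\<close>

lemma var_coeff_0_mult_var: "var_coeff u 0 (p * var u) = 0"
proof (induction p rule: poly_mapping_add_induct)
  case (single m c)
  then show ?case by (simp add: var_def mult_single var_coeff_single lookup_add)
qed (simp add: var_coeff_add distrib_right)

lemma poly_in_empty: "p \<in> poly_in {} \<Longrightarrow> p = cst (lookup p 0)"
  by (intro poly_mapping_eqI) (auto simp: poly_in_def lookup_single when_def in_keys_iff)

text \<open>This reduces closure of a generated ideal under taking coefficients to a check on its
  generators.\<close>

lemma is_ideal_var_coeff:
  fixes K :: "('v, 'k::comm_ring_1) mpoly set"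
  assumes K: "is_ideal K"
  shows "is_ideal {p. \<forall>i. var_coeff v i p \<in> K}"
proof -
  have right: "\<forall>i. var_coeff v i (p * b) \<in> K" if "\<forall>i. var_coeff v i p \<in> K" for p b
    using that
  proof (induction b arbitrary: p rule: mpoly_induct)
    case (cst c)
    have "var_coeff v i (p * cst c) = var_coeff v i p * cst c" for i
      by (rule var_coeff_mult_free[of _ "{}"]) simp_all
    then show ?case using cst is_idealD(4)[OF K] by simp
  next
    case (var u b)
    have "var_coeff v i (p * var u) \<in> K" for i
    proof (cases "u = v")
      case True
      show ?thesis
      proof (cases i)
        case 0
        then show ?thesis using True is_idealD(1)[OF K] by (simp add: var_coeff_0_mult_var)
      next
        case (Suc j)
        then show ?thesis using var_coeff_mult_power[of v j 1 p] var.prems True by simp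
      qed
    next
      case False
      then have "var_coeff v i (p * var u) = var_coeff v i p * var u"
        by (intro var_coeff_mult_free[of _ "{u}"]) auto
      then show ?thesis using var.prems is_idealD(4)[OF K] by simp
    qed
    then have "\<forall>i. var_coeff v i (p * var u * b) \<in> K" by (intro var.IH) blast
    then show ?case by (simp add: mult.assoc)
  next
    case (add b b')
    then show ?case using is_idealD(2)[OF K] by (simp add: distrib_left var_coeff_add)
  qed
  have "\<forall>i. var_coeff v i (b * p) \<in> K" if "\<forall>i. var_coeff v i p \<in> K" for p b
    using right[OF that, of b] unfolding mult.commute[of p b] .
  then show ?thesis
    unfolding is_ideal_def using is_idealD(1,2)[OF K] by (simp add: var_coeff_add)
qed

text \<open>A polynomial in \<open>var v\<close> alone has a nonzero constant as its top
  coefficient. Comparing coefficients of \<open>a * g\<close> at the last one of \<open>a\<close>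
  outside \<open>K\<close> gives, modulo \<open>K\<close>, a nonzero scalar multiple of it.\<close>

lemma regular_of_var_coeff_closed:
  fixes K :: "('v, 'k::field) mpoly set"
  assumes K: "is_ideal K" and closed: "\<And>p i. p \<in> K \<Longrightarrow> var_coeff v i p \<in> K"
    and g: "g \<in> poly_in {v}" "g \<noteq> 0" and a: "g * a \<in> K"
  shows "a \<in> K"
proof (rule ccontr)
  assume na: "a \<notin> K"
  define N where "N = Max (insert 0 ((\<lambda>m. lookup m v) ` keys a))"
  have N: "lookup m v \<le> N" if "m \<in> keys a" for m using that by (simp add: N_def)
  have big: "var_coeff v i a = 0" if "N < i" for i
    unfolding var_coeff_def using N that by (intro sum.neutral) fastforce
  \<comment> \<open>All later coefficients of \<open>a\<close> are in \<open>K\<close>, so in degree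
    \<open>i + d\<close> of the product only the pairing of \<open>i\<close> with the top degree
    \<open>d\<close> of \<open>g\<close> survives.\<close>
  define i where "i = (GREATEST i. var_coeff v i a \<notin> K)"
  have bound: "i \<le> N" if "var_coeff v i a \<notin> K" for i
    using that big[of i] is_idealD(1)[OF K] by (cases "N < i") auto
  have "\<exists>i. var_coeff v i a \<notin> K"
  proof (rule ccontr)
    assume "\<not> ?thesis"
    then have "(\<Sum>i\<le>N. var_coeff v i a * var v ^ i) \<in> K"
      by (intro is_ideal_sum[OF K] is_idealD(4)[OF K]) blast
    then show False using var_coeff_expansion[of a v N] N na by simp
  qed
  then have i: "var_coeff v i a \<notin> K"
    unfolding i_def by (rule GreatestI_ex_nat[where b = N]) (rule bound)
  have above: "var_coeff v j a \<in> K" if "i < j" for j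
    using Greatest_le_nat[of "\<lambda>i. var_coeff v i a \<notin> K" j N] bound that unfolding i_def by fastforce
  obtain d where d: "var_coeff v d g \<noteq> 0" "g = (\<Sum>j\<le>d. var_coeff v j g * var v ^ j)"
    using var_coeff_top[OF g(2)] .
  have gc: "var_coeff v j g \<in> poly_in {}" for j using var_coeff_poly_in[of g v "{}" j] g(1) by simp
  have "var_coeff v (i + d) (a * g) = (\<Sum>j\<le>d. var_coeff v (i + d) (a * (var_coeff v j g * var v ^ j)))"
    by (subst (1) d(2)) (simp only: sum_distrib_left var_coeff_sum)
  also have "\<dots> = (\<Sum>j\<le>d. var_coeff v (i + d - j) a * var_coeff v j g)"
  proof (rule sum.cong)
    fix j assume "j \<in> {..d}"
    then have "var_coeff v (i + d) (a * var_coeff v j g * var v ^ j) = var_coeff v (i + d - j) (a * var_coeff v j g)"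
      using var_coeff_mult_power[of v "i + d - j" j "a * var_coeff v j g"] by simp
    also have "\<dots> = var_coeff v (i + d - j) a * var_coeff v j g"
      by (rule var_coeff_mult_free[OF gc]) simp
    finally show "var_coeff v (i + d) (a * (var_coeff v j g * var v ^ j)) = var_coeff v (i + d - j) a * var_coeff v j g"
      by (simp add: mult.assoc)
  qed simp
  also have "\<dots> = (\<Sum>j<d. var_coeff v (i + d - j) a * var_coeff v j g) + var_coeff v i a * var_coeff v d g"
    by (simp add: lessThan_Suc_atMost[symmetric])
  finally have "(\<Sum>j<d. var_coeff v (i + d - j) a * var_coeff v j g) + var_coeff v i a * var_coeff v d g \<in> K"
    using closed[of "a * g"] a by (metis mult.commute)
  moreover have "(\<Sum>j<d. var_coeff v (i + d - j) a * var_coeff v j g) \<in> K"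
    by (intro is_ideal_sum[OF K] is_idealD(4)[OF K] above) auto
  ultimately have "var_coeff v i a * var_coeff v d g \<in> K"
    using is_idealD(6)[OF K] by fastforce
  moreover obtain c where c: "var_coeff v d g = cst c" using poly_in_empty[OF gc[of d]] by blast
  moreover have "c \<noteq> 0" using d(1) c by auto
  ultimately have "var_coeff v i a * cst c * cst (inverse c) \<in> K" using is_idealD(4)[OF K] by simp
  then show False using i \<open>c \<noteq> 0\<close> by (simp add: mult.assoc mult_single)
qed

text \<open>The generators of the ideal are compatible with coefficients in \<open>var v\<close>:
  monomials off \<open>F\<close> stay off \<open>F\<close> because \<open>v\<close> is in
  \<open>F\<close>, and the other members of the family do not involve \<open>v\<close>.\<close>

lemma permutably_regular_variables:
  fixes g :: "'v \<Rightarrow> ('v, 'k::field) mpoly"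
  assumes F: "finite F" and g: "\<And>v. v \<in> F \<Longrightarrow> g v \<in> poly_in {v} \<and> g v \<noteq> 0"
  shows "permutably_regular (sr_ideal (Pow F)) g F"
  unfolding permutably_regular_def
proof (intro allI impI)
  fix T v a assume T: "T \<subseteq> F" "v \<in> F - T" "g v * a \<in> adjoin_set (sr_ideal (Pow F)) (g ` T)"
  let ?P = "sr_ideal (Pow F) :: ('v, 'k) mpoly set"
  let ?K = "adjoin_set ?P (g ` T)"
  let ?K' = "{p. \<forall>i. var_coeff v i p \<in> ?K}"
  have "?K \<subseteq> ?K'"
  proof (rule adjoin_set_minimal[OF is_ideal_var_coeff])
    show "is_ideal ?K" by simp
    show "?P \<subseteq> ?K'"
    proof (intro subsetI CollectI allI)
      fix p :: "('v, 'k) mpoly" and i assume p: "p \<in> ?P"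
      have "var_coeff v i p \<in> ?P"
        unfolding var_coeff_def
      proof (rule is_ideal_sum)
        show "is_ideal ?P" using F by (intro is_ideal_sr_ideal) (auto simp: simplicial_complex_def finite_subset)
        fix m assume m: "m \<in> keys p"
        have "\<not> keys m \<subseteq> F" using p m by (auto simp: sr_ideal_def)
        then obtain w where w: "w \<in> keys m" "w \<notin> F" by blast
        then have "w \<in> keys (m - single v i)"
          using T(2) by (auto simp: in_keys_iff lookup_minus lookup_single when_def)
        then show "(if lookup m v = i then single (m - single v i) (lookup p m) else 0) \<in> ?P"
          using w(2) by (auto simp: sr_ideal_def)
      qed
      then show "var_coeff v i p \<in> ?K" using adjoin_set_superset(1) by blast
    qed
    show "g ` T \<subseteq> ?K'"
    proof (intro subsetI CollectI allI, elim imageE)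
      fix p i u assume u: "p = g u" "u \<in> T"
      have "var_coeff v i (1 * g u) = var_coeff v i 1 * g u"
        using g[of u] u T by (intro var_coeff_mult_free[of _ "{u}"]) auto
      moreover have "g u \<in> ?K" using adjoin_set_superset(2) u(2) by blast
      ultimately show "var_coeff v i p \<in> ?K"
        using is_idealD(3)[OF is_ideal_adjoin_set] u(1) by simp
    qed
  qed
  then have "var_coeff v i p \<in> ?K" if "p \<in> ?K" for p i using that by blast
  moreover have "g v \<in> poly_in {v}" "g v \<noteq> 0" using g T(2) by blast+
  ultimately show "a \<in> ?K" using T(3) by (intro regular_of_var_coeff_closed[of ?K v "g v" a]) simp_all
qed

section \<open>Vertex decomposable complexes are Cohen-Macaulay\<close>

lemma facets_Pow: "facets (Pow F) = {F}"
  by (auto simp: facets_def)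

lemma vertex_decomposable_pure:
  assumes "vertex_decomposable \<Delta>"
  shows "pure_complex \<Delta>"
  using assms
proof (cases rule: vertex_decomposable.cases)
  case void
  then show ?thesis by (simp add: pure_complex_def simplicial_complex_def facets_def)
next
  case (simplex F)
  have "simplicial_complex (Pow F)"
    unfolding simplicial_complex_def using simplex(2) by (auto intro: finite_subset)
  then show ?thesis by (simp add: simplex(1) pure_complex_def facets_Pow)
next
  case (decompose x)
  then show ?thesis by simp
qed

lemma face_in_facet:
  assumes "finite \<Delta>" "H \<in> \<Delta>"
  obtains F where "F \<in> facets \<Delta>" "H \<subseteq> F"
proof -
  obtain F where F: "F \<in> \<Delta>" "H \<subseteq> F" "\<forall>E\<in>\<Delta>. F \<subseteq> E \<longrightarrow> F = E"
    using finite_has_maximal2[OF assms] by (elim bexE conjE)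
  then have "F \<in> facets \<Delta>" by (simp add: facets_def)
  then show thesis using that F(2) by simp
qed

text \<open>The set \<open>G\<close> collects cone apexes: \<open>{H. H - G \<in> \<Delta>}\<close>
  is the join of \<open>\<Delta>\<close> with the simplex on \<open>G\<close>. Passing to the link
  moves \<open>x\<close> into \<open>G\<close>, so the size \<open>r\<close> of the facets of the
  join, and with it the list, stays fixed throughout the induction.\<close>

theorem vertex_decomposable_weakly_regular:
  fixes g :: "'v \<Rightarrow> ('v, 'k::field) mpoly"
  assumes "vertex_decomposable \<Delta>" and V: "finite V"
    and g: "\<And>v. v \<in> V \<Longrightarrow> g v \<in> poly_in {v} \<and> g v \<noteq> 0 \<and> (\<exists>q. g v = var v * q)"
    and "\<Union>\<Delta> \<subseteq> V" "G \<subseteq> V" "\<And>H. H \<in> \<Delta> \<Longrightarrow> H \<inter> G = {}"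
    and "\<And>F. F \<in> facets \<Delta> \<Longrightarrow> card F + card G = r"
  shows "weakly_regular (sr_ideal {H. H - G \<in> \<Delta>}) (map (elem_sym V g) (rev [1..<Suc r]))"
  using assms(1,4-)
proof (induction arbitrary: G rule: vertex_decomposable.induct)
  case void
  have "sr_ideal {H. H - G \<in> {}} = (UNIV :: ('v, 'k) mpoly set)" by (auto simp: sr_ideal_def)
  then show ?case by (simp add: weakly_regular_UNIV)
next
  case (simplex F)
  let ?F = "F \<union> G"
  have fin: "finite G" using simplex.prems(2) V finite_subset by blast
  have "F \<inter> G = {}" using simplex.prems(3)[of F] by simp
  then have card: "card ?F = r"
    using simplex fin by (simp add: card_Un_disjoint facets_Pow)
  have "{H. H - G \<in> Pow F} = Pow ?F" by auto
  moreover have "weakly_regular (sr_ideal (Pow ?F)) (map (elem_sym V g) (rev [1..<Suc (card ?F)]))"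
  proof (rule elem_sym_weakly_regular[OF V])
    show FV: "?F \<subseteq> V" using simplex.prems by auto
    show "is_ideal (sr_ideal (Pow ?F) :: ('v, 'k) mpoly set)"
      using simplex.hyps fin
      by (intro is_ideal_sr_ideal) (auto simp: simplicial_complex_def intro: finite_subset[of _ ?F])
    show "permutably_regular (sr_ideal (Pow ?F)) g ?F"
      using simplex.hyps fin g FV by (intro permutably_regular_variables) auto
    fix v assume v: "v \<in> V - ?F"
    then obtain q where "g v = var v * q" using g by blast
    then show "g v \<in> sr_ideal (Pow ?F)" using v simplex.hyps fin by (simp add: sr_ideal_Pow restr_def)
  qed
  ultimately show ?case using card by simp
next
  case (decompose \<Delta> x)
  let ?fs = "map (elem_sym V g) (rev [1..<Suc r])"
  have sc: "simplicial_complex \<Delta>" using decompose.hyps(1) by (simp add: pure_complex_def)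
  have finG: "finite G" using decompose.prems(2) V finite_subset by blast
  have xG: "x \<notin> G" using decompose.prems(3)[OF decompose.hyps(2)] by blast
  have sub: "H' \<in> \<Delta>" if "H \<in> \<Delta>" "H' \<subseteq> H" for H H'
    using sc that unfolding simplicial_complex_def by blast
  have fin\<Delta>: "finite \<Delta>"
    using decompose.prems(1) V by (intro finite_subset[of \<Delta> "Pow V"]) auto
  let ?D = "{H. H - G \<in> \<Delta>}"
  have scD: "simplicial_complex ?D"
    unfolding simplicial_complex_def
  proof (intro ballI conjI allI impI)
    fix H assume H: "H \<in> ?D"
    then have "finite (H - G)" using sc by (auto simp: simplicial_complex_def)
    then show "finite H" using finG by simp
    fix H' assume "H' \<subseteq> H"
    then show "H' \<in> ?D" using H sub[of "H - G" "H' - G"] by blast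
  qed
  have link_eq: "{H. H - insert x G \<in> link \<Delta> x} = {H. insert x H \<in> ?D}"
  proof -
    have "H - insert x G \<in> link \<Delta> x \<longleftrightarrow> insert x H - G \<in> \<Delta>" for H
    proof -
      have "(H - insert x G) \<union> {x} = insert x H - G" using xG by blast
      then show ?thesis using sub[of "insert x H - G" "H - insert x G"] by (auto simp: link_def)
    qed
    then show ?thesis by simp
  qed
  have link_facet: "insert x L \<in> facets \<Delta>" if L: "L \<in> facets (link \<Delta> x)" for L
    unfolding facets_def
  proof (intro CollectI conjI ballI impI)
    have L': "L \<in> \<Delta>" "x \<notin> L" "insert x L \<in> \<Delta>" using L by (auto simp: facets_def link_def)
    show "insert x L \<in> \<Delta>" using L' by blast
    fix H assume H: "H \<in> \<Delta>" "insert x L \<subseteq> H"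
    have "H - {x} \<in> link \<Delta> x"
      using H sub[of H "H - {x}"] by (auto simp: link_def insert_absorb)
    moreover have "L \<subseteq> H - {x}" using H(2) L'(2) by auto
    moreover have "\<forall>K\<in>link \<Delta> x. L \<subseteq> K \<longrightarrow> L = K" using L by (simp add: facets_def)
    ultimately have "L = H - {x}" by simp
    then show "insert x L = H" using H(2) by auto
  qed
  have lk: "weakly_regular (sr_ideal {H. insert x H \<in> ?D}) ?fs"
    unfolding link_eq[symmetric]
  proof (rule decompose.IH(1))
    show "\<Union> (link \<Delta> x) \<subseteq> V" using decompose.prems(1) by (auto simp: link_def)
    show "insert x G \<subseteq> V" using decompose.prems(1,2) decompose.hyps(2) by auto
    show "H \<inter> insert x G = {}" if "H \<in> link \<Delta> x" for H
      using that decompose.prems(3)[of H] by (auto simp: link_def)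
    fix L assume L: "L \<in> facets (link \<Delta> x)"
    have "x \<notin> L" "finite L" using L sc by (auto simp: facets_def link_def simplicial_complex_def)
    then show "card L + card (insert x G) = r"
      using decompose.prems(4)[OF link_facet[OF L]] xG finG by simp
  qed
  show ?case
  proof (cases "\<exists>F0\<in>facets \<Delta>. x \<notin> F0")
    \<comment> \<open>Every facet contains \<open>x\<close>, so the complex is a cone and equals the
      star of \<open>x\<close>; its deletion has smaller facets and is left aside.\<close>
    case False
    have "insert x H \<in> ?D" if "H \<in> ?D" for H
    proof -
      obtain F where F: "F \<in> facets \<Delta>" "H - G \<subseteq> F"
        using face_in_facet[OF fin\<Delta>, of "H - G"] \<open>H \<in> ?D\<close> by blast
      then have "insert x H - G \<subseteq> F" "F \<in> \<Delta>" using False by (auto simp: facets_def)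
      then show ?thesis using sub by blast
    qed
    moreover have "H \<in> ?D" if "insert x H \<in> ?D" for H
      using that scD unfolding simplicial_complex_def by (metis subset_insertI)
    ultimately have "{H. insert x H \<in> ?D} = ?D" by blast
    then show ?thesis using lk by simp
  next
    case True
    then obtain F0 where F0: "F0 \<in> facets \<Delta>" "x \<notin> F0" by blast
    \<comment> \<open>The deletion is pure and keeps the facet \<open>F0\<close> of
      \<open>\<Delta>\<close>, which fixes the size of all its facets.\<close>
    have F0d: "F0 \<in> facets (deletion \<Delta> x)" using F0 by (auto simp: facets_def deletion_def)
    have "weakly_regular (sr_ideal {H. H - G \<in> deletion \<Delta> x}) ?fs"
    proof (rule decompose.IH(2))
      show "\<Union> (deletion \<Delta> x) \<subseteq> V" using decompose.prems(1) by (auto simp: deletion_def)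
      show "H \<inter> G = {}" if "H \<in> deletion \<Delta> x" for H
        using that decompose.prems(3)[of H] by (auto simp: deletion_def)
      fix F assume "F \<in> facets (deletion \<Delta> x)"
      then have "card F = card F0"
        using vertex_decomposable_pure[OF decompose.hyps(4)] F0d unfolding pure_complex_def by blast
      then show "card F + card G = r" using decompose.prems(4)[OF F0(1)] by simp
    qed (rule decompose.prems(2))
    moreover have "{H. H - G \<in> deletion \<Delta> x} = {H \<in> ?D. x \<notin> H}"
      using xG by (auto simp: deletion_def)
    ultimately have "weakly_regular (adjoin (sr_ideal ?D) (var x)) ?fs"
      by (simp only: adjoin_sr_ideal[OF scD])
    moreover have "weakly_regular (colon (sr_ideal ?D) (var x)) ?fs"
      using lk by (simp add: colon_sr_ideal)
    ultimately show ?thesis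
      using weakly_regular_extension[OF is_ideal_sr_ideal[OF scD]] by blast
  qed
qed

section \<open>The presentation of a Stanley-Reisner ring\<close>

lemma squarefree_monomial_eq:
  assumes "finite F"
  shows "squarefree_monomial F = (single (\<Sum>v\<in>F. single v 1) 1 :: ('v, 'k::field) mpoly)"
  using assms unfolding squarefree_monomial_def
  by (induction F) (simp_all add: mult_single)

lemma lookup_indicator_exponent:
  assumes "finite F"
  shows "lookup (\<Sum>v\<in>F. single v (1::nat)) u = (if u \<in> F then 1 else 0)"
  using assms by (simp add: lookup_sum lookup_single when_def)

lemma keys_indicator_exponent: "finite F \<Longrightarrow> keys (\<Sum>v\<in>F. single v (1::nat)) = F"
  by (auto simp: in_keys_iff lookup_indicator_exponent[simplified] split: if_splits)

lemma carrier_poly_ring: "carrier (poly_ring V) = poly_in V"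
  by (simp add: poly_ring_def poly_in_def)

text \<open>A monomial whose support is not a face is a multiple of the squarefree monomial of that
  support.\<close>

lemma stanley_reisner_ideal_eq:
  fixes \<Delta> :: "'v set set"
  assumes V: "finite V" and \<Delta>: "simplicial_complex \<Delta>"
  shows "stanley_reisner_ideal V \<Delta> = (sr_ideal \<Delta> \<inter> poly_in V :: ('v, 'k::field) mpoly set)"
proof
  let ?R = "poly_ring V :: ('v, 'k) mpoly ring"
  let ?S = "{squarefree_monomial F | F. F \<subseteq> V \<and> F \<notin> \<Delta>} :: ('v, 'k) mpoly set"
  let ?J = "sr_ideal \<Delta> \<inter> poly_in V :: ('v, 'k) mpoly set"
  interpret R: cring ?R by (rule cring_poly_ring)
  have sr: "is_ideal (sr_ideal \<Delta> :: ('v, 'k) mpoly set)" by (rule is_ideal_sr_ideal[OF \<Delta>])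
  have S: "?S \<subseteq> ?J"
  proof
    fix x assume "x \<in> ?S"
    then obtain F where F: "x = squarefree_monomial F" "F \<subseteq> V" "F \<notin> \<Delta>" by blast
    have fin: "finite F" using F(2) V by (rule finite_subset)
    show "x \<in> ?J"
      using F keys_indicator_exponent[OF fin]
      by (simp add: squarefree_monomial_eq[OF fin] sr_ideal_def poly_in_def)
  qed
  have uminus: "\<ominus>\<^bsub>?R\<^esub> a = - a" if "a \<in> poly_in V" for a
    by (rule R.minus_equality) (use that in \<open>simp_all add: carrier_poly_ring poly_in_uminus, simp_all add: poly_ring_def\<close>)
  have "ideal ?J ?R"
  proof (rule idealI)
    show "ring ?R" by (rule R.ring_axioms)
    show "subgroup ?J (add_monoid ?R)"
    proof (rule R.add.subgroupI)
      show "?J \<subseteq> carrier ?R" by (auto simp: carrier_poly_ring)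
      show "?J \<noteq> {}" using is_idealD(1)[OF sr] by auto
      fix a assume a: "a \<in> ?J"
      then show "\<ominus>\<^bsub>?R\<^esub> a \<in> ?J" using is_idealD(5)[OF sr] by (simp add: uminus poly_in_uminus)
      fix b assume "b \<in> ?J"
      then show "a \<oplus>\<^bsub>?R\<^esub> b \<in> ?J"
        using a is_idealD(2)[OF sr] by (auto simp: poly_ring_def intro: poly_in_add)
    qed
    fix a x assume "a \<in> ?J" "x \<in> carrier ?R"
    then show "x \<otimes>\<^bsub>?R\<^esub> a \<in> ?J" "a \<otimes>\<^bsub>?R\<^esub> x \<in> ?J"
      unfolding carrier_poly_ring using is_idealD(3,4)[OF sr]
      by (auto simp: poly_ring_def intro: poly_in_mult)
  qed
  then show "stanley_reisner_ideal V \<Delta> \<subseteq> ?J"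
    unfolding stanley_reisner_ideal_def using S by (rule R.genideal_minimal)
  let ?I = "stanley_reisner_ideal V \<Delta> :: ('v, 'k) mpoly set"
  have I: "ideal ?I ?R" by (rule ideal_stanley_reisner_ideal[OF V])
  interpret I: ideal "?I" ?R by (rule I)
  have "?S \<subseteq> carrier ?R" using S by (auto simp: carrier_poly_ring)
  then have gen: "?S \<subseteq> ?I"
    unfolding stanley_reisner_ideal_def by (rule R.genideal_self)
  show "?J \<subseteq> ?I"
  proof
    fix p assume p: "p \<in> ?J"
    have sing: "single m (lookup p m) \<in> ?I" if m: "m \<in> keys p" for m
    proof -
      have mV: "keys m \<subseteq> V" "keys m \<notin> \<Delta>" using p m by (auto simp: sr_ideal_def poly_in_def)
      let ?e = "\<Sum>v\<in>keys m. single v (1::nat)"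
      have eq: "m = (m - ?e) + ?e"
        by (intro poly_mapping_eqI)
           (auto simp: lookup_add lookup_minus lookup_indicator_exponent[simplified] in_keys_iff)
      have sub: "keys (m - ?e) \<subseteq> keys m" by (auto simp: in_keys_iff lookup_minus)
      have "single (m - ?e) (lookup p m) \<otimes>\<^bsub>?R\<^esub> squarefree_monomial (keys m) \<in> ?I"
      proof (rule I.I_l_closed)
        have "squarefree_monomial (keys m) \<in> ?S" using mV by (intro CollectI exI[of _ "keys m"]) simp
        then show "squarefree_monomial (keys m) \<in> ?I" by (rule subsetD[OF gen])
        show "single (m - ?e) (lookup p m) \<in> carrier ?R"
          using sub mV unfolding carrier_poly_ring poly_in_def by auto
      qed
      also have "single (m - ?e) (lookup p m) \<otimes>\<^bsub>?R\<^esub> squarefree_monomial (keys m) = single m (lookup p m)"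
        using eq by (simp add: poly_ring_def squarefree_monomial_eq mult_single)
      finally show ?thesis .
    qed
    have "(\<Sum>m\<in>X. single m (lookup p m)) \<in> ?I" if "X \<subseteq> keys p" for X
      using finite_subset[OF that finite_keys] that
    proof (induction X)
      case empty
      then show ?case using I.zero_closed by (simp add: poly_ring_def)
    next
      case (insert m X)
      then have "single m (lookup p m) \<oplus>\<^bsub>?R\<^esub> (\<Sum>m\<in>X. single m (lookup p m)) \<in> ?I"
        by (intro I.a_closed sing) auto
      then show ?case using insert.hyps by (simp add: poly_ring_def)
    qed
    from this[OF order_refl] show "p \<in> ?I" by (simp add: poly_mapping_sum_single)
  qed
qed

text \<open>Killing the variables outside \<open>V\<close> before passing to cosets extends the
  quotient map to the whole polynomial type.\<close>

definition sr_presentation :: "'v set \<Rightarrow> 'v set set \<Rightarrow> ('v, 'k::field) mpoly \<Rightarrow> ('v, 'k) mpoly set" where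
  "sr_presentation V \<Delta> p = stanley_reisner_ideal V \<Delta> +>\<^bsub>poly_ring V\<^esub> subst (restr V) p"

lemma subst_restr_id: "p \<in> poly_in V \<Longrightarrow> subst (restr V) p = p"
  by (intro poly_mapping_eqI) (auto simp: lookup_subst_restr poly_in_def in_keys_iff)

lemma subst_restr_sr_ideal:
  assumes "\<Union>\<Delta> \<subseteq> V"
  shows "subst (restr V) p \<in> sr_ideal \<Delta> \<longleftrightarrow> p \<in> sr_ideal \<Delta>"
proof -
  have "m \<in> keys (subst (restr V) p) \<longleftrightarrow> m \<in> keys p" if "keys m \<in> \<Delta>" for m
    using assms that by (auto simp: in_keys_iff lookup_subst_restr)
  then show ?thesis unfolding sr_ideal_def by blast
qed

lemma sr_presentation:
  fixes \<Delta> :: "'v set set"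
  assumes V: "finite V" and \<Delta>: "simplicial_complex \<Delta>" "\<Union>\<Delta> \<subseteq> V"
  defines "R \<equiv> stanley_reisner_ring V \<Delta> :: ('v, 'k::field) mpoly set ring"
  shows "ring_presentation R (sr_presentation V \<Delta>)"
    and "ring_presentation.ker R (sr_presentation V \<Delta>) = sr_ideal \<Delta>"
proof -
  let ?P = "poly_ring V :: ('v, 'k) mpoly ring"
  let ?I = "stanley_reisner_ideal V \<Delta> :: ('v, 'k) mpoly set"
  let ?\<pi> = "sr_presentation V \<Delta> :: ('v, 'k) mpoly \<Rightarrow> _"
  interpret P: cring ?P by (rule cring_poly_ring)
  interpret I: ideal ?I ?P by (rule ideal_stanley_reisner_ideal[OF V])
  have hom: "(+>\<^bsub>?P\<^esub>) ?I \<in> ring_hom ?P R"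
    unfolding R_def stanley_reisner_ring_def by (rule I.rcos_ring_hom)
  have mem: "subst (restr V) p \<in> carrier ?P" for p :: "('v, 'k) mpoly"
    by (simp add: carrier_poly_ring subst_restr_poly_in)
  have ops: "a \<oplus>\<^bsub>?P\<^esub> b = a + b" "a \<otimes>\<^bsub>?P\<^esub> b = a * b" "\<one>\<^bsub>?P\<^esub> = 1" for a b
    by (simp_all add: poly_ring_def)
  show pres: "ring_presentation R ?\<pi>"
  proof (intro ring_presentation.intro ring_presentation_axioms.intro)
    show "cring R" unfolding R_def by (rule cring_stanley_reisner_ring[OF V])
    have "carrier R = (\<lambda>a. ?I +>\<^bsub>?P\<^esub> a) ` carrier ?P"
      unfolding R_def stanley_reisner_ring_def FactRing_def A_RCOSETS_def' by auto
    also have "carrier ?P = range (subst (restr V))"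
    proof
      show "carrier ?P \<subseteq> range (subst (restr V))"
        unfolding carrier_poly_ring by (metis rangeI subsetI subst_restr_id)
    qed (use mem in blast)
    also have "(\<lambda>a. ?I +>\<^bsub>?P\<^esub> a) ` range (subst (restr V)) = range ?\<pi>"
      unfolding image_image by (simp add: sr_presentation_def)
    finally show "range ?\<pi> = carrier R" by simp
    fix a b :: "('v, 'k) mpoly"
    show "?\<pi> (a + b) = ?\<pi> a \<oplus>\<^bsub>R\<^esub> ?\<pi> b"
      using ring_hom_add[OF hom mem mem, of a b] by (simp add: sr_presentation_def ops)
    show "?\<pi> (a * b) = ?\<pi> a \<otimes>\<^bsub>R\<^esub> ?\<pi> b"
      using ring_hom_mult[OF hom mem mem, of a b] by (simp add: sr_presentation_def ops)
    show "?\<pi> 1 = \<one>\<^bsub>R\<^esub>"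
      using ring_hom_one[OF hom] by (simp add: sr_presentation_def ops)
  qed
  have zero: "\<zero>\<^bsub>R\<^esub> = ?I"
    unfolding R_def stanley_reisner_ring_def by (simp add: FactRing_def)
  have "?\<pi> p = \<zero>\<^bsub>R\<^esub> \<longleftrightarrow> p \<in> sr_ideal \<Delta>" for p :: "('v, 'k) mpoly"
  proof -
    have "?\<pi> p = \<zero>\<^bsub>R\<^esub> \<longleftrightarrow> subst (restr V) p \<in> ?I"
      unfolding zero sr_presentation_def
      using I.rcos_const_imp_mem[OF mem] P.a_rcos_zero[OF I.is_ideal] by blast
    also have "\<dots> \<longleftrightarrow> p \<in> sr_ideal \<Delta>"
      by (simp add: stanley_reisner_ideal_eq[OF V \<Delta>(1)] subst_restr_poly_in subst_restr_sr_ideal[OF \<Delta>(2)])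
    finally show ?thesis .
  qed
  then show "ring_presentation.ker R ?\<pi> = sr_ideal \<Delta>"
    unfolding ring_presentation.ker_def[OF pres] by blast
qed

lemma var_in_sr_ideal: "{u} \<notin> \<Delta> \<Longrightarrow> var u \<in> sr_ideal \<Delta>"
  by (simp add: sr_ideal_def var_def)

theorem Cohen_Macaulay_vertex_decomposable:
  fixes \<Delta> :: "'v::linorder set set"
  assumes V: "finite V" "\<Union>\<Delta> \<subseteq> V" and vd: "vertex_decomposable \<Delta>"
    and d: "\<And>F. F \<in> facets \<Delta> \<Longrightarrow> card F = d"
  shows "Cohen_Macaulay_ring (stanley_reisner_ring V \<Delta> :: ('v, 'k::field) mpoly set ring)"
proof -
  let ?\<pi> = "sr_presentation V \<Delta> :: ('v, 'k) mpoly \<Rightarrow> _"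
  have sc: "simplicial_complex \<Delta>" using vertex_decomposable_pure[OF vd] by (simp add: pure_complex_def)
  interpret ring_presentation "stanley_reisner_ring V \<Delta> :: ('v, 'k) mpoly set ring" ?\<pi>
    by (rule sr_presentation[OF V(1) sc V(2)])
  have ker: "ker = sr_ideal \<Delta>" by (rule sr_presentation[OF V(1) sc V(2)])
  have fin: "finite \<Delta>" using V by (intro finite_subset[of \<Delta> "Pow V"]) auto
  have outside: "var u \<in> (sr_ideal \<Delta> :: ('v, 'k) mpoly set)" if "u \<notin> V" for u
    using V(2) that by (intro var_in_sr_ideal) auto
  show ?thesis
  proof (rule Cohen_Macaulay_ringI)
    show "noetherian_ring (stanley_reisner_ring V \<Delta> :: ('v, 'k) mpoly set ring)"
    proof (rule noetherian_ringI')
      fix J assume J: "is_ideal J" "ker \<subseteq> J"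
      have vars: "var u \<in> K" if "ker \<subseteq> K" "u \<notin> V" for u K
        using that outside unfolding ker by blast
      have "\<exists>T. finite T \<and> T \<subseteq> J \<and>
          (\<forall>J'. is_ideal J' \<longrightarrow> (\<forall>u. u \<notin> V \<longrightarrow> var u \<in> J') \<longrightarrow> T \<subseteq> J' \<longrightarrow> J \<subseteq> J')"
        by (rule finitely_generated_modulo_vars[OF V(1) J(1)]) (rule vars[OF J(2)])
      then obtain T where T: "finite T" "T \<subseteq> J"
        "\<forall>J'. is_ideal J' \<longrightarrow> (\<forall>u. u \<notin> V \<longrightarrow> var u \<in> J') \<longrightarrow> T \<subseteq> J' \<longrightarrow> J \<subseteq> J'"
        by (elim exE conjE)
      have "J \<subseteq> J'" if "is_ideal J'" "ker \<subseteq> J'" "T \<subseteq> J'" for J'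
        by (rule T(3)[rule_format]) (use that vars[OF that(2)] in auto)
      then show "\<exists>T. finite T \<and> T \<subseteq> J \<and> (\<forall>J'. is_ideal J' \<longrightarrow> ker \<subseteq> J' \<longrightarrow> T \<subseteq> J' \<longrightarrow> J \<subseteq> J')"
        using T(1,2) by blast
    qed
    have faces: "finite F \<and> card F \<le> d" if F: "F \<in> \<Delta>" for F
    proof -
      obtain E where E: "E \<in> facets \<Delta>" "F \<subseteq> E" using face_in_facet[OF fin F] .
      have "finite E" using E(1) sc by (auto simp: facets_def simplicial_complex_def)
      then show ?thesis using E d[OF E(1)] card_mono[of E F] finite_subset by auto
    qed
    show "r \<le> d" if "\<And>i. i \<le> r \<Longrightarrow> is_prime_ideal (Q i)" "\<And>i. i < r \<Longrightarrow> Q i \<subset> Q (Suc i)" "ker \<subseteq> Q 0"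
      for Q r
      using prime_chain_length_sr[OF fin faces, of r Q] that unfolding ker by blast
    fix M assume M: "is_maximal_ideal M" "ker \<subseteq> M"
    have MI: "is_ideal M" using M by (simp add: is_maximal_ideal_def)
    have outM: "var u \<in> M" if "u \<notin> V" for u using outside[OF that] M(2) unfolding ker by blast
    define q where "q v = (SOME q. q \<in> poly_in {v} \<and> q \<noteq> 0 \<and> q \<in> M)" for v
    have q: "q v \<in> poly_in {v} \<and> q v \<noteq> 0 \<and> q v \<in> M" for v
      unfolding q_def using zariski_lemma[OF M(1) V(1) outM] by (rule someI_ex)
    \<comment> \<open>The factor \<open>q v\<close> puts \<open>g v\<close> into \<open>M\<close>;
      the factor \<open>var v\<close> puts it into the prime of every face that omits
      \<open>v\<close>.\<close>
    define g where "g v = var v * q v" for v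
    have g: "g v \<in> poly_in {v} \<and> g v \<noteq> 0 \<and> (\<exists>q. g v = var v * q)" for v
      unfolding g_def using q[of v] by (auto intro!: poly_in_mult)
    have gM: "g v \<in> M" for v unfolding g_def using q is_idealD(3)[OF MI] by blast
    let ?fs = "map (elem_sym V g) (rev [1..<Suc d])"
    have "elem_sym V g i \<in> M" if "1 \<le> i" for i
      unfolding elem_sym_def
    proof (rule is_ideal_sum[OF MI])
      fix T assume T: "T \<in> {T. T \<subseteq> V \<and> card T = i}"
      then have "finite T" "T \<noteq> {}" using that V(1) finite_subset by fastforce+
      then obtain v where "v \<in> T" by blast
      then show "(\<Prod>v\<in>T. g v) \<in> M" by (rule prod_in_ideal[OF MI \<open>finite T\<close> _ gM])
    qed
    then have "set ?fs \<subseteq> M" by auto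
    moreover have "weakly_regular ker ?fs"
      using vertex_decomposable_weakly_regular[OF vd V(1), of g "{}" d] g V(2) d unfolding ker by simp
    moreover have "length ?fs = d" by simp
    ultimately show "\<exists>fs. length fs = d \<and> set fs \<subseteq> M \<and> weakly_regular ker fs" by blast
  qed
qed

section \<open>Points with coordinates 0 and 1, and the failure of Cohen-Macaulayness\<close>

lemma is_maximal_point_ideal: "is_maximal_ideal (point_ideal G :: ('v, 'k::field) mpoly set)"
proof -
  let ?\<epsilon> = "subst (\<lambda>v. if v \<in> G then 1 else 0 :: ('v, 'k) mpoly)"
  have const: "\<exists>c. ?\<epsilon> p = cst c" for p :: "('v, 'k) mpoly"
  proof (induction p rule: mpoly_induct)
    case (var v p)
    then obtain c where "?\<epsilon> p = cst c" by blast
    then show ?case by (auto intro: exI[of _ c] exI[of _ 0])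
  next
    case (add p q)
    then obtain a b where "?\<epsilon> p = cst a" "?\<epsilon> q = cst b" by blast
    then show ?case by (intro exI[of _ "a + b"]) (simp add: single_add)
  qed (auto)
  have "\<exists>b. 1 - a * b \<in> point_ideal G" if "a \<notin> point_ideal G" for a :: "('v, 'k) mpoly"
  proof -
    obtain c where c: "?\<epsilon> a = cst c" using const by blast
    then have "c \<noteq> 0" using that by (auto simp: point_ideal_def)
    then have "1 - a * cst (inverse c) \<in> point_ideal G"
      by (simp add: point_ideal_def c mult_single)
    then show ?thesis by blast
  qed
  moreover have "is_ideal (point_ideal G :: ('v, 'k) mpoly set)" "1 \<notin> (point_ideal G :: ('v, 'k) mpoly set)"
    by (simp_all add: is_ideal_def point_ideal_def)
  ultimately show ?thesis unfolding is_maximal_ideal_def by blast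
qed

text \<open>The chain starts at the prime of the face \<open>E\<close> and sets the variables of
  \<open>E\<close> to the coordinates of the point one after the other. As \<open>G\<close> lies in
  \<open>E\<close>, the last map is evaluation at the point.\<close>

lemma point_ideal_chain:
  fixes \<Delta> :: "'v::linorder set set"
  assumes "simplicial_complex \<Delta>" "E \<in> \<Delta>" "G \<subseteq> E"
  shows "\<exists>Q :: nat \<Rightarrow> ('v, 'k::field) mpoly set. (\<forall>i\<le>card E. is_prime_ideal (Q i)) \<and>
    (\<forall>i<card E. Q i \<subset> Q (Suc i)) \<and> sr_ideal \<Delta> \<subseteq> Q 0 \<and> Q (card E) = point_ideal G"
proof -
  have "finite E" using assms by (simp add: simplicial_complex_def)
  then obtain es where es: "set es = E" "distinct es" using finite_distinct_list by blast
  have len: "length es = card E" using es distinct_card by metis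
  define \<delta> where "\<delta> v = (if v \<in> G then 1 else 0 :: ('v, 'k) mpoly)" for v
  define s where "s j v = (if v \<in> set (take j es) then \<delta> v else restr E v)" for j v
  define Q where "Q j = {p. subst (s j) p = 0}" for j
  have "Q j \<subset> Q (Suc j)" if j: "j < card E" for j
  proof -
    let ?e = "es ! j"
    have jl: "j < length es" using j len by simp
    have take: "set (take (Suc j) es) = insert ?e (set (take j es))"
      using jl by (simp add: take_Suc_conv_app_nth)
    have ne: "?e \<notin> set (take j es)" "?e \<in> E"
      using es jl by (auto simp: in_set_conv_nth distinct_conv_nth)
    have "s (Suc j) = (\<lambda>v. subst (var(?e := \<delta> ?e)) (s j v))"
      using take ne by (auto simp: s_def restr_def \<delta>_def fun_eq_iff)
    then have comp: "subst (s (Suc j)) p = subst (var(?e := \<delta> ?e)) (subst (s j) p)" for p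
      by (simp add: subst_subst)
    have sub: "subst s' (\<delta> v) = \<delta> v" for s' :: "'v \<Rightarrow> ('v, 'k) mpoly" and v by (simp add: \<delta>_def)
    \<comment> \<open>The polynomial \<open>var ?e - \<delta> ?e\<close> witnesses that the
      inclusion is strict.\<close>
    have "subst (s (Suc j)) (var ?e - \<delta> ?e) = 0" using take by (simp add: s_def sub)
    moreover have "subst (s j) (var ?e - \<delta> ?e) \<noteq> 0"
      using ne by (simp add: s_def sub restr_def \<delta>_def)
    ultimately have "var ?e - \<delta> ?e \<in> Q (Suc j)" "var ?e - \<delta> ?e \<notin> Q j" by (simp_all only: Q_def mem_Collect_eq not_False_eq_True)
    moreover have "Q j \<subseteq> Q (Suc j)" by (auto simp: Q_def comp)
    ultimately show ?thesis by blast
  qed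
  moreover have "is_prime_ideal (Q i)" for i unfolding Q_def by (rule is_prime_ideal_kernel)
  moreover have "s 0 = restr E" by (auto simp: s_def)
  then have "sr_ideal \<Delta> \<subseteq> Q 0"
    using sr_ideal_eq_kernels[OF assms(1)] assms(2) unfolding Q_def by auto
  moreover have "s (card E) = \<delta>"
    using es len assms(3) by (auto simp: s_def restr_def \<delta>_def fun_eq_iff)
  then have "Q (card E) = point_ideal G" by (simp add: Q_def point_ideal_def \<delta>_def[abs_def])
  ultimately show ?thesis by blast
qed

text \<open>At the point of \<open>G\<close> the height is at least \<open>card E\<close>, whereas
  regular sequences have length at most \<open>card G + 1\<close>.\<close>

theorem not_Cohen_Macaulay_disconnected_link:
  fixes \<Delta> :: "'v::linorder set set"
  assumes V: "finite V" "\<Union>\<Delta> \<subseteq> V" and sc: "simplicial_complex \<Delta>"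
    and E: "E \<in> \<Delta>" "G \<subseteq> E" "card G + 2 \<le> card E"
    and disj: "\<And>F a b. F \<in> \<Delta> \<Longrightarrow> G \<subseteq> F \<Longrightarrow> a \<in> F - G \<Longrightarrow> b \<in> F - G \<Longrightarrow> a \<in> W \<longleftrightarrow> b \<in> W"
    and w: "insert w G \<in> \<Delta>" "w \<notin> G" "w \<in> W" and w': "insert w' G \<in> \<Delta>" "w' \<notin> G" "w' \<notin> W"
  shows "\<not> Cohen_Macaulay_ring (stanley_reisner_ring V \<Delta> :: ('v, 'k::field) mpoly set ring)"
proof
  assume CM: "Cohen_Macaulay_ring (stanley_reisner_ring V \<Delta> :: ('v, 'k) mpoly set ring)"
  interpret ring_presentation "stanley_reisner_ring V \<Delta> :: ('v, 'k) mpoly set ring"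
    "sr_presentation V \<Delta> :: ('v, 'k) mpoly \<Rightarrow> _"
    by (rule sr_presentation[OF V(1) sc V(2)])
  have ker: "ker = sr_ideal \<Delta>" by (rule sr_presentation[OF V(1) sc V(2)])
  obtain Q :: "nat \<Rightarrow> ('v, 'k) mpoly set" where Q: "\<And>i. i \<le> card E \<Longrightarrow> is_prime_ideal (Q i)"
    "\<And>i. i < card E \<Longrightarrow> Q i \<subset> Q (Suc i)" "sr_ideal \<Delta> \<subseteq> Q 0" "Q (card E) = point_ideal G"
    using point_ideal_chain[OF sc E(1,2)] by blast
  obtain fs where fs: "card E \<le> length fs" "set fs \<subseteq> Q (card E)" "weakly_regular ker fs"
    using Cohen_Macaulay_ringD[OF CM, of Q "card E"] Q is_maximal_point_ideal unfolding ker by metis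
  have "finite E" using sc E(1) by (simp add: simplicial_complex_def)
  then have finG: "finite G" using E(2) finite_subset by blast
  have "length fs \<le> card G + 1"
  proof (rule regular_sequence_short_of_disconnected_link[where W = W and w = w and w' = w'])
    show "a \<in> W \<longleftrightarrow> b \<in> W" if "F \<in> \<Delta>" "G \<subseteq> F" "a \<in> F - G" "b \<in> F - G" for F a b
      using disj that by blast
  qed (use sc finG w w' fs(2,3) Q(4) ker in auto)
  then show False using fs(1) E(3) by simp
qed

section \<open>Complexes generated by sets of equal size\<close>

definition generated :: "'v set set \<Rightarrow> 'v set set" where
  "generated \<A> = {F. \<exists>A\<in>\<A>. F \<subseteq> A}"

definition uniform :: "nat \<Rightarrow> 'v set set \<Rightarrow> bool" where
  "uniform c \<A> \<longleftrightarrow> (\<forall>A\<in>\<A>. finite A \<and> card A = c)"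

lemma facets_generated: "facets (generated \<A>) \<subseteq> \<A>"
  unfolding facets_def generated_def by blast

lemma pure_generated:
  assumes "uniform c \<A>"
  shows "pure_complex (generated \<A>)"
  unfolding pure_complex_def
proof
  show "simplicial_complex (generated \<A>)"
    using assms unfolding simplicial_complex_def generated_def uniform_def
    by (blast intro: finite_subset)
  show "\<forall>F\<in>facets (generated \<A>). \<forall>G\<in>facets (generated \<A>). card F = card G"
    using facets_generated[of \<A>] assms unfolding uniform_def by (metis subsetD)
qed

lemma generated_singleton: "generated {A} = Pow A"
  by (auto simp: generated_def)

lemma link_generated: "link (generated \<A>) x = generated ((\<lambda>A. A - {x}) ` {A \<in> \<A>. x \<in> A})"
  unfolding link_def generated_def by auto

text \<open>The hypothesis is the shedding condition: it keeps the facets through \<open>x\<close>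
  from leaving new facets behind.\<close>

lemma deletion_generated:
  assumes "\<And>A. A \<in> \<A> \<Longrightarrow> x \<in> A \<Longrightarrow> \<exists>B\<in>\<A>. x \<notin> B \<and> A - {x} \<subseteq> B"
  shows "deletion (generated \<A>) x = generated {A \<in> \<A>. x \<notin> A}"
proof
  show "deletion (generated \<A>) x \<subseteq> generated {A \<in> \<A>. x \<notin> A}"
  proof
    fix F assume "F \<in> deletion (generated \<A>) x"
    then obtain A where A: "A \<in> \<A>" "F \<subseteq> A - {x}" by (auto simp: deletion_def generated_def)
    show "F \<in> generated {A \<in> \<A>. x \<notin> A}"
    proof (cases "x \<in> A")
      case True
      then obtain B where "B \<in> \<A>" "x \<notin> B" "A - {x} \<subseteq> B" using assms A(1) by blast
      then show ?thesis using A(2) unfolding generated_def by blast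
    qed (use A in \<open>auto simp: generated_def\<close>)
  qed
qed (auto simp: deletion_def generated_def)

lemma vertex_decomposable_generated:
  assumes "uniform c \<A>" "A \<in> \<A>" "x \<in> A"
    and "vertex_decomposable (generated ((\<lambda>A. A - {x}) ` {A \<in> \<A>. x \<in> A}))"
    and "vertex_decomposable (generated {A \<in> \<A>. x \<notin> A})"
    and "\<And>A. A \<in> \<A> \<Longrightarrow> x \<in> A \<Longrightarrow> \<exists>B\<in>\<A>. x \<notin> B \<and> A - {x} \<subseteq> B"
  shows "vertex_decomposable (generated \<A>)"
proof (rule vertex_decomposable.decompose[OF pure_generated[OF assms(1)]])
  show "{x} \<in> generated \<A>" using assms(2,3) by (auto simp: generated_def)
qed (use assms in \<open>simp_all add: link_generated deletion_generated\<close>)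

lemma vertex_decomposable_generated_Un:
  assumes "uniform c (\<B> \<union> \<C>)" "\<B> \<noteq> {}" "\<forall>A\<in>\<B>. x \<in> A" "\<forall>A\<in>\<C>. x \<notin> A"
    and "vertex_decomposable (generated ((\<lambda>A. A - {x}) ` \<B>))" "vertex_decomposable (generated \<C>)"
    and "\<forall>A\<in>\<B>. \<exists>B\<in>\<C>. A - {x} \<subseteq> B"
  shows "vertex_decomposable (generated (\<B> \<union> \<C>))"
proof -
  obtain A where A: "A \<in> \<B>" using assms(2) by blast
  have eq: "{A \<in> \<B> \<union> \<C>. x \<in> A} = \<B>" "{A \<in> \<B> \<union> \<C>. x \<notin> A} = \<C>" using assms(3,4) by blast+
  show ?thesis
  proof (rule vertex_decomposable_generated[OF assms(1)])
    show "A \<in> \<B> \<union> \<C>" "x \<in> A" using A assms(3) by blast+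
    fix A assume "A \<in> \<B> \<union> \<C>" "x \<in> A"
    then have "A \<in> \<B>" using assms(4) by auto
    then obtain B where "B \<in> \<C>" "A - {x} \<subseteq> B" using assms(7) by auto
    then show "\<exists>B\<in>\<B> \<union> \<C>. x \<notin> B \<and> A - {x} \<subseteq> B" using assms(4) by auto
  qed (simp_all only: eq assms(5,6))
qed

text \<open>The new vertex \<open>x\<close> is shed first: its link is the simplex on
  \<open>B\<close> and its deletion is the old complex.\<close>

lemma vertex_decomposable_add_facet:
  assumes "vertex_decomposable (generated \<A>)" "uniform c \<A>"
    and "x \<notin> \<Union>\<A>" "x \<notin> B" "finite B" "c = Suc (card B)" "A \<in> \<A>" "B \<subseteq> A"
  shows "vertex_decomposable (generated (insert (insert x B) \<A>))"
proof (rule vertex_decomposable_generated[where c = c and x = x and A = "insert x B"])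
  show "uniform c (insert (insert x B) \<A>)" using assms by (simp add: uniform_def)
  have "{A \<in> insert (insert x B) \<A>. x \<in> A} = {insert x B}" using assms(3) by blast
  then have "(\<lambda>A. A - {x}) ` {A \<in> insert (insert x B) \<A>. x \<in> A} = {B}" using assms(4) by auto
  then show "vertex_decomposable (generated ((\<lambda>A. A - {x}) ` {A \<in> insert (insert x B) \<A>. x \<in> A}))"
    using assms(5) by (simp add: generated_singleton vertex_decomposable.simplex)
  have "{A \<in> insert (insert x B) \<A>. x \<notin> A} = \<A>" using assms(3) by blast
  then show "vertex_decomposable (generated {A \<in> insert (insert x B) \<A>. x \<notin> A})"
    using assms(1) by simp
  show "\<exists>C\<in>insert (insert x B) \<A>. x \<notin> C \<and> A' - {x} \<subseteq> C" if "A' \<in> insert (insert x B) \<A>" "x \<in> A'" for A'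
    using that assms(3,7,8) by blast
qed auto

section \<open>Vertex decomposable van der Waerden complexes\<close>

lemma vdW_generated: "vdW n k = generated (progressions n k)"
  by (simp add: vdW_def generated_def)

lemma uniform_progressions: "uniform (k + 1) (progressions n k)"
  unfolding uniform_def using progressions_finite_card by blast

lemma pure_skeleton:
  assumes "finite S" "r \<le> card S"
  shows "pure_complex {F. F \<subseteq> S \<and> card F \<le> r}"
proof -
  let ?\<Delta> = "{F. F \<subseteq> S \<and> card F \<le> r}"
  have "simplicial_complex ?\<Delta>"
    unfolding simplicial_complex_def
  proof (intro ballI conjI allI impI)
    fix F assume F: "F \<in> ?\<Delta>"
    then show "finite F" using assms(1) finite_subset by blast
    then show "G \<in> ?\<Delta>" if "G \<subseteq> F" for G using F that card_mono[of F G] by auto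
  qed
  moreover have "card F = r" if F: "F \<in> facets ?\<Delta>" for F
  proof (rule ccontr)
    assume ne: "card F \<noteq> r"
    have F': "F \<subseteq> S" "card F < r" using F ne by (auto simp: facets_def)
    then have finF: "finite F" using assms(1) finite_subset by blast
    have "F \<noteq> S" using F' assms(2) by auto
    then obtain y where y: "y \<in> S" "y \<notin> F" using F' by blast
    then have "insert y F \<in> ?\<Delta>" using F' finF by simp
    then show False using F y unfolding facets_def by blast
  qed
  ultimately show ?thesis unfolding pure_complex_def by simp
qed

text \<open>Link and deletion of a vertex are again skeleta of a smaller simplex; the extreme values
  of \<open>r\<close> give simplices. The case \<open>r = 2\<close> is the complete graph, which is
  \<open>vdW n 1\<close>.\<close>

lemma vertex_decomposable_skeleton:
  assumes "finite S"
  shows "vertex_decomposable {F. F \<subseteq> S \<and> card F \<le> r}"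
  using assms
proof (induction S arbitrary: r rule: finite_induct)
  case empty
  have "{F. F \<subseteq> {} \<and> card F \<le> r} = Pow {}" by auto
  then show ?case by (metis finite.emptyI vertex_decomposable.simplex)
next
  case (insert x S)
  let ?\<Delta> = "{F. F \<subseteq> insert x S \<and> card F \<le> r}"
  have fin: "finite F" if "F \<subseteq> insert x S" for F using that insert.hyps(1) finite_subset by blast
  consider "r = 0" | "card (insert x S) \<le> r" | "0 < r" "r \<le> card (insert x S)" by linarith
  then show ?case
  proof cases
    case 1
    have "?\<Delta> = Pow {}" using 1 fin by auto
    then show ?thesis by (metis finite.emptyI vertex_decomposable.simplex)
  next
    case 2
    have "?\<Delta> = Pow (insert x S)"
      using 2 card_mono[of "insert x S"] insert.hyps(1) by (auto intro: order_trans)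
    then show ?thesis using insert.hyps(1) by (metis finite.insertI vertex_decomposable.simplex)
  next
    case 3
    show ?thesis
    proof (rule vertex_decomposable.decompose)
      show "pure_complex ?\<Delta>" using 3 insert.hyps by (intro pure_skeleton) auto
      show "{x} \<in> ?\<Delta>" using 3 by simp
      have "F \<in> link ?\<Delta> x \<longleftrightarrow> F \<subseteq> S \<and> card F \<le> r - 1" for F
      proof (cases "F \<subseteq> S")
        case True
        then have "finite F" "x \<notin> F" using fin insert.hyps(2) by blast+
        then show ?thesis using True 3(1) by (auto simp: link_def)
      qed (auto simp: link_def)
      then have "link ?\<Delta> x = {F. F \<subseteq> S \<and> card F \<le> r - 1}" by blast
      then show "vertex_decomposable (link ?\<Delta> x)" using insert.IH by simp
      have "deletion ?\<Delta> x = {F. F \<subseteq> S \<and> card F \<le> r}" using insert.hyps by (auto simp: deletion_def)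
      then show "vertex_decomposable (deletion ?\<Delta> x)" using insert.IH by simp
    qed
  qed
qed

lemma vertex_decomposable_vdW_1:
  assumes "1 < n"
  shows "vertex_decomposable (vdW n 1)"
proof -
  have prog: "progressions n 1 = {{a, b} | a b. 1 \<le> a \<and> a < b \<and> b \<le> n}"
  proof -
    have "(\<lambda>j. i + j * d) ` {0..1} = {i, i + d}" for i d :: nat
    proof -
      have "{0..1::nat} = {0, 1}" by auto
      then show ?thesis by simp
    qed
    then have "progressions n 1 = {{i, i + d} | i d. 1 \<le> i \<and> i < i + d \<and> i + d \<le> n}"
      by (simp add: progressions_def)
    also have "\<dots> = {{a, b} | a b. 1 \<le> a \<and> a < b \<and> b \<le> n}"
    proof (intro equalityI subsetI)
      fix A assume "A \<in> {{a, b} | a b. 1 \<le> a \<and> a < b \<and> b \<le> n}"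
      then obtain a b where "A = {a, a + (b - a)}" "1 \<le> a" "a < a + (b - a)" "a + (b - a) \<le> n" by auto
      then show "A \<in> {{i, i + d} | i d. 1 \<le> i \<and> i < i + d \<and> i + d \<le> n}" by blast
    qed blast
    finally show ?thesis .
  qed
  have pair: "\<exists>A\<in>progressions n 1. {a, b} \<subseteq> A" if "a \<in> {1..n}" "b \<in> {1..n}" "a < b" for a b
    using that unfolding prog by auto
  have point: "\<exists>A\<in>progressions n 1. {a} \<subseteq> A" if "a \<in> {1..n}" for a
  proof (cases "a = n")
    case True
    then show ?thesis using pair[of 1 n] assms by auto
  next
    case False
    then show ?thesis using pair[of a n] that by auto
  qed
  have "vdW n 1 = {F. F \<subseteq> {1..n} \<and> card F \<le> 2}"
  proof (intro equalityI subsetI)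
    fix F assume "F \<in> vdW n 1"
    then obtain a b where ab: "F \<subseteq> {a, b}" "1 \<le> a" "a < b" "b \<le> n" unfolding vdW_def prog by blast
    have "card F \<le> card {a, b}" using ab(1) by (intro card_mono) auto
    then show "F \<in> {F. F \<subseteq> {1..n} \<and> card F \<le> 2}" using ab by auto
  next
    fix F assume F: "F \<in> {F. F \<subseteq> {1..n} \<and> card F \<le> 2}"
    then have "finite F" using finite_subset by blast
    consider "card F = 0" | "card F = 1" | "card F = 2" using F by fastforce
    then have "\<exists>A\<in>progressions n 1. F \<subseteq> A"
    proof cases
      case 1
      then show ?thesis using \<open>finite F\<close> point[of 1] assms by auto
    next
      case 2
      then obtain a where "F = {a}" by (auto simp: card_1_singleton_iff)
      then show ?thesis using point F by auto
    next
      case 3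
      then obtain a b where "F = {a, b}" "a \<noteq> b" by (auto simp: card_2_iff)
      then show ?thesis using pair[of a b] pair[of b a] F by (cases "a < b") (auto simp: insert_commute)
    qed
    then show "F \<in> vdW n 1" by (simp add: vdW_def)
  qed
  then show ?thesis using vertex_decomposable_skeleton[of "{1..n}" 2] by simp
qed

text \<open>Raising \<open>n\<close> by one adds one interval with the new vertex
  \<open>Suc n\<close>; the rest of that interval lies in the last old one.\<close>

lemma vertex_decomposable_intervals:
  fixes k n :: nat
  assumes "k < n"
  shows "vertex_decomposable (generated {{i..i + k} | i. 1 \<le> i \<and> i + k \<le> n})"
  using assms
proof (induction n)
  case (Suc n)
  let ?I = "\<lambda>n. {{i..i + k} | i. 1 \<le> i \<and> i + k \<le> n}"
  show ?case
  proof (cases "k = n")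
    case True
    then have "?I (Suc n) = {{1..Suc n}}" by auto
    then show ?thesis by (simp add: generated_singleton vertex_decomposable.simplex)
  next
    case False
    then have kn: "k < n" using Suc.prems by simp
    have "?I (Suc n) = insert {Suc n - k..Suc n} (?I n)"
    proof (intro equalityI subsetI)
      fix A assume "A \<in> ?I (Suc n)"
      then obtain i where i: "A = {i..i + k}" "1 \<le> i" "i + k \<le> Suc n" by blast
      show "A \<in> insert {Suc n - k..Suc n} (?I n)"
      proof (cases "i + k = Suc n")
        case True
        then show ?thesis using i by auto
      next
        case False
        then show ?thesis using i by auto
      qed
    next
      fix A assume "A \<in> insert {Suc n - k..Suc n} (?I n)"
      then show "A \<in> ?I (Suc n)"
      proof
        assume "A = {Suc n - k..Suc n}"
        then have "A = {(Suc n - k)..(Suc n - k) + k}" "1 \<le> Suc n - k" "(Suc n - k) + k \<le> Suc n"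
          using kn by auto
        then show ?thesis by blast
      qed auto
    qed
    moreover have "{Suc n - k..Suc n} = insert (Suc n) {Suc n - k..n}"
      using kn by (auto simp: le_Suc_eq)
    moreover have "vertex_decomposable (generated (insert (insert (Suc n) {Suc n - k..n}) (?I n)))"
    proof (rule vertex_decomposable_add_facet[where c = "k + 1" and A = "{n - k..n}"])
      show "vertex_decomposable (generated (?I n))" using Suc.IH kn by simp
      show "uniform (k + 1) (?I n)" by (auto simp: uniform_def)
      show "Suc n \<notin> \<Union>(?I n)" by auto
      show "{n - k..n} \<in> ?I n" using kn by (intro CollectI exI[of _ "n - k"]) auto
    qed (use kn in auto)
    ultimately show ?thesis by simp
  qed
qed simp

text \<open>A difference of 2 or more needs \<open>n > 2 * k\<close>, so only intervals
  occur.\<close>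

lemma vertex_decomposable_vdW_large:
  assumes "0 < k" "k < n" "n \<le> 2 * k"
  shows "vertex_decomposable (vdW n k)"
proof -
  have "progressions n k = {{i..i + k} | i. 1 \<le> i \<and> i + k \<le> n}"
  proof (intro equalityI subsetI)
    fix A assume "A \<in> progressions n k"
    then obtain i d where A: "A = (\<lambda>j. i + j * d) ` {0..k}" "1 \<le> i" "i < i + k * d" "i + k * d \<le> n"
      by (auto simp: progressions_def)
    have "d = 1"
    proof (rule ccontr)
      assume "d \<noteq> 1"
      then have "2 \<le> d" using A(3) by (cases d) auto
      then have "k * 2 \<le> k * d" by (rule mult_le_mono2)
      then show False using A(2,4) assms(3) by linarith
    qed
    then have "A = (+) i ` {0..k}" using A(1) by simp
    then have "A = {i..i + k}" by (simp add: image_add_atLeastAtMost add.commute)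
    then show "A \<in> {{i..i + k} | i. 1 \<le> i \<and> i + k \<le> n}" using A \<open>d = 1\<close> by auto
  next
    fix A assume "A \<in> {{i..i + k} | i. 1 \<le> i \<and> i + k \<le> n}"
    then obtain i where i: "A = {i..i + k}" "1 \<le> i" "i + k \<le> n" by blast
    have "A = (\<lambda>j. i + j * 1) ` {0..k}" using i(1) by (simp add: image_add_atLeastAtMost add.commute)
    moreover have "i < i + k * 1" "i + k * 1 \<le> n" using i(3) assms(1) by auto
    ultimately show "A \<in> progressions n k" using i(2) unfolding progressions_def by blast
  qed
  then show ?thesis using vertex_decomposable_intervals[OF assms(2)] by (simp add: vdW_generated)
qed

section \<open>The exceptional complexes for k = 2 and n = 5, 6\<close>

lemma progressions_2: "progressions n 2 = {{i, i + d, i + 2 * d} | i d. 1 \<le> i \<and> 1 \<le> d \<and> i + 2 * d \<le> n}"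
proof -
  have "{0..2::nat} = {0, 1, 2}" by auto
  then have "(\<lambda>j. i + j * d) ` {0..2} = {i, i + d, i + 2 * d}" for i d :: nat by simp
  moreover have "i < i + 2 * d \<longleftrightarrow> 1 \<le> d" for i d :: nat by auto
  ultimately show ?thesis by (simp add: progressions_def)
qed

lemma progressions_2I: "1 \<le> i \<Longrightarrow> 1 \<le> d \<Longrightarrow> i + 2 * d \<le> n \<Longrightarrow> {i, i + d, i + 2 * d} \<in> progressions n 2"
  unfolding progressions_2 by blast

text \<open>In both exceptional complexes the vertex 2 is shed. Its links are the paths treated here
  and in the next lemma; the facets avoiding 2 form the strips after that.\<close>

lemma vertex_decomposable_path_2: "vertex_decomposable (generated {{1, 3}, {3, 4::nat}})"
proof -
  have "vertex_decomposable (generated (insert (insert 4 {3}) {{1, 3::nat}}))"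
    by (rule vertex_decomposable_add_facet[where c = 2 and A = "{1, 3}"])
       (simp_all add: generated_singleton uniform_def vertex_decomposable.simplex)
  then show ?thesis by (simp add: insert_commute)
qed

lemma vertex_decomposable_path_3: "vertex_decomposable (generated {{1, 3}, {3, 4}, {4, 6::nat}})"
proof -
  have "vertex_decomposable (generated (insert (insert 6 {4}) {{1, 3}, {3, 4::nat}}))"
    by (rule vertex_decomposable_add_facet[where c = 2 and A = "{3, 4}", OF vertex_decomposable_path_2])
       (simp_all add: uniform_def)
  then show ?thesis by (simp add: insert_commute)
qed

lemma vertex_decomposable_strip_2: "vertex_decomposable (generated {{3, 4, 5}, {1, 3, 5::nat}})"
proof -
  have "vertex_decomposable (generated (insert (insert 4 {3, 5}) {{1, 3, 5::nat}}))"
    by (rule vertex_decomposable_add_facet[where c = 3 and A = "{1, 3, 5}"])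
       (simp_all add: generated_singleton uniform_def vertex_decomposable.simplex)
  then show ?thesis by (simp add: insert_commute)
qed

lemma vertex_decomposable_strip_3: "vertex_decomposable (generated {{3, 4, 5}, {4, 5, 6}, {1, 3, 5::nat}})"
proof -
  have "vertex_decomposable (generated (insert (insert 6 {4, 5}) {{3, 4, 5}, {1, 3, 5::nat}}))"
    by (rule vertex_decomposable_add_facet[where c = 3 and A = "{3, 4, 5}", OF vertex_decomposable_strip_2])
       (simp_all add: uniform_def)
  then show ?thesis by (simp add: insert_commute)
qed

lemma vertex_decomposable_vdW_5_2: "vertex_decomposable (vdW 5 2)"
proof -
  let ?A = "{{1, 2, 3}, {2, 3, 4}, {3, 4, 5}, {1, 3, 5}} :: nat set set"
  have prog: "progressions 5 2 = ?A"
  proof (intro equalityI subsetI)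
    fix A assume "A \<in> progressions 5 2"
    then obtain i d where A: "A = {i, i + d, i + 2 * d}" "1 \<le> i" "1 \<le> d" "i + 2 * d \<le> 5"
      unfolding progressions_2 by blast
    then consider "d = 1" "i = 1" | "d = 1" "i = 2" | "d = 1" "i = 3" | "d = 2" "i = 1" by linarith
    then show "A \<in> ?A" by cases (simp_all add: A(1) numeral_eq_Suc)
  next
    fix A assume A: "A \<in> ?A"
    have "{1, 2, 3} \<in> progressions 5 2"
      "{2, 3, 4} \<in> progressions 5 2"
      "{3, 4, 5} \<in> progressions 5 2"
      "{1, 3, 5} \<in> progressions 5 2"
      using progressions_2I[of 1 1 5] progressions_2I[of 2 1 5] progressions_2I[of 3 1 5] progressions_2I[of 1 2 5]
      by (simp_all add: numeral_eq_Suc)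
    then show "A \<in> progressions 5 2" using A by (elim insertE emptyE) simp_all
  qed
  let ?B = "{{1, 2, 3}, {2, 3, 4}} :: nat set set" and ?C = "{{3, 4, 5}, {1, 3, 5}} :: nat set set"
  have "vertex_decomposable (generated (?B \<union> ?C))"
  proof (rule vertex_decomposable_generated_Un[where c = 3 and x = 2])
    show "vertex_decomposable (generated ((\<lambda>A. A - {2}) ` ?B))"
      using vertex_decomposable_path_2 by (simp add: insert_Diff_if)
    show "vertex_decomposable (generated ?C)" by (rule vertex_decomposable_strip_2)
  qed (simp_all add: uniform_def insert_Diff_if)
  moreover have "?B \<union> ?C = ?A" by (simp only: Un_insert_left Un_empty_left)
  ultimately show ?thesis by (simp only: vdW_generated prog)
qed

lemma vertex_decomposable_vdW_6_2: "vertex_decomposable (vdW 6 2)"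
proof -
  let ?A = "{{1, 2, 3}, {2, 3, 4}, {2, 4, 6}, {3, 4, 5}, {4, 5, 6}, {1, 3, 5}} :: nat set set"
  have prog: "progressions 6 2 = ?A"
  proof (intro equalityI subsetI)
    fix A assume "A \<in> progressions 6 2"
    then obtain i d where A: "A = {i, i + d, i + 2 * d}" "1 \<le> i" "1 \<le> d" "i + 2 * d \<le> 6"
      unfolding progressions_2 by blast
    consider "d = 1" | "d = 2" using A(2-4) by linarith
    then show "A \<in> ?A"
    proof cases
      case 1
      then consider "i = 1" | "i = 2" | "i = 3" | "i = 4" using A(2,4) by linarith
      then show ?thesis by cases (simp_all add: A(1) 1 numeral_eq_Suc)
    next
      case 2
      then consider "i = 1" | "i = 2" using A(2,4) by linarith
      then show ?thesis by cases (simp_all add: A(1) 2 numeral_eq_Suc)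
    qed
  next
    fix A assume A: "A \<in> ?A"
    have "{1, 2, 3} \<in> progressions 6 2"
      "{2, 3, 4} \<in> progressions 6 2"
      "{3, 4, 5} \<in> progressions 6 2"
      "{4, 5, 6} \<in> progressions 6 2"
      "{1, 3, 5} \<in> progressions 6 2"
      "{2, 4, 6} \<in> progressions 6 2"
      using progressions_2I[of 1 1 6] progressions_2I[of 2 1 6] progressions_2I[of 3 1 6] progressions_2I[of 4 1 6] progressions_2I[of 1 2 6] progressions_2I[of 2 2 6]
      by (simp_all add: numeral_eq_Suc)
    then show "A \<in> progressions 6 2" using A by (elim insertE emptyE) simp_all
  qed
  let ?B = "{{1, 2, 3}, {2, 3, 4}, {2, 4, 6}} :: nat set set" and ?C = "{{3, 4, 5}, {4, 5, 6}, {1, 3, 5}} :: nat set set"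
  have "vertex_decomposable (generated (?B \<union> ?C))"
  proof (rule vertex_decomposable_generated_Un[where c = 3 and x = 2])
    show "vertex_decomposable (generated ((\<lambda>A. A - {2}) ` ?B))"
      using vertex_decomposable_path_3 by (simp add: insert_Diff_if)
    show "vertex_decomposable (generated ?C)" by (rule vertex_decomposable_strip_3)
  qed (simp_all add: uniform_def insert_Diff_if)
  moreover have "?B \<union> ?C = ?A" by (simp only: Un_insert_left Un_empty_left)
  ultimately show ?thesis by (simp only: vdW_generated prog)
qed

lemma vertex_decomposable_vdW:
  assumes "0 < k" "k < n" "n \<le> 6 \<or> k = 1 \<or> n \<le> 2 * k"
  shows "vertex_decomposable (vdW n k)"
proof -
  \<comment> \<open>With \<open>n \<le> 6\<close>, \<open>k \<ge> 2\<close> and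
    \<open>2 * k < n\<close>, only \<open>k = 2\<close> with \<open>n = 5\<close> or
    \<open>n = 6\<close> remains.\<close>
  consider "k = 1" | "n \<le> 2 * k" | "k = 2" "n = 5" | "k = 2" "n = 6" using assms by linarith
  then show ?thesis
    using assms vertex_decomposable_vdW_1 vertex_decomposable_vdW_large
      vertex_decomposable_vdW_5_2 vertex_decomposable_vdW_6_2 by cases auto
qed

section \<open>Disconnected links in van der Waerden complexes\<close>

lemma vdW_vertices: "\<Union>(vdW n k) \<subseteq> {1..n}"
proof
  fix x assume "x \<in> \<Union>(vdW n k)"
  then obtain i d j where "x = i + j * d" "j \<le> k" "1 \<le> i" "i + k * d \<le> n"
    by (auto simp: vdW_def progressions_def)
  moreover from this have "j * d \<le> k * d" by simp
  ultimately show "x \<in> {1..n}" unfolding atLeastAtMost_iff by linarith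
qed

lemma progression_in_vdW:
  assumes "1 \<le> i" "1 \<le> d" "0 < k" "i + k * d \<le> n" "F \<subseteq> (\<lambda>j. i + j * d) ` {0..k}"
  shows "F \<in> vdW n k"
proof -
  have "0 < k * d" using assms(2,3) by simp
  then have "i < i + k * d" by simp
  then show ?thesis using assms unfolding vdW_def progressions_def by blast
qed

lemma faceE:
  assumes "F \<in> vdW n k"
  obtains i d where "F \<subseteq> (\<lambda>j. i + j * d) ` {0..k}" "1 \<le> i" "1 \<le> d" "i + k * d \<le> n"
proof -
  obtain i d where "F \<subseteq> (\<lambda>j. i + j * d) ` {0..k}" "1 \<le> i" "i < i + k * d" "i + k * d \<le> n"
    using assms unfolding vdW_def progressions_def by blast
  moreover from this have "1 \<le> d" by (cases d) auto
  ultimately show thesis using that by blast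
qed

text \<open>The set \<open>W\<close> separates the vertices of the link of \<open>G\<close>, and
  \<open>E\<close> ensures that this link has an edge. By Reisner's criterion links of positive
  dimension in Cohen-Macaulay complexes are connected.\<close>

definition has_disconnected_link :: "'v set set \<Rightarrow> bool" where
  "has_disconnected_link \<Delta> \<longleftrightarrow> (\<exists>G E W w w'. E \<in> \<Delta> \<and> G \<subseteq> E \<and> card G + 2 \<le> card E \<and>
    (\<forall>F\<in>\<Delta>. G \<subseteq> F \<longrightarrow> F - G \<subseteq> W \<or> (F - G) \<inter> W = {}) \<and>
    insert w G \<in> \<Delta> \<and> w \<notin> G \<and> w \<in> W \<and> insert w' G \<in> \<Delta> \<and> w' \<notin> G \<and> w' \<notin> W)"

lemma has_disconnected_linkI:
  assumes "E \<in> \<Delta>" "G \<subseteq> E" "card G + 2 \<le> card E"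
    and "\<And>F. F \<in> \<Delta> \<Longrightarrow> G \<subseteq> F \<Longrightarrow> F - G \<subseteq> W \<or> (F - G) \<inter> W = {}"
    and "insert w G \<in> \<Delta>" "w \<notin> G" "w \<in> W" "insert w' G \<in> \<Delta>" "w' \<notin> G" "w' \<notin> W"
  shows "has_disconnected_link \<Delta>"
  unfolding has_disconnected_link_def
  by (intro exI[of _ G] exI[of _ E] exI[of _ W] exI[of _ w] exI[of _ w'] conjI ballI impI) (fact assms | rule assms, assumption+)+

text \<open>The only facets containing \<open>{1, 3, \<dots>, 1 + 2 \<lfloor>k/2\<rfloor>}\<close> are the progressions of differences
  \<open>1\<close> and \<open>2\<close> starting at \<open>1\<close>, and they meet exactly in this set.\<close>

lemma disconnected_link_vdW:
  assumes "3 \<le> k" "2 * k < n"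
  shows "has_disconnected_link (vdW n k)"
proof -
  let ?m = "k div 2"
  let ?G = "(\<lambda>j. 1 + 2 * j) ` {0..?m}"
  let ?E = "(\<lambda>j. 1 + j * 1) ` {0..k}"
  \<comment> \<open>Outside \<open>?G\<close>, difference 1 contributes only even numbers and
    difference 2 only odd ones.\<close>
  let ?W = "{a :: nat. even a}"
  have G: "a \<in> ?G \<longleftrightarrow> odd a \<and> a \<le> k + 1" for a
  proof
    assume "odd a \<and> a \<le> k + 1"
    then have "a = 1 + 2 * (a div 2)" "a div 2 \<le> ?m" by (auto elim!: oddE)
    then show "a \<in> ?G" by (metis atLeastAtMost_iff image_eqI le0)
  qed auto
  have E: "a \<in> ?E \<longleftrightarrow> 1 \<le> a \<and> a \<le> k + 1" for a
    by (auto intro!: image_eqI[of _ _ "a - 1"])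
  have GE: "?G \<subseteq> ?E" using G E by (auto elim!: oddE)
  have "card ?G = ?m + 1" by (subst card_image) (auto simp: inj_on_def)
  moreover have "card ?E = k + 1" by (subst card_image) (auto simp: inj_on_def)
  \<comment> \<open>This count fails for \<open>k = 2\<close>, where \<open>?G\<close> would be
    \<open>{1, 3}\<close> in a facet of three elements.\<close>
  ultimately have card: "card ?G + 2 \<le> card ?E" using assms(1) by presburger
  have EvdW: "F \<in> vdW n k" if "F \<subseteq> ?E" for F
    using assms that by (intro progression_in_vdW[of 1 1]) auto
  have w: "insert 2 ?G \<in> vdW n k" using GE E[of 2] assms(1) by (intro EvdW) auto
  \<comment> \<open>The first odd number beyond \<open>?G\<close>. The progression of difference 2
    from 1 ends at \<open>1 + 2 * k\<close>, which \<open>2 * k < n\<close> admits.\<close>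
  have "insert (2 * ?m + 3) ?G \<subseteq> (\<lambda>j. 1 + j * 2) ` {0..k}"
  proof
    fix a assume "a \<in> insert (2 * ?m + 3) ?G"
    then have "a = 2 * ?m + 3 \<or> odd a \<and> a \<le> k + 1" by (simp only: insert_iff G)
    then have "a = 1 + (a div 2) * 2" "a div 2 \<le> k" using assms(1) by presburger+
    then show "a \<in> (\<lambda>j. 1 + j * 2) ` {0..k}" by (intro image_eqI[of _ _ "a div 2"]) auto
  qed
  then have w': "insert (2 * ?m + 3) ?G \<in> vdW n k"
    using assms by (intro progression_in_vdW[of 1 2]) auto
  have w'G: "2 * ?m + 3 \<notin> ?G" unfolding G by presburger
  have disj: "F - ?G \<subseteq> ?W \<or> (F - ?G) \<inter> ?W = {}" if F: "F \<in> vdW n k" "?G \<subseteq> F" for F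
  proof -
    obtain i d where id: "F \<subseteq> (\<lambda>j. i + j * d) ` {0..k}" "1 \<le> i" "1 \<le> d" using faceE[OF F(1)] .
    \<comment> \<open>The vertex 1 pins down the start of the progression, and then the vertex 3
      forces its difference to divide 2.\<close>
    have "1 \<in> F" "3 \<in> F" using F(2) G[of 1] G[of 3] assms(1) by auto
    then obtain j1 j3 where j: "1 = i + j1 * d" "3 = i + j3 * d" using id(1) by blast
    have i1: "i = 1" using j(1) id(2) by linarith
    then have "j3 * d = 2" using j(2) by linarith
    then have "d dvd 2" by (metis dvd_triv_right)
    then have "d \<le> 2" by (rule dvd_imp_le) simp
    then consider "d = 1" | "d = 2" using id(3) by linarith
    then show ?thesis
    proof cases
      case 1
      have "even c" if "c \<in> F - ?G" for c
      proof -
        have "c \<le> k + 1" using id(1) that 1 i1 by auto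
        then show ?thesis using that G[of c] by blast
      qed
      then show ?thesis by auto
    next
      case 2
      have "odd c" if "c \<in> F" for c using id(1) that 2 i1 by auto
      then show ?thesis by auto
    qed
  qed
  have "2 \<notin> ?G" "2 \<in> ?W" "2 * ?m + 3 \<notin> ?W" unfolding G by simp_all
  then show ?thesis
    using has_disconnected_linkI[OF EvdW[OF order_refl] GE card disj w _ _ w' w'G] by blast
qed

text \<open>The edges of the link of the vertex \<open>1\<close> are the pairs \<open>{1 + d, 1 + 2 d}\<close>.\<close>

lemma disconnected_link_vdW_2:
  assumes "6 < n"
  shows "has_disconnected_link (vdW n 2)"
proof -
  \<comment> \<open>An edge joins the offsets \<open>d\<close> and \<open>2 * d\<close> from the
    vertex 1. Powers of two are closed under doubling and halving within the edges, and they
    separate the offset 1 from the offset 3.\<close>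
  let ?W = "{1 + 2 ^ j | j :: nat. True} :: nat set"
  have three: "{0..2::nat} = {0, 1, 2}" by auto
  have double: "1 + 2 * d \<in> ?W \<longleftrightarrow> 1 + d \<in> ?W" for d
  proof
    assume "1 + 2 * d \<in> ?W"
    then obtain j where j: "2 * d = 2 ^ j" by auto
    then have "j \<noteq> 0" by (intro notI) simp
    then obtain j' where "j = Suc j'" using not0_implies_Suc by blast
    then have "d = 2 ^ j'" using j by simp
    then show "1 + d \<in> ?W" by blast
  next
    assume "1 + d \<in> ?W"
    then obtain j where "d = 2 ^ j" by auto
    then have "2 * d = 2 ^ Suc j" by simp
    then show "1 + 2 * d \<in> ?W" by (intro CollectI exI[of _ "Suc j"]) simp
  qed
  have prog: "F \<in> vdW n 2" if "F \<subseteq> {1, 1 + d, 1 + 2 * d}" "1 \<le> d" "1 + 2 * d \<le> n" for F d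
    using that by (intro progression_in_vdW[of 1 d]) (auto simp: three)
  have E: "{1, 2, 3} \<in> vdW n 2" using prog[of "{1, 2, 3}" 1] assms by simp
  have w: "insert 2 {1} \<in> vdW n 2" using prog[of "insert 2 {1}" 1] assms by simp
  \<comment> \<open>The progression 1, 4, 7 is where \<open>6 < n\<close> enters.\<close>
  have w': "insert 4 {1} \<in> vdW n 2" using prog[of "insert 4 {1}" 3] assms by simp
  have 2: "2 \<in> ?W" by (auto intro!: exI[of _ 0])
  have 4: "4 \<notin> ?W"
  proof
    assume "4 \<in> ?W"
    then obtain j where j: "(3::nat) = 2 ^ j" by auto
    have "odd (2 ^ j :: nat)" unfolding j[symmetric] by simp
    then have "j = 0" by simp
    then show False using j by simp
  qed
  have disj: "F - {1} \<subseteq> ?W \<or> (F - {1}) \<inter> ?W = {}" if F: "F \<in> vdW n 2" "{1} \<subseteq> F" for F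
  proof -
    obtain i d where id: "F \<subseteq> (\<lambda>j. i + j * d) ` {0..2}" "1 \<le> i" "1 \<le> d" using faceE[OF F(1)] .
    obtain j where "1 = i + j * d" using F(2) id(1) by blast
    then have "i = 1" using id(2) by linarith
    then have F': "F \<subseteq> {1, 1 + d, 1 + 2 * d}" using id(1) by (simp add: three)
    have "c \<in> ?W \<longleftrightarrow> 1 + d \<in> ?W" if c: "c \<in> F - {1}" for c
    proof -
      have "c = 1 + d \<or> c = 1 + 2 * d" using F' c by auto
      then show ?thesis using double[of d] by (elim disjE) (simp_all only:)
    qed
    then show ?thesis by (cases "1 + d \<in> ?W") (simp_all only: subset_iff disjoint_iff, simp_all)
  qed
  show ?thesis
    by (rule has_disconnected_linkI[OF E _ _ disj w _ 2 w' _ 4]) auto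
qed

section \<open>Cohen-Macaulayness of van der Waerden complexes\<close>

theorem Cohen_Macaulay_vdW:
  assumes "vertex_decomposable (vdW n k)"
  shows "Cohen_Macaulay_over TYPE('k::field) {1..n} (vdW n k)"
  unfolding Cohen_Macaulay_over_def
proof (rule Cohen_Macaulay_vertex_decomposable[OF _ vdW_vertices assms])
  fix F assume "F \<in> facets (vdW n k)"
  then show "card F = k + 1" using progressions_finite_card unfolding facets_vdW by blast
qed simp

theorem not_Cohen_Macaulay_vdW:
  assumes "6 < n" "2 \<le> k" "2 * k < n"
  shows "\<not> Cohen_Macaulay_over TYPE('k::field) {1..n} (vdW n k)"
proof -
  have "has_disconnected_link (vdW n k)"
  proof (cases "k = 2")
    case True
    show ?thesis unfolding True by (rule disconnected_link_vdW_2[OF assms(1)])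
  next
    case False
    then show ?thesis using assms by (intro disconnected_link_vdW) auto
  qed
  then obtain G E W w w' where E: "E \<in> vdW n k" "G \<subseteq> E" "card G + 2 \<le> card E"
    and disj: "\<forall>F\<in>vdW n k. G \<subseteq> F \<longrightarrow> F - G \<subseteq> W \<or> (F - G) \<inter> W = {}"
    and w: "insert w G \<in> vdW n k" "w \<notin> G" "w \<in> W" and w': "insert w' G \<in> vdW n k" "w' \<notin> G" "w' \<notin> W"
    unfolding has_disconnected_link_def by (elim exE conjE)
  show ?thesis
    unfolding Cohen_Macaulay_over_def
  proof (rule not_Cohen_Macaulay_disconnected_link[OF _ vdW_vertices simplicial_complex_vdW E _ w w'])
    show "a \<in> W \<longleftrightarrow> b \<in> W" if "F \<in> vdW n k" "G \<subseteq> F" "a \<in> F - G" "b \<in> F - G" for F a b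
      using disj[rule_format, OF that(1,2)] that(3,4) by auto
  qed simp
qed

theorem theorem1p1:
  fixes n k :: nat
  assumes "0 < k" and "k < n"
  shows "(vertex_decomposable (vdW n k) \<longleftrightarrow>
            n \<le> 6 \<or> (n > 6 \<and> k = 1) \<or> (n > 6 \<and> real n / 2 \<le> real k \<and> k < n)) \<and>
         (pure_complex (vdW n k) \<and> \<not> Cohen_Macaulay_over TYPE('k::field) {1..n} (vdW n k) \<longleftrightarrow>
            n > 6 \<and> 2 \<le> k \<and> real k < real n / 2)"
proof -
  have real_iff: "real n / 2 \<le> real k \<longleftrightarrow> n \<le> 2 * k" "real k < real n / 2 \<longleftrightarrow> 2 * k < n" by linarith+
  have pure: "pure_complex (vdW n k)" unfolding vdW_generated by (rule pure_generated[OF uniform_progressions])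
  have vd: "vertex_decomposable (vdW n k)" if "n \<le> 6 \<or> k = 1 \<or> n \<le> 2 * k"
    using vertex_decomposable_vdW[OF assms that] .
  have cm: "Cohen_Macaulay_over TYPE('k) {1..n} (vdW n k)" if "vertex_decomposable (vdW n k)"
    using Cohen_Macaulay_vdW[OF that] .
  have not_cm: "\<not> Cohen_Macaulay_over TYPE('k) {1..n} (vdW n k)" if "6 < n" "2 \<le> k" "2 * k < n"
    using not_Cohen_Macaulay_vdW[OF that] .
  \<comment> \<open>The two ranges are complementary. Vertex decomposability implies
    Cohen-Macaulayness, which fails on the second range, so each property is decided on
    both.\<close>
  have "n \<le> 6 \<or> k = 1 \<or> n \<le> 2 * k \<longleftrightarrow> \<not> (6 < n \<and> 2 \<le> k \<and> 2 * k < n)" using assms by linarith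
  then show ?thesis unfolding real_iff using pure vd cm not_cm assms(2) by (smt (verit) not_le)
qed

end
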